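(* Let $p$ be an odd prime, $n\ge2$, $\eta$ trivial or $\eta=\left(\frac{\cdot}{p}\right)$, and let $\lambda\in\mathbb Z_p^\times$ satisfy $\left(\frac{\lambda}{p}\right)=-1$. The algebra $H(\overline K//\overline{K_n},\eta)$ is a commutative algebra of dimension $2n$ with generators (indeed basis) $\mathcal I,\ \mathcal U_0,\ \mathcal V_{i,1},\ \mathcal V_{i,\lambda}$ ($1\le i\le n-1$), where $\mathcal I$ is the identity, and relations as follows, where $\mathcal V_j=\mathcal V_{j,1}+\mathcal V_{j,\lambda}$, $\mathcal Y_r=\mathcal I+\sum_{j=r}^{n-1}\mathcal V_j$ for $1\le r\le n-1$ and $\mathcal Y_n=\mathcal I$. (a) For $1\le r\le n-1$, if $p\equiv1\pmod 4$: $$\mathcal V_{r,1}*\mathcal V_{r,1}=\tfrac{p-1}{2}p^{n-r-1}\mathcal Y_{r+1}+\tfrac{p-5}{4}p^{n-r-1}\mathcal V_{r,1}+\tfrac{p-1}{4}p^{n-r-1}\mathcal V_{r,\lambda},$$ $$\mathcal V_{r,\lambda}*\mathcal V_{r,\lambda}=\tfrac{p-1}{2}p^{n-r-1}\mathcal Y_{r+1}+\tfrac{p-1}{4}p^{n-r-1}\mathcal V_{r,1}+\tfrac{p-5}{4}p^{n-r-1}\mathcal V_{r,\lambda},$$ $$\mathcal V_{r,1}*\mathcal V_{r,\lambda}=\mathcal V_{r,\lambda}*\mathcal V_{r,1}=\tfrac{p-1}{4}p^{n-r-1}(\mathcal V_{r,1}+\mathcal V_{r,\lambda});$$ if $p\equiv3\pmod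 4$: $$\mathcal V_{r,1}*\mathcal V_{r,1}=\tfrac{p-3}{4}p^{n-r-1}\mathcal V_{r,1}+\tfrac{p+1}{4}p^{n-r-1}\mathcal V_{r,\lambda},$$ $$\mathcal V_{r,\lambda}*\mathcal V_{r,\lambda}=\tfrac{p+1}{4}p^{n-r-1}\mathcal V_{r,1}+\tfrac{p-3}{4}p^{n-r-1}\mathcal V_{r,\lambda},$$ $$\mathcal V_{r,1}*\mathcal V_{r,\lambda}=\mathcal V_{r,\lambda}*\mathcal V_{r,1}=\tfrac{p-1}{2}p^{n-r-1}\mathcal Y_{r+1}+\tfrac{p-3}{4}p^{n-r-1}(\mathcal V_{r,1}+\mathcal V_{r,\lambda}).$$ (b) For $1\le r<j\le n-1$ and $\mu,\delta\in\{1,\lambda\}$: $\mathcal V_{r,\mu}*\mathcal V_{j,\delta}=\mathcal V_{j,\delta}*\mathcal V_{r,\mu}=\tfrac{p-1}{2}p^{n-j-1}\mathcal V_{r,\mu}$. (c) If $\eta=1$ then $\mathcal U_0*\mathcal U_0=p^n\mathcal Y_1+p^{n-1}(p-1)\,\mathcal U_0$; if $\eta\ne1$ then $\mathcal U_0*\mathcal U_0=\eta(-1)p^n\mathcal Y_1$. (d) For $1\le r\le n-1$ and $\delta\in\{1,\lambda\}$: $\mathcal U_0*\mathcal V_{r,\delta}=\mathcal V_{r,\delta}*\mathcal U_0=\tfrac{p-1}{2}p^{n-r-1}\mathcal U_0$.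
   Context: Let $G=\mathrm{SL}_2(\mathbb Q_p)$, $K=\mathrm{SL}_2(\mathbb Z_p)$ and $K_n=K_0(p^n)=\{\begin{pmatrix}a&b\\ c&d\end{pmatrix}\in K: c\in p^n\mathbb Z_p\}$. $(\cdot,\cdot)_p$ is the quadratic Hilbert symbol of $\mathbb Q_p$. For $A=\begin{pmatrix}a&b\\ c&d\end{pmatrix}$ put $\tau(A)=c$ if $c\neq0$ and $\tau(A)=d$ if $c=0$; for $g\in G$ put $s_p(g)=(c,d)_p$ if $cd\ne0$ and $\mathrm{ord}_p(c)$ is odd, and $s_p(g)=1$ otherwise. Put $\sigma_0(g,h)=(\tau(gh)\tau(g),\tau(gh)\tau(h))_p$ and $c(g,h)=\sigma_0(g,h)s_p(g)s_p(h)s_p(gh)$. The metaplectic double cover $\widetilde G$ is $G\times\{\pm1\}$ with $(g,\epsilon_1)(h,\epsilon_2)=(gh,\epsilon_1\epsilon_2c(g,h))$; $\overline S$ denotes the full inverse image of a subgroup $S\subset G$. For odd $p$ the cover splits over $K$ by $k\mapsto(k,1)$, so $\overline K\cong K\times\{\pm1\}$. $\eta$ is viewed as the character $\begin{pmatrix}a&b\\ c&d\end{pmatrix}\mapsto\eta(d)$ of $K_n$, and as the genuine character $\eta((A,\epsilon))=\epsilon\,\eta(A)$ of $\overline{K_n}$. $H(\overline K//\overline{K_n},\eta)$ is the space of $f\in C_c^\infty(\widetilde G)$ supported on $\overline K$ with $f(\tilde k\tilde g\tilde k')=\overline{\eta}(\tilde k)\overline{\eta}(\tilde k')f(\tilde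 g)$ for $\tilde k,\tilde k'\in\overline{K_n}$, with product the convolution $f_1*f_2(\tilde h)=\int_{\widetilde G}f_1(\tilde g)f_2(\tilde g^{-1}\tilde h)\,d\tilde g$, Haar measure normalized by $\mathrm{vol}(\overline{K_n})=1$. Put $y(s)=\begin{pmatrix}1&0\\ s&1\end{pmatrix}$, $w(1)=\begin{pmatrix}0&1\\ -1&0\end{pmatrix}$. $\mathcal I$, $\mathcal U_0$, $\mathcal V_{r,a}$ ($1\le r\le n-1$, $a\in\mathbb Z_p^\times$) are the elements of $H$ supported on the $\overline{K_n}$-double cosets of $(I,1)$, $(w(1),1)$, $(y(ap^r),1)$ respectively, each with value $1$ at that representative. *)

theory Defs
  imports
    "HOL-Analysis.Analysis"
    "HOL-Algebra.Module"
    "HOL-Algebra.Algebraic_Closure_Type"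
    "HOL-Number_Theory.Number_Theory"
    "HOL-Computational_Algebra.Polynomial_Factorial"
    "HOL-Library.Function_Algebras"
    "Berlekamp_Zassenhaus.Finite_Field"
begin

section \<open>The p-adic integers and the p-adic numbers\<close>

text \<open>
  The prime is p = CARD('p) for a type 'p of class prime_card. The ring of p-adic integers is
  the inverse limit of the rings of integers mod p^k, with canonical representatives; the field
  of p-adic numbers is its field of fractions.
\<close>

typedef (overloaded) ('p::prime_card) padic_int =
  "{x :: nat \<Rightarrow> int. \<forall>k. x k \<in> {0..<int CARD('p) ^ k} \<and>
     x (Suc k) mod int CARD('p) ^ k = x k}"
  morphisms padic_coord Abs_padic_int
  using prime_card[where 'a = 'p] by (intro exI[of _ "\<lambda>_. 0"]) (auto simp: prime_gt_0_nat)

setup_lifting type_definition_padic_int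

lemma card_pos [simp]: "0 < int CARD('p::prime_card)"
  using prime_card[where 'a = 'p] by (simp add: prime_gt_0_nat)

lemma padic_coord_mod [simp]:
  "padic_coord (x :: 'p::prime_card padic_int) k mod int CARD('p) ^ k = padic_coord x k"
  using padic_coord[of x] by auto

lemma padic_coord_Suc_mod:
  "padic_coord (x :: 'p::prime_card padic_int) (Suc k) mod int CARD('p) ^ k = padic_coord x k"
  using padic_coord[of x] by auto

lemma padic_coord_Suc_cong:
  "[padic_coord (x :: 'p::prime_card padic_int) (Suc k) = padic_coord x k] (mod int CARD('p) ^ k)"
  unfolding cong_def by (simp add: padic_coord_Suc_mod)

lemma padic_coord_add_mod:
  "padic_coord (x :: 'p::prime_card padic_int) (k + m) mod int CARD('p) ^ k = padic_coord x k"
proof (induction m)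
  case (Suc m)
  have "padic_coord x (k + Suc m) mod int CARD('p) ^ k =
      padic_coord x (Suc (k + m)) mod int CARD('p) ^ (k + m) mod int CARD('p) ^ k"
    by (simp add: mod_mod_cancel le_imp_power_dvd)
  then show ?case
    using Suc by (simp add: padic_coord_Suc_mod)
qed simp

lemma coherent_mod:
  fixes f :: "nat \<Rightarrow> int"
  assumes "\<And>k. [f (Suc k) = f k] (mod int CARD('p::prime_card) ^ k)"
  shows "f k mod int CARD('p) ^ k \<in> {0..<int CARD('p) ^ k} \<and>
    (f (Suc k) mod int CARD('p) ^ Suc k) mod int CARD('p) ^ k = f k mod int CARD('p) ^ k"
proof -
  have "(f (Suc k) mod int CARD('p) ^ Suc k) mod int CARD('p) ^ k = f (Suc k) mod int CARD('p) ^ k"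
    by (rule mod_mod_cancel) (simp add: le_imp_power_dvd)
  then show ?thesis
    using assms[of k] by (auto simp: cong_def)
qed

instantiation padic_int :: (prime_card) comm_ring_1
begin

lift_definition zero_padic_int :: "'a padic_int" is "\<lambda>_. 0"
  by simp

lift_definition one_padic_int :: "'a padic_int" is "\<lambda>k. 1 mod int CARD('a) ^ k"
  by (rule coherent_mod) simp

lift_definition plus_padic_int :: "'a padic_int \<Rightarrow> 'a padic_int \<Rightarrow> 'a padic_int"
  is "\<lambda>x y k. (x k + y k) mod int CARD('a) ^ k"
  by (rule coherent_mod) (auto simp: cong_def intro!: mod_add_cong)

lift_definition times_padic_int :: "'a padic_int \<Rightarrow> 'a padic_int \<Rightarrow> 'a padic_int"
  is "\<lambda>x y k. (x k * y k) mod int CARD('a) ^ k"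
  by (rule coherent_mod) (auto simp: cong_def intro!: mod_mult_cong)

lift_definition uminus_padic_int :: "'a padic_int \<Rightarrow> 'a padic_int"
  is "\<lambda>x k. (- x k) mod int CARD('a) ^ k"
  by (rule coherent_mod) (auto simp: cong_def intro!: mod_minus_cong)

lift_definition minus_padic_int :: "'a padic_int \<Rightarrow> 'a padic_int \<Rightarrow> 'a padic_int"
  is "\<lambda>x y k. (x k - y k) mod int CARD('a) ^ k"
  by (rule coherent_mod) (auto simp: cong_def intro!: mod_diff_cong)

instance
proof
  fix a b c :: "'a padic_int"
  show "a * b * c = a * (b * c)"
    by transfer (simp add: fun_eq_iff mod_mult_left_eq mod_mult_right_eq mult.assoc)
  show "a * b = b * a"
    by transfer (simp add: mult.commute)
  show "1 * a = a"
    by transfer (auto simp: fun_eq_iff mod_mult_left_eq)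
  show "a + b + c = a + (b + c)"
    by transfer (simp add: fun_eq_iff mod_add_left_eq mod_add_right_eq add.assoc)
  show "a + b = b + a"
    by transfer (simp add: add.commute)
  show "0 + a = a"
    by transfer (auto simp: fun_eq_iff)
  show "- a + a = 0"
    by transfer (auto simp: fun_eq_iff mod_add_left_eq)
  show "a - b = a + - b"
    by transfer (simp add: fun_eq_iff mod_add_right_eq)
  show "(a + b) * c = a * c + b * c"
    by transfer (simp add: fun_eq_iff mod_mult_left_eq mod_add_eq distrib_right)
  show "(0 :: 'a padic_int) \<noteq> 1"
  proof
    assume "(0 :: 'a padic_int) = 1"
    then have "padic_coord (0 :: 'a padic_int) 1 = padic_coord (1 :: 'a padic_int) 1"
      by simp
    then have "(1::int) mod int CARD('a) = 0"
      by (simp add: zero_padic_int.rep_eq one_padic_int.rep_eq)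
    then show False
      using prime_gt_1_nat[OF prime_card[where 'a = 'a]] by simp
  qed
qed

end

instance padic_int :: (prime_card) idom
proof
  fix a b :: "'a padic_int"
  let ?p = "int CARD('a)"
  assume "a \<noteq> 0" "b \<noteq> 0"
  have nz: "\<exists>k. padic_coord x k \<noteq> 0" if "x \<noteq> 0" for x :: "'a padic_int"
    using that by (auto simp: padic_coord_inject[symmetric] zero_padic_int.rep_eq fun_eq_iff)
  obtain k where k: "padic_coord a k \<noteq> 0" using nz[OF \<open>a \<noteq> 0\<close>] by blast
  obtain m where m: "padic_coord b m \<noteq> 0" using nz[OF \<open>b \<noteq> 0\<close>] by blast
  let ?x = "padic_coord a (k + m)" and ?y = "padic_coord b (k + m)"
  have x: "\<not> ?p ^ k dvd ?x"
    using k padic_coord_add_mod[of a k m] by (simp add: dvd_eq_mod_eq_0)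
  have y: "\<not> ?p ^ m dvd ?y"
    using m padic_coord_add_mod[of b m k] by (simp add: dvd_eq_mod_eq_0 add.commute)
  have p: "Factorial_Ring.prime ?p"
    using prime_card[where 'a = 'a] by simp
  have x0: "?x \<noteq> 0" and y0: "?y \<noteq> 0" using x y by auto
  have nu: "\<not> ?p dvd 1" using p not_prime_unit by blast
  have "multiplicity ?p ?x < k" "multiplicity ?p ?y < m"
    using x y x0 y0 nu by (meson multiplicity_dvd' not_le)+
  then have "multiplicity ?p (?x * ?y) < k + m"
    using prime_elem_multiplicity_mult_distrib[OF prime_imp_prime_elem[OF p] x0 y0] by simp
  then have "\<not> ?p ^ (k + m) dvd ?x * ?y"
    using power_dvd_iff_le_multiplicity[OF _ nu, of "?x * ?y" "k + m"] x0 y0 by simp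
  then have "padic_coord (a * b) (k + m) \<noteq> 0"
    by (simp add: times_padic_int.rep_eq dvd_eq_mod_eq_0)
  then show "a * b \<noteq> 0"
    by (auto simp: zero_padic_int.rep_eq)
qed

type_synonym 'p padic = "'p padic_int fract"

text \<open>The ideal \<open>p\<^sup>k\<close> times the ring of p-adic integers, inside the field of p-adic numbers.\<close>

definition padic_ideal :: "nat \<Rightarrow> 'p::prime_card padic set" where
  "padic_ideal k = range (\<lambda>a. of_nat CARD('p) ^ k * to_fract a)"

definition padic_ord :: "'p::prime_card padic \<Rightarrow> int" where
  "padic_ord x = (THE k. \<exists>u. u dvd 1 \<and> x = of_nat CARD('p) powi k * to_fract u)"

definition legendre_char :: "'p::prime_card padic_int \<Rightarrow> complex" where
  "legendre_char a = of_int (Legendre (padic_coord a 1) (int CARD('p)))"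

definition hilbert_symbol :: "'p::prime_card padic \<Rightarrow> 'p padic \<Rightarrow> int" where
  "hilbert_symbol a b =
    (if \<exists>x y z. (x, y, z) \<noteq> (0, 0, 0) \<and> z\<^sup>2 = a * x\<^sup>2 + b * y\<^sup>2 then 1 else -1)"


section \<open>The metaplectic double cover of SL(2)\<close>

type_synonym 'p mat2 = "'p padic ^ 2 ^ 2"
type_synonym 'p mp2 = "'p mat2 \<times> int"

definition mat2 :: "'a \<Rightarrow> 'a \<Rightarrow> 'a \<Rightarrow> 'a \<Rightarrow> 'a::zero ^ 2 ^ 2" where
  "mat2 a b c d = vector [vector [a, b], vector [c, d]]"

definition SL2_Qp :: "'p::prime_card mat2 set" where
  "SL2_Qp = {A. det A = 1}"

definition SL2_Zp :: "'p::prime_card mat2 set" where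
  "SL2_Zp = {A \<in> SL2_Qp. \<forall>i j. A $ i $ j \<in> range to_fract}"

definition K0 :: "nat \<Rightarrow> 'p::prime_card mat2 set" where
  "K0 n = {A \<in> SL2_Zp. A $ 2 $ 1 \<in> padic_ideal n}"

definition principal_congruence :: "nat \<Rightarrow> 'p::prime_card mat2 set" where
  "principal_congruence k = {A \<in> SL2_Zp. \<forall>i j. A $ i $ j - mat 1 $ i $ j \<in> padic_ideal k}"

definition tau :: "'p::prime_card mat2 \<Rightarrow> 'p padic" where
  "tau A = (if A $ 2 $ 1 \<noteq> 0 then A $ 2 $ 1 else A $ 2 $ 2)"

definition s_p :: "'p::prime_card mat2 \<Rightarrow> int" where
  "s_p A = (if A $ 2 $ 1 * A $ 2 $ 2 \<noteq> 0 \<and> odd (padic_ord (A $ 2 $ 1))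
            then hilbert_symbol (A $ 2 $ 1) (A $ 2 $ 2) else 1)"

definition sigma0 :: "'p::prime_card mat2 \<Rightarrow> 'p mat2 \<Rightarrow> int" where
  "sigma0 g h = hilbert_symbol (tau (g ** h) * tau g) (tau (g ** h) * tau h)"

definition mp_cocycle :: "'p::prime_card mat2 \<Rightarrow> 'p mat2 \<Rightarrow> int" where
  "mp_cocycle g h = sigma0 g h * s_p g * s_p h * s_p (g ** h)"

definition Mp2 :: "'p::prime_card mp2 monoid" where
  "Mp2 = \<lparr>carrier = SL2_Qp \<times> {1, -1},
          mult = (\<lambda>(g, e) (h, d). (g ** h, e * d * mp_cocycle g h)),
          one = (mat 1, 1)\<rparr>"

definition cover_preimage :: "'p::prime_card mat2 set \<Rightarrow> 'p mp2 set" where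
  "cover_preimage S = S \<times> {1, -1}"

text \<open>
  The cocycle is not locally constant on all of SL(2), so the product topology does not make
  the cover a topological group. The group topology of the cover is the one for which the lifts
  \<open>(u, 1)\<close> of the principal congruence subgroups form a neighbourhood basis of the identity;
  on the preimage of SL(2) over the p-adic integers (p odd) it agrees with the product topology.
\<close>

definition Mp2_open :: "'p::prime_card mp2 set \<Rightarrow> bool" where
  "Mp2_open U \<longleftrightarrow> U \<subseteq> carrier Mp2 \<and>
     (\<forall>x\<in>U. \<exists>k. \<forall>u\<in>principal_congruence k. x \<otimes>\<^bsub>Mp2\<^esub> (u, 1) \<in> U)"

definition Mp2_topology :: "'p::prime_card mp2 topology" where
  "Mp2_topology = topology Mp2_open"

lemma padic_ideal_antimono:
  assumes "k \<le> m"
  shows "(padic_ideal m :: 'p::prime_card padic set) \<subseteq> padic_ideal k"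
proof
  fix x :: "'p padic" assume "x \<in> padic_ideal m"
  then obtain a where a: "x = of_nat CARD('p) ^ m * to_fract a"
    by (auto simp: padic_ideal_def)
  have n: "to_fract (of_nat j) = (of_nat j :: 'p padic)" for j
    by (induction j) simp_all
  have pw: "to_fract (b ^ j) = (to_fract b ^ j :: 'p padic)" for b j
    by (induction j) simp_all
  have "x = of_nat CARD('p) ^ k * to_fract (of_nat CARD('p) ^ (m - k) * a)"
    using a assms by (simp add: n pw flip: power_add mult.assoc)
  then show "x \<in> padic_ideal k"
    unfolding padic_ideal_def by (rule image_eqI) simp
qed

lemma principal_congruence_antimono:
  "k \<le> m \<Longrightarrow> principal_congruence m \<subseteq> principal_congruence k"
  using padic_ideal_antimono unfolding principal_congruence_def by blast

lemma openin_Mp2_topology: "openin (Mp2_topology :: 'p::prime_card mp2 topology) = Mp2_open"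
proof -
  have "istopology (Mp2_open :: 'p mp2 set \<Rightarrow> bool)"
    unfolding istopology_def
  proof (intro conjI allI impI)
    fix S T :: "'p mp2 set"
    assume S: "Mp2_open S" and T: "Mp2_open T"
    have "\<exists>k. \<forall>u\<in>principal_congruence k. x \<otimes>\<^bsub>Mp2\<^esub> (u, 1) \<in> S \<inter> T" if x: "x \<in> S \<inter> T" for x
    proof -
      obtain k m where "\<forall>u\<in>principal_congruence k. x \<otimes>\<^bsub>Mp2\<^esub> (u, 1) \<in> S"
        and "\<forall>u\<in>principal_congruence m. x \<otimes>\<^bsub>Mp2\<^esub> (u, 1) \<in> T"
        using x S T unfolding Mp2_open_def by (metis IntD1 IntD2)
      then show ?thesis
        using principal_congruence_antimono[of k "max k m"]
          principal_congruence_antimono[of m "max k m"]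
        by (intro exI[of _ "max k m"]) auto
    qed
    then show "Mp2_open (S \<inter> T)"
      using S unfolding Mp2_open_def by blast
  next
    fix \<K> :: "'p mp2 set set"
    assume "\<forall>K\<in>\<K>. Mp2_open K"
    then show "Mp2_open (\<Union> \<K>)"
      unfolding Mp2_open_def by (meson Union_iff Union_least)
  qed
  then show ?thesis
    by (simp add: Mp2_topology_def)
qed

text \<open>
  Regularity is not required: it is automatic on a locally compact, second countable group.
\<close>

definition left_haar_measure ::
  "('a, 'm) monoid_scheme \<Rightarrow> 'a topology \<Rightarrow> 'a measure \<Rightarrow> bool" where
  "left_haar_measure G T \<mu> \<longleftrightarrow>
     space \<mu> = carrier G \<and>
     sets \<mu> = sigma_sets (carrier G) {U. openin T U} \<and>
     (\<forall>x\<in>carrier G. \<forall>A\<in>sets \<mu>. emeasure \<mu> ((\<lambda>y. x \<otimes>\<^bsub>G\<^esub> y) ` A) = emeasure \<mu> A) \<and>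
     (\<forall>C\<in>sets \<mu>. compactin T C \<longrightarrow> emeasure \<mu> C < \<infinity>) \<and>
     (\<forall>U. openin T U \<and> U \<noteq> {} \<longrightarrow> emeasure \<mu> U > 0)"


section \<open>The Hecke algebra\<close>

definition cscale :: "complex \<Rightarrow> ('a \<Rightarrow> complex) \<Rightarrow> 'a \<Rightarrow> complex"  (infixr "*\<^sub>C" 75) where
  "c *\<^sub>C f = (\<lambda>x. c * f x)"

global_interpretation cfun: vector_space "cscale :: complex \<Rightarrow> ('a \<Rightarrow> complex) \<Rightarrow> 'a \<Rightarrow> complex"
  by unfold_locales (auto simp: cscale_def fun_eq_iff algebra_simps)

text \<open>Locally constant, compactly supported functions, extended by 0 outside the space.\<close>

definition Cc_infty :: "'a topology \<Rightarrow> ('a \<Rightarrow> complex) set" where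
  "Cc_infty T = {f.
     (\<forall>x. x \<notin> topspace T \<longrightarrow> f x = 0) \<and>
     (\<forall>x\<in>topspace T. \<exists>U. openin T U \<and> x \<in> U \<and> (\<forall>y\<in>U. f y = f x)) \<and>
     compactin T (T closure_of {x. f x \<noteq> 0})}"

text \<open>
  The genuine character of the preimage of \<open>K0 n\<close> attached to a character of the p-adic units.
\<close>

definition genuine_char :: "('p::prime_card padic_int \<Rightarrow> complex) \<Rightarrow> 'p mp2 \<Rightarrow> complex" where
  "genuine_char \<eta> x = of_int (snd x) * \<eta> (inv_into UNIV to_fract (fst x $ 2 $ 2))"

definition hecke_space ::
  "nat \<Rightarrow> ('p::prime_card padic_int \<Rightarrow> complex) \<Rightarrow> ('p mp2 \<Rightarrow> complex) set" where
  "hecke_space n \<eta> = {f \<in> Cc_infty Mp2_topology.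
     {x. f x \<noteq> 0} \<subseteq> cover_preimage SL2_Zp \<and>
     (\<forall>k\<in>cover_preimage (K0 n). \<forall>k'\<in>cover_preimage (K0 n). \<forall>g\<in>carrier Mp2.
        f (k \<otimes>\<^bsub>Mp2\<^esub> g \<otimes>\<^bsub>Mp2\<^esub> k') = cnj (genuine_char \<eta> k) * cnj (genuine_char \<eta> k') * f g)}"

definition hecke_conv ::
  "'p::prime_card mp2 measure \<Rightarrow> ('p mp2 \<Rightarrow> complex) \<Rightarrow> ('p mp2 \<Rightarrow> complex) \<Rightarrow> 'p mp2 \<Rightarrow> complex" where
  "hecke_conv \<mu> f1 f2 = (\<lambda>h. if h \<in> carrier Mp2
     then (LINT g|\<mu>. f1 g * f2 (inv\<^bsub>Mp2\<^esub> g \<otimes>\<^bsub>Mp2\<^esub> h)) else 0)"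

definition double_coset :: "nat \<Rightarrow> 'p::prime_card mp2 \<Rightarrow> 'p mp2 set" where
  "double_coset n g = {k \<otimes>\<^bsub>Mp2\<^esub> g \<otimes>\<^bsub>Mp2\<^esub> k' | k k'.
     k \<in> cover_preimage (K0 n) \<and> k' \<in> cover_preimage (K0 n)}"

definition is_coset_element ::
  "nat \<Rightarrow> ('p::prime_card padic_int \<Rightarrow> complex) \<Rightarrow> 'p mp2 \<Rightarrow> ('p mp2 \<Rightarrow> complex) \<Rightarrow> bool" where
  "is_coset_element n \<eta> g f \<longleftrightarrow>
     f \<in> hecke_space n \<eta> \<and> {x. f x \<noteq> 0} \<subseteq> double_coset n g \<and> f g = 1"

definition coset_element ::
  "nat \<Rightarrow> ('p::prime_card padic_int \<Rightarrow> complex) \<Rightarrow> 'p mp2 \<Rightarrow> 'p mp2 \<Rightarrow> complex" where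
  "coset_element n \<eta> g = (THE f. is_coset_element n \<eta> g f)"

definition rep_I :: "'p::prime_card mp2" where
  "rep_I = (mat 1, 1)"

definition rep_U :: "'p::prime_card mp2" where
  "rep_U = (mat2 0 1 (-1) 0, 1)"

definition rep_V :: "nat \<Rightarrow> 'p::prime_card padic_int \<Rightarrow> 'p mp2" where
  "rep_V r a = (mat2 1 0 (to_fract a * of_nat CARD('p) ^ r) 1, 1)"

definition hecke_algebra ::
  "'p::prime_card mp2 measure \<Rightarrow> nat \<Rightarrow> ('p padic_int \<Rightarrow> complex) \<Rightarrow>
    (complex, 'p mp2 \<Rightarrow> complex) module" where
  "hecke_algebra \<mu> n \<eta> = \<lparr>carrier = hecke_space n \<eta>,
     mult = hecke_conv \<mu>, one = coset_element n \<eta> rep_I,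
     ring.zero = 0, add = (+), smult = cscale\<rparr>"

end

theory Submission
  imports Defs
begin

text \<open>
  For odd p the cocycle is trivial on the maximal compact subgroup: the Hilbert symbol is given by
  the tame formula, and the signs cancel because the orders of the three lower left entries are
  constrained by \<open>c'' = c a' + d c'\<close>. Hence elements of the Hecke algebra are the functions on
  \<open>SL\<^sub>2\<close> of the p-adic integers that transform under both actions of \<open>K\<^sub>0(p\<^sup>n)\<close> by the character
  \<open>\<eta>(d)\<close>, and the convolution integral is a finite sum over left cosets, that is, over the
  projective line mod \<open>p\<^sup>n\<close>. Such a function is determined by its value at the Weyl element and
  its restriction to the lower unipotents \<open>y(s)\<close> with s in \<open>p\<int> / p\<^sup>n\<close>, which only depends on the
  class of s modulo squares of units. In these coordinates convolution is additive
  convolution on \<open>p\<int> / p\<^sup>n\<close> together with a rank one term from the Weyl element, so that it is visibly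
  commutative, and the structure constants count solutions of \<open>u + u' = v\<close> with
  prescribed quadratic characters, which is a Jacobi sum.
\<close>

section \<open>Sums of Legendre symbols\<close>

text \<open>The Hilbert symbol is given as solvability of a conic, so the tame formula has to be
  derived from square roots: clearing denominators moves the conic to the p-adic integers, and
  lifting digit by digit, possible because 2 is invertible mod p, shows that a unit is a square iff
  its residue is. Write chi for the Legendre symbol mod p. The indicator of chi = e is (chi^2 + e
  chi) / 2 for a sign e, which is the origin of the denominators 2 and 4. In the product of two such
  indicators the linear sums vanish and the Jacobi sum -chi(-1) survives; chi(-1) depends on p mod
  4, hence the two tables. Y_r is the indicator of the s divisible by p^r: the two square classes of
  order j form the difference of consecutive indicators, and the sum over j telescopes. So Y_(r+1)
  collects the sums u + u' divisible by p. The factor p^n in (c) counts the big cell representatives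
  met when U_0 * U_0 is evaluated at a lower unipotent: the units s together with all the upper
  representatives.\<close>

lemma Legendre_cong: "[a = b] (mod p) \<Longrightarrow> Legendre a p = Legendre b p"
  unfolding Legendre_def QuadRes_def by (simp add: cong_def)

lemma Legendre_mod [simp]: "Legendre (a mod p) p = Legendre a p"
  by (rule Legendre_cong) simp

lemma Legendre_eq_0_iff: "Legendre a p = 0 \<longleftrightarrow> p dvd a"
  by (auto simp: Legendre_def cong_0_iff)

lemma Legendre_values: "Legendre a p \<in> {-1, 0, 1}"
  by (auto simp: Legendre_def)

lemma Legendre_sq: "(Legendre a p)\<^sup>2 = (if p dvd a then 0 else 1)"
  using Legendre_values[of a p] Legendre_eq_0_iff[of a p] by auto

text \<open>Euler's criterion yields the identity only mod p, but both sides lie in {-1, 0, 1}, so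
  their difference is at most 2 in size and p > 2 forces it to vanish.\<close>

lemma Legendre_mult:
  fixes p :: nat
  assumes p: "Factorial_Ring.prime p" "odd p"
  shows "Legendre (a * b) p = Legendre a p * Legendre b p"
proof -
  have p2: "2 < p" using p prime_ge_2_nat[of p] by (cases "p = 2") auto
  have "[Legendre (a * b) p = (a * b) ^ ((p - 1) div 2)] (mod p)"
    using euler_criterion[OF p(1) p2] by simp
  also have "(a * b) ^ ((p - 1) div 2) = a ^ ((p - 1) div 2) * b ^ ((p - 1) div 2)"
    by (simp add: power_mult_distrib)
  also have "[\<dots> = Legendre a p * Legendre b p] (mod p)"
    using euler_criterion[OF p(1) p2] by (intro cong_mult) (simp_all add: cong_sym)
  finally have "int p dvd Legendre (a * b) p - Legendre a p * Legendre b p"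
    by (simp add: cong_iff_dvd_diff)
  moreover have "Legendre (a * b) p - Legendre a p * Legendre b p \<in> {-2..2}"
    using Legendre_values[of "a * b" p] Legendre_values[of a p] Legendre_values[of b p] by auto
  ultimately show ?thesis
    using p2 dvd_imp_le_int[of "Legendre (a * b) p - Legendre a p * Legendre b p" "int p"]
    by fastforce
qed

lemma Legendre_1: "Factorial_Ring.prime p \<Longrightarrow> Legendre 1 (int p) = 1"
  using prime_gt_1_nat[of p] by (auto simp: Legendre_def QuadRes_def cong_def intro: exI[of _ 1])

text \<open>Euler's criterion again, with the parity of (p - 1) div 2 read off from p mod 4. This
  sign causes the case split in the multiplication table.\<close>

lemma Legendre_minus_1:
  assumes p: "Factorial_Ring.prime p"
  shows "p mod 4 = 1 \<Longrightarrow> Legendre (-1) (int p) = 1"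
    and "p mod 4 = 3 \<Longrightarrow> Legendre (-1) (int p) = -1"
proof -
  have p2: "2 < p" if "p mod 4 = 1 \<or> p mod 4 = 3"
    using that prime_gt_1_nat[OF p] by (cases "p = 2") auto
  have eq: "Legendre (-1) (int p) = (-1) ^ ((p - 1) div 2)" if "p mod 4 = 1 \<or> p mod 4 = 3"
  proof -
    have "[Legendre (-1) p = (-1) ^ ((p - 1) div 2)] (mod p)"
      using euler_criterion[OF p p2[OF that]] by simp
    then have "int p dvd Legendre (-1) p - (-1) ^ ((p - 1) div 2)"
      by (simp add: cong_iff_dvd_diff)
    moreover have "\<bar>Legendre (-1) p - (-1) ^ ((p - 1) div 2)\<bar> \<le> 2"
      using Legendre_values[of "-1" p] by (cases "even ((p - 1) div 2)") auto
    ultimately show ?thesis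
      using p2[OF that] dvd_imp_le_int[of "Legendre (-1) p - (-1) ^ ((p - 1) div 2)" "int p"]
      by fastforce
  qed
  show "p mod 4 = 1 \<Longrightarrow> Legendre (-1) (int p) = 1"
    and "p mod 4 = 3 \<Longrightarrow> Legendre (-1) (int p) = -1"
  proof -
    assume a: "p mod 4 = 1"
    then have "even ((p - 1) div 2)" by presburger
    then show "Legendre (-1) (int p) = 1" using eq[OF disjI1[OF a]] by (simp only: neg_one_even_power)
  next
    assume a: "p mod 4 = 3"
    then have "odd ((p - 1) div 2)" by presburger
    then show "Legendre (-1) (int p) = -1" using eq[OF disjI2[OF a]] neg_one_odd_power by metis
  qed
qed

text \<open>Change of variables for sums over representatives: \<open>\<sigma>\<close> may leave S
  as long as reduction mod m brings it back, because g has period m. On a finite set injectivity is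
  enough for a bijection.\<close>

lemma sum_mod_permute:
  fixes m :: int and g :: "int \<Rightarrow> 'a::comm_monoid_add"
  assumes m: "m > 0" and S: "S \<subseteq> {0..<m}"
    and g: "\<And>x y. [x = y] (mod m) \<Longrightarrow> g x = g y"
    and \<sigma>: "\<And>s. s \<in> S \<Longrightarrow> \<sigma> s mod m \<in> S"
    and inj: "\<And>s t. s \<in> S \<Longrightarrow> t \<in> S \<Longrightarrow> [\<sigma> s = \<sigma> t] (mod m) \<Longrightarrow> [s = t] (mod m)"
  shows "(\<Sum>s\<in>S. g (\<sigma> s)) = (\<Sum>s\<in>S. g s)"
proof -
  have fin: "finite S" using S finite_subset by blast
  have i: "inj_on (\<lambda>s. \<sigma> s mod m) S"
  proof
    fix s t assume st: "s \<in> S" "t \<in> S" "\<sigma> s mod m = \<sigma> t mod m"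
    then have "[s = t] (mod m)" by (intro inj[OF st(1,2)]) (simp only: cong_def)
    moreover have "s \<in> {0..<m}" "t \<in> {0..<m}" using st S by auto
    ultimately show "s = t" by (simp add: cong_def)
  qed
  have "(\<lambda>s. \<sigma> s mod m) ` S = S"
    using endo_inj_surj[OF fin _ i] \<sigma> by blast
  then have "bij_betw (\<lambda>s. \<sigma> s mod m) S S"
    using i by (simp add: bij_betw_def)
  then have "(\<Sum>s\<in>S. g (\<sigma> s mod m)) = (\<Sum>s\<in>S. g s)"
    by (rule sum.reindex_bij_betw)
  moreover have "g (\<sigma> s mod m) = g (\<sigma> s)" for s
    by (rule g) simp
  ultimately show ?thesis by simp
qed

text \<open>Multiplication by the nonresidue c permutes the residues and changes the sign of the
  sum, which therefore equals its own negative.\<close>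

lemma sum_Legendre:
  fixes p :: nat
  assumes p: "Factorial_Ring.prime p" "odd p" and c: "Legendre c p = -1"
  shows "(\<Sum>s\<in>{0..<int p}. Legendre s p) = 0"
proof -
  have nd: "\<not> int p dvd c" using c Legendre_eq_0_iff[of c p] by auto
  have "(\<Sum>s\<in>{0..<int p}. Legendre (c * s) p) = (\<Sum>s\<in>{0..<int p}. Legendre s p)"
  proof (rule sum_mod_permute[of "int p"])
    fix s t assume "[c * s = c * t] (mod int p)"
    then show "[s = t] (mod int p)"
      using nd cong_mult_lcancel[of c "int p" s t] prime_imp_coprime[of "int p" c] p
      by (simp add: coprime_commute)
  qed (use p prime_gt_0_nat in \<open>auto intro: Legendre_cong\<close>)
  then show ?thesis
    using c by (simp add: Legendre_mult[OF p] sum_negf)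
qed

lemma sum_Legendre_shift:
  fixes p :: nat
  assumes p: "Factorial_Ring.prime p" "odd p" and c: "Legendre c p = -1"
  shows "(\<Sum>s\<in>{0..<int p}. Legendre (v - s) p) = 0"
proof -
  have "(\<Sum>s\<in>{0..<int p}. Legendre (v - s) p) = (\<Sum>s\<in>{0..<int p}. Legendre s p)"
  proof (rule sum_mod_permute[of "int p"])
    fix s t assume "[v - s = v - t] (mod int p)"
    then show "[s = t] (mod int p)"
      using cong_diff[of v v "int p" "v - s" "v - t"] by simp
  qed (use p prime_gt_0_nat in \<open>auto intro: Legendre_cong\<close>)
  then show ?thesis using sum_Legendre[OF assms] by simp
qed

text \<open>For s nonzero mod p, chi(s) chi(v - s) = chi(s)^2 chi(v/s - 1) = chi(v/s - 1), and v/s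
  runs over all nonzero classes. What remains is the complete sum of chi(x - 1), which is 0, without
  its term at x = 0.\<close>

lemma Jacobi_sum_Legendre:
  fixes p :: nat
  assumes p: "Factorial_Ring.prime p" "odd p" and c: "Legendre c p = -1" and v: "\<not> int p dvd v"
  shows "(\<Sum>s\<in>{0..<int p}. Legendre s p * Legendre (v - s) p) = - Legendre (-1) p"
proof -
  have pos: "int p > 0" using p by (simp add: prime_gt_0_nat)
  have pint: "Factorial_Ring.prime (int p)" using p by simp
  have split: "{0..<int p} = insert 0 {1..<int p}" using pos by auto
  define iv where "iv s = (SOME t. [s * t = 1] (mod int p))" for s
  have iv: "[s * iv s = 1] (mod int p)" if "\<not> int p dvd s" for s
  proof -
    have "coprime s (int p)" using prime_imp_coprime[OF pint that] by (simp add: coprime_commute)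
    then show ?thesis unfolding iv_def by (rule someI_ex[OF cong_solve_coprime_int])
  qed
  have nd: "\<not> int p dvd s" if "s \<in> {1..<int p}" for s
    using that zdvd_not_zless[of s "int p"] by simp
  have ivnd: "\<not> int p dvd iv s" if "\<not> int p dvd s" for s
  proof
    assume "int p dvd iv s"
    then have "int p dvd 1"
      using cong_dvd_iff[OF iv[OF that]] by simp
    then show False using pint by (simp add: prime_int_nat_transfer)
  qed
  have "(\<Sum>s\<in>{0..<int p}. Legendre s p * Legendre (v - s) p)
      = (\<Sum>s\<in>{1..<int p}. Legendre s p * Legendre (v - s) p)"
    unfolding split by (simp add: Legendre_eq_0_iff)
  also have "\<dots> = (\<Sum>s\<in>{1..<int p}. Legendre (v * iv s - 1) p)"
  proof (rule sum.cong[OF refl])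
    fix s assume s: "s \<in> {1..<int p}"
    have "[v - s = s * (v * iv s - 1)] (mod int p)"
    proof -
      have "[v * (s * iv s) - s = v * 1 - s] (mod int p)"
        by (intro cong_diff cong_mult iv nd s cong_refl)
      then show ?thesis by (simp add: algebra_simps cong_sym)
    qed
    then have "Legendre (v - s) p = Legendre s p * Legendre (v * iv s - 1) p"
      by (simp add: Legendre_cong Legendre_mult[OF p])
    moreover have "Legendre s p * Legendre s p = 1"
      using Legendre_sq[of s p] nd[OF s] by (simp add: power2_eq_square)
    ultimately show "Legendre s p * Legendre (v - s) p = Legendre (v * iv s - 1) p"
      by (metis mult.assoc mult_1)
  qed
  also have "\<dots> = (\<Sum>s\<in>{1..<int p}. Legendre (s - 1) p)"
  proof (rule sum_mod_permute[of "int p"])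
    fix x y assume "[x = y] (mod int p)"
    then show "Legendre (x - 1) p = Legendre (y - 1) p"
      by (intro Legendre_cong cong_diff) auto
  next
    fix s assume s: "s \<in> {1..<int p}"
    have "\<not> int p dvd v * iv s"
      using v ivnd[OF nd[OF s]] pint by (simp add: prime_dvd_mult_iff)
    then show "v * iv s mod int p \<in> {1..<int p}"
      using pos pos_mod_sign[OF pos, of "v * iv s"] pos_mod_bound[OF pos, of "v * iv s"]
        mod_eq_0_iff_dvd[of "v * iv s" "int p"]
      by (auto simp del: mod_eq_0_iff_dvd)
  next
    fix s t assume s: "s \<in> {1..<int p}" and t: "t \<in> {1..<int p}"
      and eq: "[v * iv s = v * iv t] (mod int p)"
    have "coprime v (int p)" using prime_imp_coprime[OF pint v] by (simp add: coprime_commute)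
    then have e: "[iv s = iv t] (mod int p)" using eq cong_mult_lcancel by blast
    have "[s * (t * iv t) = t * (s * iv s)] (mod int p)"
      using cong_mult[OF cong_refl cong_sym[OF e], of "s * t"] by (simp add: ac_simps)
    moreover have "[s * (t * iv t) = s * 1] (mod int p)" "[t * (s * iv s) = t * 1] (mod int p)"
      by (intro cong_mult cong_refl iv nd s t)+
    ultimately show "[s = t] (mod int p)" by (metis cong_sym cong_trans mult_1_right)
  qed (use pos in auto)
  also have "\<dots> = (\<Sum>s\<in>{0..<int p}. Legendre (s - 1) p) - Legendre (-1) p"
    unfolding split by simp
  also have "(\<Sum>s\<in>{0..<int p}. Legendre (s - 1) p) = (\<Sum>s\<in>{0..<int p}. Legendre s p)"
  proof (rule sum_mod_permute[of "int p"])
    fix s t assume "[s - 1 = t - 1] (mod int p)"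
    then show "[s = t] (mod int p)"
      using cong_add[of "s - 1" "t - 1" "int p" 1 1] by simp
  qed (use pos in \<open>auto intro: Legendre_cong\<close>)
  finally show ?thesis using sum_Legendre[OF p c] by simp
qed

section \<open>Arithmetic of the p-adic integers\<close>

lemma coord_0 [simp]: "padic_coord (0 :: 'p::prime_card padic_int) k = 0"
  by (simp add: zero_padic_int.rep_eq)

lemma coord_1: "padic_coord (1 :: 'p::prime_card padic_int) k = 1 mod int CARD('p) ^ k"
  by (simp add: one_padic_int.rep_eq)

lemma coord_add: "padic_coord (x + y :: 'p::prime_card padic_int) k
    = (padic_coord x k + padic_coord y k) mod int CARD('p) ^ k"
  by (simp add: plus_padic_int.rep_eq)

lemma coord_mult: "padic_coord (x * y :: 'p::prime_card padic_int) k
    = (padic_coord x k * padic_coord y k) mod int CARD('p) ^ k"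
  by (simp add: times_padic_int.rep_eq)

lemma coord_diff: "padic_coord (x - y :: 'p::prime_card padic_int) k
    = (padic_coord x k - padic_coord y k) mod int CARD('p) ^ k"
  by (simp add: minus_padic_int.rep_eq)

lemma coord_range: "padic_coord (x :: 'p::prime_card padic_int) k \<in> {0..<int CARD('p) ^ k}"
  using padic_coord[of x] by blast

lemma padic_eqI: "(\<And>k. padic_coord x k = padic_coord y k) \<Longrightarrow> x = y"
  by (simp add: padic_coord_inject[symmetric] fun_eq_iff)

lemma coord_of_nat: "padic_coord (of_nat m :: 'p::prime_card padic_int) k = int m mod int CARD('p) ^ k"
  by (induction m) (simp_all add: coord_add coord_1 mod_add_eq add.commute)

lemma coord_of_int: "padic_coord (of_int m :: 'p::prime_card padic_int) k = m mod int CARD('p) ^ k"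
  by (cases m rule: int_diff_cases) (simp add: coord_diff coord_of_nat mod_diff_eq)

text \<open>The values need not be reduced: coherence mod p^k suffices, so quotients, inverses and
  roots can be built from arbitrary integer approximations.\<close>

lemma padic_of_coherent:
  fixes f :: "nat \<Rightarrow> int"
  assumes "\<And>k. [f (Suc k) = f k] (mod int CARD('p::prime_card) ^ k)"
  obtains x :: "'p::prime_card padic_int" where "\<And>k. padic_coord x k = f k mod int CARD('p) ^ k"
proof
  fix k
  show "padic_coord (Abs_padic_int (\<lambda>k. f k mod int CARD('p) ^ k) :: 'p padic_int) k
      = f k mod int CARD('p) ^ k"
    using coherent_mod[where 'p = 'p, of f] assms by (subst Abs_padic_int_inverse) auto
qed

lemma prime_p: "Factorial_Ring.prime CARD('p::prime_card)"
  by (rule prime_card)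

text \<open>Division by p^k is a shift: if coordinate k vanishes then p^k divides all later
  coordinates, and coordinate j of the quotient is coordinate k + j divided by p^k.\<close>

lemma p_power_dvd_iff:
  fixes x :: "'p::prime_card padic_int"
  shows "of_nat CARD('p) ^ k dvd x \<longleftrightarrow> padic_coord x k = 0"
proof
  assume "of_nat CARD('p) ^ k dvd x"
  then obtain y where "x = of_nat (CARD('p) ^ k) * y" by (auto simp: dvd_def)
  then show "padic_coord x k = 0" by (simp only: coord_mult coord_of_nat) simp
next
  assume 0: "padic_coord x k = 0"
  let ?p = "int CARD('p)"
  have dv: "?p ^ k dvd padic_coord x (k + j)" for j
    using padic_coord_add_mod[of x k j] 0 by (simp add: mod_eq_0_iff_dvd)
  have "[padic_coord x (k + Suc j) div ?p ^ k = padic_coord x (k + j) div ?p ^ k] (mod ?p ^ j)" for j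
  proof -
    have "?p ^ (k + j) dvd padic_coord x (k + Suc j) - padic_coord x (k + j)"
      using padic_coord_Suc_cong[of x "k + j"] by (simp add: cong_iff_dvd_diff)
    moreover obtain u v where uv: "padic_coord x (k + Suc j) = ?p ^ k * u" "padic_coord x (k + j) = ?p ^ k * v"
      using dv by (metis dvdE)
    ultimately have "?p ^ k * ?p ^ j dvd ?p ^ k * (u - v)"
      by (simp only: power_add right_diff_distrib)
    then have "?p ^ j dvd u - v" by simp
    then show ?thesis using uv by (simp add: cong_iff_dvd_diff)
  qed
  then obtain y :: "'p padic_int"
    where y: "\<And>j. padic_coord y j = (padic_coord x (k + j) div ?p ^ k) mod ?p ^ j"
    using padic_of_coherent[where f = "\<lambda>j. padic_coord x (k + j) div ?p ^ k"] by metis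
  have "x = of_nat (CARD('p) ^ k) * y"
  proof (rule padic_eqI)
    fix j
    have "padic_coord (of_nat (CARD('p) ^ k) * y) j = (?p ^ k * (padic_coord x (k + j) div ?p ^ k)) mod ?p ^ j"
      by (simp only: coord_mult coord_of_nat y mod_mult_eq mod_mult_right_eq mod_mult_left_eq) simp
    also have "\<dots> = padic_coord x (j + k) mod ?p ^ j"
      using dv[of j] by (simp add: add.commute)
    also have "\<dots> = padic_coord x j" by (rule padic_coord_add_mod)
    finally show "padic_coord x j = padic_coord (of_nat (CARD('p) ^ k) * y) j" by simp
  qed
  then show "of_nat CARD('p) ^ k dvd x" by simp
qed

lemma p_dvd_iff:
  fixes x :: "'p::prime_card padic_int"
  shows "of_nat CARD('p) dvd x \<longleftrightarrow> padic_coord x 1 = 0"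
  using p_power_dvd_iff[where k = 1 and x = x] by simp

lemma coord_eq_iff:
  fixes x y :: "'p::prime_card padic_int"
  shows "padic_coord x k = padic_coord y k \<longleftrightarrow> of_nat CARD('p) ^ k dvd x - y"
proof -
  have "padic_coord x k = padic_coord y k \<longleftrightarrow> [padic_coord x k = padic_coord y k] (mod int CARD('p) ^ k)"
    by (simp add: cong_def)
  also have "\<dots> \<longleftrightarrow> padic_coord (x - y) k = 0"
    by (simp only: coord_diff cong_iff_dvd_diff mod_eq_0_iff_dvd)
  finally show ?thesis by (simp only: p_power_dvd_iff)
qed

lemma p_power_dvd_of_int:
  "of_nat CARD('p::prime_card) ^ k dvd (of_int m :: 'p::prime_card padic_int) \<longleftrightarrow> int CARD('p) ^ k dvd m"
  by (simp only: p_power_dvd_iff coord_of_int mod_eq_0_iff_dvd)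

lemma coord_mod_p:
  fixes x :: "'p::prime_card padic_int"
  assumes "k \<ge> 1"
  shows "[padic_coord x k = padic_coord x 1] (mod int CARD('p))"
  using padic_coord_add_mod[of x 1 "k - 1"] padic_coord_mod[of x 1] assms by (simp add: cong_def)

text \<open>Inverses mod p^k may be chosen independently for each k; uniqueness of the inverse mod
  p^k makes the choices coherent.\<close>

lemma padic_unit_iff:
  fixes x :: "'p::prime_card padic_int"
  shows "x dvd 1 \<longleftrightarrow> \<not> of_nat CARD('p) dvd x"
proof
  assume "x dvd 1"
  show "\<not> of_nat CARD('p) dvd x"
  proof
    assume "of_nat CARD('p) dvd x"
    then have "of_nat CARD('p) dvd (1 :: 'p padic_int)"
      using \<open>x dvd 1\<close> dvd_trans by blast
    then show False
      using prime_gt_1_nat[OF prime_p[where 'p = 'p]] by (simp add: p_dvd_iff coord_1)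
  qed
next
  assume nd: "\<not> of_nat CARD('p) dvd x"
  let ?p = "int CARD('p)"
  have cop: "coprime (padic_coord x k) (?p ^ k)" for k
  proof (cases "k = 0")
    case False
    then have "\<not> ?p dvd padic_coord x k"
      using coord_mod_p[of k x] nd coord_range[of x 1]
      by (metis cong_dvd_iff One_nat_def less_one not_less p_dvd_iff mod_eq_0_iff_dvd padic_coord_mod power_one_right)
    then have "coprime ?p (padic_coord x k)"
      using prime_p[where 'p = 'p] by (intro prime_imp_coprime) simp_all
    then show ?thesis by (simp add: coprime_commute)
  qed simp
  have "\<exists>z. [padic_coord x k * z = 1] (mod ?p ^ k)" for k
    by (rule cong_solve_coprime_int[OF cop])
  then obtain z where z: "\<And>k. [padic_coord x k * z k = 1] (mod ?p ^ k)" by metis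
  have "[z (Suc k) = z k] (mod ?p ^ k)" for k
  proof -
    have "[padic_coord x (Suc k) * z (Suc k) = 1] (mod ?p ^ k)"
      using z[of "Suc k"] by (rule cong_dvd_modulus) simp
    moreover have "[padic_coord x (Suc k) * z (Suc k) = padic_coord x k * z (Suc k)] (mod ?p ^ k)"
      by (intro cong_mult padic_coord_Suc_cong cong_refl)
    ultimately have "[padic_coord x k * z (Suc k) = padic_coord x k * z k] (mod ?p ^ k)"
      using z[of k] by (meson cong_sym cong_trans)
    then show ?thesis using cong_mult_lcancel[OF cop] by blast
  qed
  then obtain y :: "'p padic_int" where y: "\<And>k. padic_coord y k = z k mod ?p ^ k"
    using padic_of_coherent by metis
  have "x * y = 1"
  proof (rule padic_eqI)
    fix k
    show "padic_coord (x * y) k = padic_coord (1 :: 'p padic_int) k"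
      using z[of k] by (simp add: coord_mult y coord_1[where 'p = 'p] mod_mult_right_eq cong_def)
  qed
  then show "x dvd 1" by (metis dvdI)
qed

lemma p_nonzero: "(of_nat CARD('p) :: 'p::prime_card padic_int) \<noteq> 0"
proof -
  have "padic_coord (of_nat CARD('p) :: 'p padic_int) 2 \<noteq> 0"
    using prime_gt_1_nat[OF prime_p[where 'p = 'p]]
    by (simp only: coord_of_nat) (simp add: mod_eq_0_iff_dvd power2_eq_square)
  then show ?thesis by force
qed

lemma prime_elem_p: "prime_elem (of_nat CARD('p) :: 'p::prime_card padic_int)"
  unfolding prime_elem_def
proof (intro conjI allI impI)
  show "\<not> (of_nat CARD('p) :: 'p padic_int) dvd 1"
    using padic_unit_iff[of "of_nat CARD('p) :: 'p padic_int"] by auto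
  fix a b :: "'p padic_int"
  assume d: "of_nat CARD('p) dvd a * b"
  show "of_nat CARD('p) dvd a \<or> of_nat CARD('p) dvd b"
  proof (rule ccontr)
    assume "\<not> ?thesis"
    then have "a dvd 1" "b dvd 1" by (simp_all add: padic_unit_iff)
    then have "a * b dvd 1" by simp
    then show False using d padic_unit_iff by blast
  qed
qed (rule p_nonzero)

section \<open>Order and unit part of a p-adic integer\<close>

lemma padic_decomp:
  fixes x :: "'p::prime_card padic_int"
  assumes "x \<noteq> 0"
  obtains m u where "x = of_nat CARD('p) ^ m * u" "u dvd 1"
proof -
  obtain k where k: "padic_coord x k \<noteq> 0"
    using assms padic_eqI[of x 0] by force
  \<comment> \<open>With \<open>Suc j\<close> the least index is the order itself: p^m divides x and
    p^(m + 1) does not.\<close>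
  define m where "m = (LEAST j. \<not> of_nat CARD('p) ^ Suc j dvd x)"
  have nk: "\<not> of_nat CARD('p) ^ k dvd x" using k by (simp only: p_power_dvd_iff) simp
  then have ex: "\<not> of_nat CARD('p) ^ Suc k dvd x"
    by (metis dvd_mult_right power_Suc)
  have m: "\<not> of_nat CARD('p) ^ Suc m dvd x"
    unfolding m_def by (rule LeastI, rule ex)
  have "of_nat CARD('p) ^ m dvd x"
  proof (cases m)
    case (Suc j)
    then show ?thesis using not_less_Least[of j] m_def by (metis lessI)
  qed simp
  then obtain u where u: "x = of_nat CARD('p) ^ m * u" by (elim dvdE)
  have "\<not> of_nat CARD('p) dvd u"
    using m u by (metis mult_dvd_mono dvd_refl power_Suc2)
  then show ?thesis using that u padic_unit_iff by blast
qed

text \<open>If m < k, cancelling p^m would make the unit u divisible by p; the case k < m is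
  symmetric.\<close>

lemma p_power_mult_unit_inj:
  fixes u v :: "'p::prime_card padic_int"
  assumes "of_nat CARD('p) ^ m * u = of_nat CARD('p) ^ k * v" "u dvd 1" "v dvd 1"
  shows "m = k" and "u = v"
proof -
  have *: "\<not> m < k" if "of_nat CARD('p) ^ m * u = of_nat CARD('p) ^ k * v" "u dvd 1"
    for m k and u v :: "'p padic_int"
  proof
    assume "m < k"
    then obtain j where "k = m + Suc j" using less_imp_Suc_add by auto
    then have "of_nat CARD('p) ^ m * u = of_nat CARD('p) ^ m * (of_nat CARD('p) * (of_nat CARD('p) ^ j * v))"
      using that by (simp add: power_add mult.assoc)
    then have "u = of_nat CARD('p) * (of_nat CARD('p) ^ j * v)" using p_nonzero[where 'p = 'p] by simp
    then show False using that(2) padic_unit_iff by (metis dvd_triv_left)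
  qed
  show "m = k" using *[OF assms(1,2)] *[OF assms(1)[symmetric] assms(3)] by linarith
  then show "u = v" using assms(1) p_nonzero[where 'p = 'p] by simp
qed

subsection \<open>The quadratic residue symbol of the leading digit\<close>

definition leg :: "'p::prime_card padic_int \<Rightarrow> int" where
  "leg x = Legendre (padic_coord x 1) (int CARD('p))"

lemma legendre_char_leg: "legendre_char x = of_int (leg x)"
  by (simp add: legendre_char_def leg_def)

lemma leg_of_int: "leg (of_int m :: 'p::prime_card padic_int) = Legendre m (int CARD('p))"
  by (simp add: leg_def coord_of_int)

lemma leg_cong:
  fixes x y :: "'p::prime_card padic_int"
  assumes "of_nat CARD('p) dvd x - y"
  shows "leg x = leg y"
proof -
  have "padic_coord x 1 = padic_coord y 1"
    using assms coord_eq_iff[of x 1 y] by simp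
  then show ?thesis by (simp add: leg_def)
qed

lemma leg_mult:
  fixes x y :: "'p::prime_card padic_int"
  assumes "odd CARD('p)"
  shows "leg (x * y) = leg x * leg y"
  by (simp add: leg_def coord_mult Legendre_mult[OF prime_p assms])

lemma leg_eq_0_iff: "leg x = 0 \<longleftrightarrow> of_nat CARD('p) dvd (x :: 'p::prime_card padic_int)"
proof -
  have "int CARD('p) dvd padic_coord x 1 \<longleftrightarrow> padic_coord x 1 = 0"
    using coord_range[of x 1] zdvd_not_zless[of "padic_coord x 1" "int CARD('p)"] by force
  then show ?thesis by (simp add: leg_def Legendre_eq_0_iff p_dvd_iff)
qed

lemma leg_unit: "x dvd 1 \<Longrightarrow> leg x = 1 \<or> leg (x :: 'p::prime_card padic_int) = -1"
  using leg_eq_0_iff[of x] Legendre_values[of "padic_coord x 1" "int CARD('p)"]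
  by (auto simp: padic_unit_iff leg_def)

lemma leg_1 [simp]: "leg (1 :: 'p::prime_card padic_int) = 1"
  using leg_of_int[of 1, where 'p = 'p] Legendre_1[OF prime_p[where 'p = 'p]] by simp

lemma leg_sq: "odd CARD('p) \<Longrightarrow> (x :: 'p::prime_card padic_int) dvd 1 \<Longrightarrow> leg (x\<^sup>2) = 1"
  using leg_unit[of x] by (auto simp: leg_mult power2_eq_square)

text \<open>Approximate roots are corrected one digit at a time.\<close>

lemma padic_sqrt:
  fixes x :: "'p::prime_card padic_int"
  assumes odd: "odd CARD('p)" and x: "leg x = 1"
  obtains y where "x = y\<^sup>2" "y dvd 1"
proof -
  let ?p = "int CARD('p)"
  have pint: "Factorial_Ring.prime ?p" using prime_p[where 'p = 'p] by simp
  \<comment> \<open>The index is shifted: stage k approximates the root mod p^(k + 1), so that stage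
    0 already has a residue prime to p.\<close>
  define P where "P k z \<longleftrightarrow> \<not> ?p dvd z \<and> [z\<^sup>2 = padic_coord x (Suc k)] (mod ?p ^ Suc k)" for k z
  have "QuadRes ?p (padic_coord x 1)"
    using x by (simp add: leg_def Legendre_def split: if_splits)
  then obtain z0 where z0: "[z0\<^sup>2 = padic_coord x 1] (mod ?p)" unfolding QuadRes_def by blast
  have xnd: "\<not> ?p dvd padic_coord x 1"
    using x Legendre_eq_0_iff[of "padic_coord x 1" ?p] by (auto simp: leg_def)
  have nd0: "\<not> ?p dvd z0"
  proof
    assume "?p dvd z0"
    then have "?p dvd z0\<^sup>2" by (simp add: power2_eq_square)
    then show False using cong_dvd_iff[OF z0] xnd by simp
  qed
  have "\<exists>f. \<forall>n. P n (f n) \<and> [f (Suc n) = f n] (mod ?p ^ Suc n)"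
  proof (rule dependent_nat_choice)
    show "\<exists>z. P 0 z" using z0 nd0 by (auto simp: P_def)
    fix z k assume Pz: "P k z"
    have "?p ^ Suc k dvd padic_coord x (Suc (Suc k)) - z\<^sup>2"
    proof -
      have "[padic_coord x (Suc (Suc k)) = z\<^sup>2] (mod ?p ^ Suc k)"
        using padic_coord_Suc_cong[of x "Suc k"] Pz unfolding P_def by (meson cong_sym cong_trans)
      then show ?thesis by (simp only: cong_iff_dvd_diff)
    qed
    then obtain w where w: "padic_coord x (Suc (Suc k)) - z\<^sup>2 = ?p ^ Suc k * w" by (elim dvdE)
    have "\<not> ?p dvd 2"
      using odd prime_gt_1_nat[OF prime_p[where 'p = 'p]] zdvd_imp_le[of ?p 2]
      by (cases "CARD('p) = 2") auto
    then have "\<not> ?p dvd 2 * z"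
      using Pz pint by (simp add: P_def prime_dvd_mult_iff)
    then have "coprime (2 * z) ?p"
      using prime_imp_coprime[OF pint, of "2 * z"] by (metis coprime_commute)
    then obtain v where v: "[2 * z * v = 1] (mod ?p)" using cong_solve_coprime_int by blast
    \<comment> \<open>Newton correction: 2 z t = w mod p kills the next digit, and the square of
      p^(k + 1) t is divisible by p^(k + 2).\<close>
    define t where "t = v * w"
    have "?p dvd 2 * z * t - w"
      using cong_mult[OF v cong_refl[of w]] by (simp add: t_def cong_iff_dvd_diff mult.assoc)
    then have "?p ^ Suc k * ?p dvd ?p ^ Suc k * (2 * z * t - w)" by (rule mult_dvd_mono[OF dvd_refl])
    moreover have "?p ^ Suc (Suc k) dvd (?p ^ Suc k * t)\<^sup>2"
      unfolding power2_eq_square by (simp add: mult.assoc mult.left_commute)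
    moreover have "(z + ?p ^ Suc k * t)\<^sup>2 - padic_coord x (Suc (Suc k))
        = ?p ^ Suc k * (2 * z * t - w) + (?p ^ Suc k * t)\<^sup>2"
      using w by (simp add: algebra_simps power2_eq_square)
    ultimately have "?p ^ Suc (Suc k) dvd (z + ?p ^ Suc k * t)\<^sup>2 - padic_coord x (Suc (Suc k))"
      by (simp add: mult.commute)
    then have "[(z + ?p ^ Suc k * t)\<^sup>2 = padic_coord x (Suc (Suc k))] (mod ?p ^ Suc (Suc k))"
      by (simp only: cong_iff_dvd_diff)
    moreover have "\<not> ?p dvd z + ?p ^ Suc k * t"
      using Pz by (simp add: P_def dvd_add_left_iff mult.assoc)
    ultimately show "\<exists>y. P (Suc k) y \<and> [y = z] (mod ?p ^ Suc k)"
      by (intro exI[of _ "z + ?p ^ Suc k * t"]) (simp add: P_def cong_iff_dvd_diff)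
  qed
  then obtain f where f: "\<And>n. P n (f n)" "\<And>n. [f (Suc n) = f n] (mod ?p ^ Suc n)" by blast
  have "[f (Suc n) = f n] (mod ?p ^ n)" for n
    using f(2)[of n] by (rule cong_dvd_modulus) simp
  then obtain y :: "'p padic_int" where y: "\<And>k. padic_coord y k = f k mod ?p ^ k"
    using padic_of_coherent by metis
  have "x = y\<^sup>2"
  proof (rule padic_eqI)
    fix k
    have "[(f k)\<^sup>2 = padic_coord x k] (mod ?p ^ k)"
    proof -
      have "[(f k)\<^sup>2 = padic_coord x (Suc k)] (mod ?p ^ k)"
        using f(1)[of k] unfolding P_def by (elim conjE cong_dvd_modulus) simp
      then show ?thesis using padic_coord_Suc_cong[of x k] cong_trans by blast
    qed
    then show "padic_coord x k = padic_coord (y\<^sup>2) k"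
      by (simp add: power2_eq_square coord_mult y mod_mult_eq cong_def)
  qed
  moreover have "y dvd 1"
  proof -
    have "x dvd 1" using x leg_eq_0_iff[of x] padic_unit_iff by force
    then show ?thesis using \<open>x = y\<^sup>2\<close> by (simp add: power2_eq_square is_unit_mult_iff)
  qed
  ultimately show ?thesis using that by blast
qed

section \<open>The tame Hilbert symbol\<close>

text \<open>The condition inside \<open>hilbert_symbol\<close>, over any commutative ring, so that
  it can be moved from the field to the p-adic integers.\<close>

definition conic_solvable :: "'a::comm_ring_1 \<Rightarrow> 'a \<Rightarrow> bool" where
  "conic_solvable a b \<longleftrightarrow> (\<exists>x y z. (x, y, z) \<noteq> (0, 0, 0) \<and> z\<^sup>2 = a * x\<^sup>2 + b * y\<^sup>2)"

text \<open>The equation is homogeneous, so a fractional point may be multiplied by a common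
  denominator.\<close>

lemma conic_solvable_to_fract:
  fixes a b :: "'a::idom"
  shows "conic_solvable (to_fract a) (to_fract b) \<longleftrightarrow> conic_solvable a b"
proof
  assume "conic_solvable a b"
  then obtain x y z where xyz: "(x, y, z) \<noteq> (0, 0, 0)" "z\<^sup>2 = a * x\<^sup>2 + b * y\<^sup>2"
    unfolding conic_solvable_def by blast
  have "(to_fract z)\<^sup>2 = to_fract (z\<^sup>2)" by (simp add: power2_eq_square)
  also have "\<dots> = to_fract a * (to_fract x)\<^sup>2 + to_fract b * (to_fract y)\<^sup>2"
    using xyz(2) by (simp add: power2_eq_square)
  finally have "(to_fract z)\<^sup>2 = to_fract a * (to_fract x)\<^sup>2 + to_fract b * (to_fract y)\<^sup>2" .
  then show "conic_solvable (to_fract a) (to_fract b)"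
    using xyz(1) unfolding conic_solvable_def
    by (intro exI[of _ "to_fract x"] exI[of _ "to_fract y"] exI[of _ "to_fract z"]) auto
next
  assume "conic_solvable (to_fract a) (to_fract b)"
  then obtain x y z where xyz: "(x, y, z) \<noteq> (0, 0, 0)" "z\<^sup>2 = to_fract a * x\<^sup>2 + to_fract b * y\<^sup>2"
    unfolding conic_solvable_def by blast
  obtain x1 x2 where x: "x = Fract x1 x2" "x2 \<noteq> 0" by (rule Fract_cases)
  obtain y1 y2 where y: "y = Fract y1 y2" "y2 \<noteq> 0" by (rule Fract_cases)
  obtain z1 z2 where z: "z = Fract z1 z2" "z2 \<noteq> 0" by (rule Fract_cases)
  define D where "D = to_fract (x2 * y2 * z2)"
  have D: "D \<noteq> 0" using x y z by (simp add: D_def)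
  have X: "D * x = to_fract (x1 * y2 * z2)" using x by (simp add: D_def Fract_conv_to_fract)
  have Y: "D * y = to_fract (y1 * x2 * z2)" using y by (simp add: D_def Fract_conv_to_fract)
  have Z: "D * z = to_fract (z1 * x2 * y2)" using z by (simp add: D_def Fract_conv_to_fract)
  have "(D * z)\<^sup>2 = to_fract a * (D * x)\<^sup>2 + to_fract b * (D * y)\<^sup>2"
    using xyz(2) by (simp add: power_mult_distrib distrib_left mult.left_commute)
  then have "to_fract ((z1 * x2 * y2)\<^sup>2) = to_fract (a * (x1 * y2 * z2)\<^sup>2 + b * (y1 * x2 * z2)\<^sup>2)"
    unfolding X Y Z by (simp add: power2_eq_square)
  then have "(z1 * x2 * y2)\<^sup>2 = a * (x1 * y2 * z2)\<^sup>2 + b * (y1 * x2 * z2)\<^sup>2"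
    by (simp only: to_fract_eq_iff)
  moreover have "(x1 * y2 * z2, y1 * x2 * z2, z1 * x2 * y2) \<noteq> (0, 0, 0)"
    using xyz(1) x y z by (auto simp: Fract_conv_to_fract)
  ultimately show "conic_solvable a b" unfolding conic_solvable_def by blast
qed

lemma hilbert_symbol_to_fract:
  "hilbert_symbol (to_fract a) (to_fract b) = (if conic_solvable a b then 1 else -1)"
  using conic_solvable_to_fract[of a b] by (simp add: hilbert_symbol_def conic_solvable_def)

lemma conic_solvable_commute: "conic_solvable a b \<longleftrightarrow> conic_solvable b a"
  unfolding conic_solvable_def by (metis add.commute prod.inject)

lemma conic_solvable_square_left:
  fixes a b :: "'a::idom"
  assumes t: "t \<noteq> 0"
  shows "conic_solvable (t\<^sup>2 * a) b \<longleftrightarrow> conic_solvable a b"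
proof
  assume "conic_solvable (t\<^sup>2 * a) b"
  then obtain x y z where xyz: "(x, y, z) \<noteq> (0, 0, 0)" "z\<^sup>2 = t\<^sup>2 * a * x\<^sup>2 + b * y\<^sup>2"
    unfolding conic_solvable_def by blast
  then have "z\<^sup>2 = a * (t * x)\<^sup>2 + b * y\<^sup>2" "(t * x, y, z) \<noteq> (0, 0, 0)"
    using t by (auto simp: power_mult_distrib ac_simps)
  then show "conic_solvable a b" unfolding conic_solvable_def by blast
next
  assume "conic_solvable a b"
  then obtain x y z where xyz: "(x, y, z) \<noteq> (0, 0, 0)" "z\<^sup>2 = a * x\<^sup>2 + b * y\<^sup>2"
    unfolding conic_solvable_def by blast
  then have "(t * z)\<^sup>2 = t\<^sup>2 * a * x\<^sup>2 + b * (t * y)\<^sup>2"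
    by (simp add: power_mult_distrib distrib_left ac_simps)
  moreover have "(x, t * y, t * z) \<noteq> (0, 0, 0)" using xyz t by auto
  ultimately show "conic_solvable (t\<^sup>2 * a) b" unfolding conic_solvable_def by blast
qed

lemma conic_solvable_square_right:
  fixes a b :: "'a::idom"
  shows "t \<noteq> 0 \<Longrightarrow> conic_solvable a (t\<^sup>2 * b) \<longleftrightarrow> conic_solvable a b"
  using conic_solvable_square_left conic_solvable_commute by metis

text \<open>A conic point says that b is a norm from the quadratic extension by the root of a,
  and \<open>-a\<close> is a norm.\<close>

lemma conic_solvable_norm:
  fixes a b :: "'a::idom"
  assumes a: "a \<noteq> 0"
  shows "conic_solvable a (- a * b) \<longleftrightarrow> conic_solvable a b"
proof -
  have *: "conic_solvable a (- a * b)" if "conic_solvable a b" for b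
  proof -
    obtain x y z where xyz: "(x, y, z) \<noteq> (0, 0, 0)" "z\<^sup>2 = a * x\<^sup>2 + b * y\<^sup>2"
      using \<open>conic_solvable a b\<close> unfolding conic_solvable_def by blast
    have "(a * x)\<^sup>2 = a * z\<^sup>2 + - a * b * y\<^sup>2"
      using xyz(2) by (simp add: power_mult_distrib algebra_simps power2_eq_square)
    moreover have "(z, y, a * x) \<noteq> (0, 0, 0)" using xyz a by auto
    ultimately show ?thesis unfolding conic_solvable_def by blast
  qed
  \<comment> \<open>Applying the implication twice multiplies b by a^2, which the conic does not
    see; this yields the converse.\<close>
  have "- a * (- a * b) = a\<^sup>2 * b" by (simp add: power2_eq_square)
  then show ?thesis
    using *[of b] *[of "- a * b"] conic_solvable_square_right[OF a, of a b] by metis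
qed

lemma conic_solvable_square: "conic_solvable (s\<^sup>2) (b :: 'a::idom)"
  unfolding conic_solvable_def by (intro exI[of _ 1] exI[of _ 0] exI[of _ s]) simp

text \<open>A square among u and v gives an evident point. If both are nonresidues then u / v is a
  square, so it suffices to solve z^2 = u r^2 + u, that is, to find a square r^2 such that r^2 + 1
  has symbol -1.\<close>

lemma conic_solvable_units:
  fixes u v :: "'p::prime_card padic_int"
  assumes odd: "odd CARD('p)" and u: "u dvd 1" and v: "v dvd 1"
  shows "conic_solvable u v"
proof -
  consider "leg u = 1" | "leg v = 1" | "leg u = -1" "leg v = -1"
    using leg_unit[OF u] leg_unit[OF v] by blast
  then show ?thesis
  proof cases
    case 1
    then show ?thesis using padic_sqrt[OF odd] conic_solvable_square by metis
  next
    case 2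
    then show ?thesis using padic_sqrt[OF odd] conic_solvable_square conic_solvable_commute by metis
  next
    case 3
    \<comment> \<open>The least nonresidue c: its predecessor is a nonzero residue, hence a p-adic
      square, and u c is a square because both symbols are -1.\<close>
    define Q where "Q c \<longleftrightarrow> Legendre (int c) (int CARD('p)) = -1" for c
    define c where "c = (LEAST c. Q c)"
    have "Q (nat (padic_coord u 1))"
      using 3 coord_range[of u 1] by (simp add: Q_def leg_def)
    then have c: "Q c" unfolding c_def by (rule LeastI)
    have c0: "c \<noteq> 0"
    proof
      assume "c = 0"
      then show False using c Legendre_eq_0_iff[of 0 "int CARD('p)"] by (simp add: Q_def)
    qed
    have nq: "\<not> Q (c - 1)" using c0 not_less_Least[of "c - 1" Q] by (simp add: c_def)
    have cc: "int c = int (c - 1) + 1" using c0 by simp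
    have "Legendre (int (c - 1)) (int CARD('p)) \<noteq> 0"
    proof
      assume "Legendre (int (c - 1)) (int CARD('p)) = 0"
      then have "[int c = 1] (mod int CARD('p))"
        using c0 by (simp add: Legendre_eq_0_iff cong_iff_dvd_diff of_nat_diff)
      then show False
        using c Legendre_cong[of "int c" 1] Legendre_1[OF prime_p[where 'p = 'p]] by (simp add: Q_def)
    qed
    then have "leg (of_int (int (c - 1)) :: 'p padic_int) = 1"
      using nq Legendre_values[of "int (c - 1)" "int CARD('p)"] by (auto simp: Q_def leg_of_int simp del: of_int_of_nat_eq)
    then obtain r :: "'p padic_int" where r: "of_int (int (c - 1)) = r\<^sup>2"
      using padic_sqrt[OF odd] by metis
    have "leg (u * of_int (int c)) = 1"
      using c 3 by (simp add: leg_mult[OF odd] leg_of_int Q_def del: of_int_of_nat_eq)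
    then obtain z where z: "u * of_int (int c) = z\<^sup>2" using padic_sqrt[OF odd] by metis
    have zz: "z\<^sup>2 = u * r\<^sup>2 + u"
      unfolding z[symmetric] r[symmetric] cc by (simp add: algebra_simps)
    obtain w where w: "v * w = 1" using v by (metis dvdE)
    have "leg (u * v) = 1" using 3 by (simp add: leg_mult[OF odd])
    then obtain s where s: "u * v = s\<^sup>2" using padic_sqrt[OF odd] by metis
    have "v * (s * w)\<^sup>2 = u * (v * w) * (v * w)"
      by (simp add: power_mult_distrib flip: s) (simp add: power2_eq_square)
    then have "z\<^sup>2 = u * r\<^sup>2 + v * (s * w)\<^sup>2" using zz w by simp
    moreover have "(r, s * w, z) \<noteq> (0, 0, 0)"
    proof -
      have "s \<noteq> 0" "w \<noteq> 0" using s w u v by auto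
      then show ?thesis by simp
    qed
    ultimately show ?thesis unfolding conic_solvable_def by blast
  qed
qed

text \<open>Homogeneity allows division by the highest power of p common to the three coordinates;
  it exists because some coordinate is nonzero.\<close>

lemma conic_primitive:
  fixes a b :: "'p::prime_card padic_int"
  assumes "conic_solvable a b"
  obtains x y z where "z\<^sup>2 = a * x\<^sup>2 + b * y\<^sup>2"
    "\<not> (of_nat CARD('p) dvd x \<and> of_nat CARD('p) dvd y \<and> of_nat CARD('p) dvd z)"
proof -
  let ?p = "of_nat CARD('p) :: 'p padic_int"
  obtain x y z where xyz: "(x, y, z) \<noteq> (0, 0, 0)" "z\<^sup>2 = a * x\<^sup>2 + b * y\<^sup>2"
    using assms unfolding conic_solvable_def by blast
  define P where "P k \<longleftrightarrow> \<not> (?p ^ k dvd x \<and> ?p ^ k dvd y \<and> ?p ^ k dvd z)" for k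
  have nd: "\<exists>k. \<not> ?p ^ k dvd t" if "t \<noteq> 0" for t
    using that padic_eqI[of t 0] by (auto simp: p_power_dvd_iff)
  then have "\<exists>k. P k" using xyz(1) unfolding P_def by (metis prod.inject)
  then have "P (LEAST k. P k)" by (rule LeastI_ex)
  moreover have "\<not> P 0" by (simp add: P_def)
  ultimately obtain k where k: "(LEAST k. P k) = Suc k" by (metis not0_implies_Suc)
  then have "P (Suc k)" "\<not> P k" using \<open>P (LEAST k. P k)\<close> not_less_Least[of k P] by auto
  then obtain x' y' z' where d: "x = ?p ^ k * x'" "y = ?p ^ k * y'" "z = ?p ^ k * z'"
    unfolding P_def by (metis dvdE)
  have "\<not> (?p dvd x' \<and> ?p dvd y' \<and> ?p dvd z')"
    using \<open>P (Suc k)\<close> unfolding P_def d by (metis mult_dvd_mono dvd_refl power_Suc2)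
  moreover have "z'\<^sup>2 = a * x'\<^sup>2 + b * y'\<^sup>2"
  proof -
    have "(?p ^ k)\<^sup>2 * z'\<^sup>2 = (?p ^ k)\<^sup>2 * (a * x'\<^sup>2 + b * y'\<^sup>2)"
      using xyz(2) unfolding d by (simp add: power_mult_distrib algebra_simps)
    then show ?thesis using p_nonzero[where 'p = 'p] by simp
  qed
  ultimately show ?thesis using that by blast
qed

text \<open>On a primitive point p cannot divide x: it would then divide z, and comparing powers of
  p also y. With x a unit, reduction mod p exhibits u as a square residue. Conversely such a u is
  itself a square.\<close>

lemma conic_solvable_unit_prime:
  fixes u v :: "'p::prime_card padic_int"
  assumes odd: "odd CARD('p)" and u: "u dvd 1" and v: "v dvd 1"
  shows "conic_solvable u (of_nat CARD('p) * v) \<longleftrightarrow> leg u = 1"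
proof
  let ?p = "of_nat CARD('p) :: 'p padic_int"
  assume "conic_solvable u (?p * v)"
  then obtain x y z where e: "z\<^sup>2 = u * x\<^sup>2 + ?p * v * y\<^sup>2"
    and prim: "\<not> (?p dvd x \<and> ?p dvd y \<and> ?p dvd z)" by (rule conic_primitive)
  have nu: "\<not> ?p dvd u" "\<not> ?p dvd v" using u v padic_unit_iff by auto
  have nx: "\<not> ?p dvd x"
  proof
    assume x: "?p dvd x"
    then have "?p dvd z\<^sup>2" unfolding e by (simp add: power2_eq_square mult.assoc)
    then have z: "?p dvd z" using prime_elem_p prime_elem_dvd_power by blast
    obtain x' z' where "x = ?p * x'" "z = ?p * z'" using x z by (metis dvdE)
    then have "?p * (v * y\<^sup>2) = ?p * (?p * (z'\<^sup>2 - u * x'\<^sup>2))"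
      using e by (simp add: power_mult_distrib power2_eq_square algebra_simps)
    then have "v * y\<^sup>2 = ?p * (z'\<^sup>2 - u * x'\<^sup>2)" using p_nonzero[where 'p = 'p] mult_left_cancel by blast
    then have "?p dvd v * y\<^sup>2" by simp
    then have "?p dvd y"
      using prime_elem_p nu prime_elem_dvd_mult_iff prime_elem_dvd_power by metis
    then show False using prim x z by blast
  qed
  have lz: "leg (z\<^sup>2) = leg (u * x\<^sup>2)"
    by (rule leg_cong) (simp add: e mult.assoc)
  have x1: "leg (x\<^sup>2) = 1" using nx leg_sq[OF odd] padic_unit_iff by blast
  have "leg (z\<^sup>2) = leg z * leg z" by (simp add: power2_eq_square leg_mult[OF odd])
  moreover have "leg (z\<^sup>2) = leg u" using lz x1 by (simp add: leg_mult[OF odd])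
  ultimately show "leg u = 1"
    using leg_unit[OF u] by (metis mult_minus_left zero_le_square neg_0_le_iff_le not_one_le_zero)
next
  assume "leg u = 1"
  then show "conic_solvable u (of_nat CARD('p) * v)"
    using padic_sqrt[OF odd] conic_solvable_square by metis
qed

lemma sign_power:
  fixes s :: int
  assumes "s = 1 \<or> s = -1"
  shows "s ^ n = (if even n then 1 else s)"
  using assms by auto

lemma power_parity_split: "t ^ n = (t ^ (n div 2))\<^sup>2 * (t ^ (n mod 2) :: 'a::comm_monoid_mult)"
proof -
  have "t ^ n = t ^ (n div 2 * 2 + n mod 2)" by simp
  then show ?thesis by (simp only: power_add power_mult)
qed

text \<open>Square factors drop out, so only the parities of m and k matter. Even orders are
  \<open>conic_solvable_units\<close>, mixed parities are
  \<open>conic_solvable_unit_prime\<close>.\<close>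

lemma tame_symbol:
  fixes u v :: "'p::prime_card padic_int"
  assumes odd: "odd CARD('p)" and u: "u dvd 1" and v: "v dvd 1"
  shows "hilbert_symbol (to_fract (of_nat CARD('p) ^ m * u)) (to_fract (of_nat CARD('p) ^ k * v))
    = leg (-1 :: 'p padic_int) ^ (m * k) * leg u ^ k * leg v ^ m"
proof -
  let ?p = "of_nat CARD('p) :: 'p padic_int"
  have p0: "?p ^ j \<noteq> 0" for j using p_nonzero[where 'p = 'p] by simp
  have m1: "(-1 :: 'p padic_int) dvd 1" by simp
  note signs = leg_unit[OF u] leg_unit[OF v] leg_unit[OF m1]
  have red: "conic_solvable (?p ^ m * u) (?p ^ k * v)
      \<longleftrightarrow> conic_solvable (?p ^ (m mod 2) * u) (?p ^ (k mod 2) * v)"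
    unfolding power_parity_split[of ?p m] power_parity_split[of ?p k] mult.assoc
    by (simp only: conic_solvable_square_left[OF p0] conic_solvable_square_right[OF p0])
  consider "even m" "even k" | "even m" "odd k" | "odd m" "even k" | "odd m" "odd k" by blast
  then have "(if conic_solvable (?p ^ m * u) (?p ^ k * v) then 1 else - 1)
      = leg (-1 :: 'p padic_int) ^ (m * k) * leg u ^ k * leg v ^ m"
  proof cases
    case 1
    then show ?thesis using red signs conic_solvable_units[OF odd u v]
      by (simp add: sign_power)
  next
    case 2
    then show ?thesis using red signs conic_solvable_unit_prime[OF odd u v]
      by (auto simp: sign_power mod2_eq_if)
  next
    case 3
    then show ?thesis using red signs conic_solvable_unit_prime[OF odd v u] conic_solvable_commute
      by (auto simp: sign_power mod2_eq_if)
  next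
    case 4
    have uv: "(- u * v) dvd 1" using u v by simp
    have pu: "?p * u \<noteq> 0" using p0[of 1] u by auto
    \<comment> \<open>For two odd orders the norm relation trades the second entry for p^2 (-u v),
      hence for the unit -u v.\<close>
    have "- (?p * u) * (?p * v) = ?p\<^sup>2 * (- u * v)" by (simp add: power2_eq_square)
    then have "conic_solvable (?p * u) (?p * v) \<longleftrightarrow> conic_solvable (?p * u) (?p\<^sup>2 * (- u * v))"
      using conic_solvable_norm[OF pu, of "?p * v"] by metis
    also have "\<dots> \<longleftrightarrow> conic_solvable (- u * v) (?p * u)"
      using conic_solvable_square_right[of ?p] p0[of 1] conic_solvable_commute by (metis power_one_right)
    also have "\<dots> \<longleftrightarrow> leg (- u * v) = 1"
      by (rule conic_solvable_unit_prime[OF odd uv u])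
    also have "leg (- u * v) = leg (-1 :: 'p padic_int) * leg u * leg v"
      using leg_mult[OF odd, of "-1" "u * v"] leg_mult[OF odd, of u v] by simp
    finally have "conic_solvable (?p * u) (?p * v) \<longleftrightarrow> leg (-1 :: 'p padic_int) * leg u * leg v = 1" .
    moreover have "?p ^ (m mod 2) = ?p" "?p ^ (k mod 2) = ?p" using 4 by (auto simp: mod2_eq_if)
    ultimately show ?thesis using red signs 4 by (auto simp: sign_power)
  qed
  then show ?thesis by (simp only: hilbert_symbol_to_fract)
qed

lemma hilbert_symbol_values: "hilbert_symbol a b = 1 \<or> hilbert_symbol a b = -1"
  by (simp add: hilbert_symbol_def)

lemma padic_ord_to_fract:
  fixes u :: "'p::prime_card padic_int"
  assumes u: "u dvd 1"
  shows "padic_ord (to_fract (of_nat CARD('p) ^ m * u)) = int m"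
proof -
  have tp: "to_fract (of_nat CARD('p) ^ j) = (of_nat CARD('p) :: 'p padic) powi int j" for j
  proof -
    have "to_fract (of_nat i) = (of_nat i :: 'p padic)" for i by (induction i) simp_all
    then have "to_fract (of_nat CARD('p) ^ j) = (of_nat CARD('p) ^ j :: 'p padic)"
      by (induction j) simp_all
    then show ?thesis by simp
  qed
  have p0: "(of_nat CARD('p) :: 'p padic) \<noteq> 0"
    using tp[of 1] p_nonzero[where 'p = 'p] to_fract_eq_0_iff[of "of_nat CARD('p) :: 'p padic_int"]
    by (metis power_int_1_right of_nat_1 power_one_right)
  show ?thesis
    unfolding padic_ord_def
  proof (rule the_equality)
    show "\<exists>v. v dvd 1 \<and> to_fract (of_nat CARD('p) ^ m * u) = of_nat CARD('p) powi int m * to_fract v"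
      using u tp by (intro exI[of _ u]) simp
    fix k
    assume "\<exists>v. v dvd 1 \<and> to_fract (of_nat CARD('p) ^ m * u) = of_nat CARD('p) powi k * to_fract v"
    then obtain v where v: "v dvd 1"
      and e: "to_fract (of_nat CARD('p) ^ m * u) = of_nat CARD('p) powi k * to_fract v" by blast
    \<comment> \<open>Multiplying by p^j makes both exponents natural, so the equation descends to
      the p-adic integers, where orders are unique.\<close>
    obtain i j where k: "k = int i - int j" by (rule int_diff_cases)
    have "to_fract (of_nat CARD('p) ^ (m + j) * u) = (of_nat CARD('p) :: 'p padic) powi int j
        * to_fract (of_nat CARD('p) ^ m * u)"
      unfolding to_fract_mult tp using p0 by (simp add: power_int_add)
    also have "\<dots> = of_nat CARD('p) powi (int j + k) * to_fract v"
      unfolding e using p0 by (simp add: power_int_add)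
    also have "\<dots> = to_fract (of_nat CARD('p) ^ i * v)"
      unfolding to_fract_mult tp k by simp
    finally have "of_nat CARD('p) ^ (m + j) * u = of_nat CARD('p) ^ i * v"
      by (simp only: to_fract_eq_iff)
    then show "k = int m" using p_power_mult_unit_inj(1)[OF _ u v] k by fastforce
  qed
qed

section \<open>The cocycle is trivial on the maximal compact subgroup\<close>

lemma mat2_nth [simp]:
  "mat2 a b c d $ 1 $ 1 = a" "mat2 a b c d $ 1 $ 2 = b"
  "mat2 a b c d $ 2 $ 1 = c" "mat2 a b c d $ 2 $ 2 = d"
  by (simp_all add: mat2_def)

definition zmat :: "'p::prime_card padic_int \<Rightarrow> 'p padic_int \<Rightarrow> 'p padic_int \<Rightarrow> 'p padic_int \<Rightarrow> 'p mat2" where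
  "zmat a b c d = mat2 (to_fract a) (to_fract b) (to_fract c) (to_fract d)"

lemma zmat_nth [simp]:
  "zmat a b c d $ 1 $ 1 = to_fract a" "zmat a b c d $ 1 $ 2 = to_fract b"
  "zmat a b c d $ 2 $ 1 = to_fract c" "zmat a b c d $ 2 $ 2 = to_fract d"
  by (simp_all add: zmat_def)

lemma zmat_inject [simp]: "zmat a b c d = zmat a' b' c' d' \<longleftrightarrow> a = a' \<and> b = b' \<and> c = c' \<and> d = d'"
  by (simp add: vec_eq_iff forall_2)

lemma zmat_mult:
  "zmat a b c d ** zmat a' b' c' d' =
    zmat (a * a' + b * c') (a * b' + b * d') (c * a' + d * c') (c * b' + d * d')"
  by (simp add: vec_eq_iff forall_2 matrix_matrix_mult_def sum_2)

lemma mat_1_zmat: "mat 1 = zmat 1 0 0 1"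
  by (simp add: vec_eq_iff forall_2 mat_def)

lemma zmat_in_SL2_Zp: "zmat a b c d \<in> SL2_Zp \<longleftrightarrow> a * d - b * c = 1"
proof -
  have "det (zmat a b c d) = to_fract (a * d - b * c)" by (simp add: det_2)
  then have "det (zmat a b c d) = 1 \<longleftrightarrow> a * d - b * c = 1"
    by (metis to_fract_1 to_fract_eq_iff)
  then show ?thesis by (simp add: SL2_Zp_def SL2_Qp_def forall_2)
qed

lemma SL2_Zp_cases:
  assumes "A \<in> SL2_Zp"
  obtains a b c d where "A = zmat a b c d" "a * d - b * c = 1"
proof -
  have "\<forall>i j. A $ i $ j \<in> range to_fract" using assms by (simp add: SL2_Zp_def)
  then obtain a b c d where "A $ 1 $ 1 = to_fract a" "A $ 1 $ 2 = to_fract b"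
    "A $ 2 $ 1 = to_fract c" "A $ 2 $ 2 = to_fract d"
    by (meson imageE)
  then have "A = zmat a b c d" by (simp add: vec_eq_iff forall_2)
  then show ?thesis using that assms zmat_in_SL2_Zp by blast
qed

lemma SL2_Zp_subset: "SL2_Zp \<subseteq> SL2_Qp"
  by (auto simp: SL2_Zp_def)

lemma SL2_Qp_mult: "A \<in> SL2_Qp \<Longrightarrow> B \<in> SL2_Qp \<Longrightarrow> A ** B \<in> SL2_Qp"
  by (simp add: SL2_Qp_def det_mul)

lemma SL2_Zp_mult: "A \<in> SL2_Zp \<Longrightarrow> B \<in> SL2_Zp \<Longrightarrow> A ** B \<in> SL2_Zp"
proof (elim SL2_Zp_cases)
  fix a b c d a' b' c' d' :: "'a padic_int"
  assume e: "A = zmat a b c d" "B = zmat a' b' c' d'"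
    and d: "a * d - b * c = 1" "a' * d' - b' * c' = 1"
  have "(a * a' + b * c') * (c * b' + d * d') - (a * b' + b * d') * (c * a' + d * c')
      = (a * d - b * c) * (a' * d' - b' * c')" by (simp add: algebra_simps)
  then show ?thesis unfolding e zmat_mult zmat_in_SL2_Zp by (simp only: d mult_1)
qed

text \<open>Mod p the determinant reads a d = 1. The equality of symbols is why \<eta>(a) and
  \<eta>(d) define the same character of K_0(p^n).\<close>

lemma det_1_lower_triangular_mod:
  fixes a b c d :: "'p::prime_card padic_int"
  assumes odd: "odd CARD('p)" and det: "a * d - b * c = 1" and c: "of_nat CARD('p) dvd c"
  shows "a dvd 1" "d dvd 1" "leg a = leg d"
proof -
  have "a * d - 1 = b * c" using det by (simp add: algebra_simps)
  then have dv: "of_nat CARD('p) dvd a * d - 1" using c by simp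
  have "leg (a * d) = 1" using leg_cong[OF dv] by simp
  then have l: "leg a * leg d = 1" by (simp add: leg_mult[OF odd])
  show ad: "a dvd 1" "d dvd 1" using l leg_eq_0_iff[of a] leg_eq_0_iff[of d] padic_unit_iff by force+
  show "leg a = leg d" using l leg_unit[OF ad(1)] by auto
qed

text \<open>The exponent makes one formula cover every order: for even m the definition omits the
  symbol and the power is 1, for odd m the tame formula gives \<open>leg d\<close>. At m = 0 the
  entry d may be a nonunit, which the exponent 0 tolerates.\<close>

lemma s_p_zmat:
  fixes a b u d :: "'p::prime_card padic_int"
  assumes odd: "odd CARD('p)" and u: "u dvd 1" and d: "m > 0 \<Longrightarrow> d dvd 1"
  shows "s_p (zmat a b (of_nat CARD('p) ^ m * u) d) = leg d ^ m"
proof (cases "even m")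
  case True
  have "leg d ^ m = 1"
    using True d leg_unit[of d] by (cases "m = 0") (auto simp: sign_power)
  then show ?thesis
    using True padic_ord_to_fract[OF u, of m] by (simp only: s_p_def zmat_nth) simp
next
  case False
  then have d1: "d dvd 1" using d by (cases m) auto
  have "of_nat CARD('p) ^ m * u \<noteq> 0" "d \<noteq> 0"
    using p_nonzero[where 'p = 'p] u d1 by auto
  then have "to_fract (of_nat CARD('p) ^ m * u) * to_fract d \<noteq> 0"
    by (simp only: mult_eq_0_iff to_fract_eq_0_iff) simp
  then have "s_p (zmat a b (of_nat CARD('p) ^ m * u) d)
      = hilbert_symbol (to_fract (of_nat CARD('p) ^ m * u)) (to_fract d)"
    using False padic_ord_to_fract[OF u, of m] by (simp only: s_p_def zmat_nth) simp
  also have "\<dots> = leg d ^ m"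
    using tame_symbol[OF odd u d1, of m 0] by simp
  finally show ?thesis .
qed

lemma s_p_zmat_0: "s_p (zmat a b 0 d) = 1"
  by (simp add: s_p_def)

lemma tame_symbol':
  fixes x y u v :: "'p::prime_card padic_int"
  assumes "odd CARD('p)" "u dvd 1" "v dvd 1"
    and "x = of_nat CARD('p) ^ m * u" "y = of_nat CARD('p) ^ k * v"
  shows "hilbert_symbol (to_fract x) (to_fract y) = leg (-1 :: 'p padic_int) ^ (m * k) * leg u ^ k * leg v ^ m"
  using tame_symbol[OF assms(1-3), of m k] assms(4,5) by simp

text \<open>The orders of the lower left entries of two matrices and of their product are constrained by
  \<open>c'' = c a' + d c'\<close>; in each case the signs in the tame formula cancel.\<close>

lemma mp_cocycle_generic:
  fixes a b c d a' b' c' d' :: "'p::prime_card padic_int"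
  assumes odd: "odd CARD('p)"
    and g: "a * d - b * c = 1" and h: "a' * d' - b' * c' = 1"
    and nz: "c \<noteq> 0" "c' \<noteq> 0" "c * a' + d * c' \<noteq> 0"
  shows "mp_cocycle (zmat a b c d) (zmat a' b' c' d') = 1"
proof -
  let ?p = "of_nat CARD('p) :: 'p padic_int"
  define c2 where "c2 = c * a' + d * c'"
  define d2 where "d2 = c * b' + d * d'"
  obtain m u where c: "c = ?p ^ m * u" and u: "u dvd 1" using padic_decomp[OF nz(1)] by metis
  obtain m' u' where c': "c' = ?p ^ m' * u'" and u': "u' dvd 1" using padic_decomp[OF nz(2)] by metis
  obtain m2 u2 where c2u: "c2 = ?p ^ m2 * u2" and u2: "u2 dvd 1"
    using padic_decomp[OF nz(3)] unfolding c2_def by metis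
  have "(a * a' + b * c') * d2 - (a * b' + b * d') * c2 = (a * d - b * c) * (a' * d' - b' * c')"
    by (simp add: algebra_simps c2_def d2_def)
  then have gh: "(a * a' + b * c') * d2 - (a * b' + b * d') * c2 = 1" by (simp only: g h mult_1)
  \<comment> \<open>Lower left entry of (g h) h^-1; mod p it relates c and c' when c2 is not a
    unit.\<close>
  have inv_row: "c = c2 * d' - d2 * c'"
  proof -
    have "c2 * d' - d2 * c' = c * (a' * d' - b' * c')" by (simp add: c2_def d2_def algebra_simps)
    then show ?thesis by (simp only: h mult_1_right)
  qed
  have dm: "of_nat CARD('p) dvd c" "a dvd 1" "d dvd 1" "leg a = leg d" if "m > 0"
  proof -
    show p: "of_nat CARD('p) dvd c" using that c by (metis dvd_mult2 dvd_power)
    show "a dvd 1" "d dvd 1" "leg a = leg d" using det_1_lower_triangular_mod[OF odd g p] by auto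
  qed
  have dm': "of_nat CARD('p) dvd c'" "a' dvd 1" "d' dvd 1" "leg a' = leg d'" if "m' > 0"
  proof -
    show p: "of_nat CARD('p) dvd c'" using that c' by (metis dvd_mult2 dvd_power)
    show "a' dvd 1" "d' dvd 1" "leg a' = leg d'" using det_1_lower_triangular_mod[OF odd h p] by auto
  qed
  have dm2: "of_nat CARD('p) dvd c2" "d2 dvd 1" if "m2 > 0"
  proof -
    show p: "of_nat CARD('p) dvd c2" using that c2u by (metis dvd_mult2 dvd_power)
    show "d2 dvd 1" using det_1_lower_triangular_mod[OF odd gh p] by auto
  qed
  have m1: "(-1 :: 'p padic_int) dvd 1" by simp
  note signs = leg_unit[OF m1] leg_unit[OF u] leg_unit[OF u'] leg_unit[OF u2]
  \<comment> \<open>The tame formula for the pair (c2 c, c2 c'), with orders m2 + m and m2 + m' and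
    unit parts u2 u and u2 u'.\<close>
  define H where "H = leg (-1 :: 'p padic_int) ^ ((m2 + m) * (m2 + m'))
      * leg (u2 * u) ^ (m2 + m') * leg (u2 * u') ^ (m2 + m)"
  have cocycle: "mp_cocycle (zmat a b c d) (zmat a' b' c' d')
      = H * leg d ^ m * leg d' ^ m' * leg d2 ^ m2"
  proof -
    have "hilbert_symbol (to_fract (c2 * c)) (to_fract (c2 * c')) = H"
      unfolding H_def
      by (rule tame_symbol'[OF odd]) (use u u' u2 in \<open>simp_all add: c c' c2u power_add ac_simps\<close>)
    moreover have "s_p (zmat a b c d) = leg d ^ m" unfolding c
      by (rule s_p_zmat[OF odd u dm(3)])
    moreover have "s_p (zmat a' b' c' d') = leg d' ^ m'" unfolding c'
      by (rule s_p_zmat[OF odd u' dm'(3)])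
    moreover have "s_p (zmat (a * a' + b * c') (a * b' + b * d') c2 d2) = leg d2 ^ m2" unfolding c2u
      by (rule s_p_zmat[OF odd u2 dm2(2)])
    moreover have "tau (zmat a b c d) = to_fract c" "tau (zmat a' b' c' d') = to_fract c'"
      "tau (zmat (a * a' + b * c') (a * b' + b * d') c2 d2) = to_fract c2"
      using nz by (simp_all only: tau_def zmat_nth to_fract_eq_0_iff c2_def) simp_all
    ultimately show ?thesis
      by (simp only: mp_cocycle_def sigma0_def zmat_mult c2_def[symmetric] d2_def[symmetric]
          to_fract_mult[symmetric] mult.assoc)
  qed
  note lm = leg_mult[OF odd]
  have unit_order: "m2 = 0" "leg u2 = leg c2" if "\<not> ?p dvd c2"
  proof -
    show "m2 = 0" using that c2u by (metis dvd_mult2 dvd_power gr0I)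
    then show "leg u2 = leg c2" using c2u by simp
  qed
  \<comment> \<open>The order m2 is the smaller of m and m' unless these agree, in which case the
    leading terms may cancel.\<close>
  consider "m = 0" "m' = 0" "m2 = 0" | "m = 0" "m' = 0" "m2 > 0"
    | "m = 0" "m' > 0" | "m > 0" "m' = 0"
    | "m > 0" "m' > 0" "m < m'" | "m > 0" "m' > 0" "m' < m"
    | "m > 0" "m' > 0" "m = m'" by linarith
  then have "H * leg d ^ m * leg d' ^ m' * leg d2 ^ m2 = 1"
  proof cases
    case 1
    then show ?thesis by (simp add: H_def)
  next
    case 2
    have "leg c = leg (- 1 * d2 * c')"
      by (rule leg_cong) (use inv_row dm2(1)[OF 2(3)] in simp)
    then have e: "leg u = leg (- 1 :: 'p padic_int) * leg d2 * leg u'"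
      using 2 c c' by (simp only: lm) simp
    show ?thesis
      using signs leg_unit[OF dm2(2)[OF 2(3)]] 2 unfolding H_def
      by (cases "even m2") (auto simp: lm e sign_power)
  next
    case 3
    have e: "leg c2 = leg c * leg a'"
      unfolding lm[symmetric] c2_def by (rule leg_cong) (use dm'(1)[OF 3(2)] in simp)
    then have "leg c2 \<noteq> 0" using 3 c signs leg_unit[OF dm'(2)[OF 3(2)]] by auto
    then have "m2 = 0" "leg u2 = leg u * leg d'"
      using unit_order leg_eq_0_iff[of c2] e 3 c dm'(4) by auto
    then show ?thesis
      using signs leg_unit[OF dm'(3)[OF 3(2)]] 3 unfolding H_def
      by (auto simp: lm sign_power)
  next
    case 4
    have e: "leg c2 = leg d * leg c'"
      unfolding lm[symmetric] c2_def by (rule leg_cong) (use dm(1)[OF 4(1)] in simp)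
    then have "leg c2 \<noteq> 0" using 4 c' signs leg_unit[OF dm(3)[OF 4(1)]] by auto
    then have "m2 = 0" "leg u2 = leg d * leg u'"
      using unit_order leg_eq_0_iff[of c2] e 4 c' by auto
    then show ?thesis
      using signs leg_unit[OF dm(3)[OF 4(1)]] 4 unfolding H_def
      by (auto simp: lm sign_power)
  next
    case 5
    obtain j where j: "m' = m + Suc j" using 5(3) less_imp_Suc_add by auto
    define w where "w = u * a' + ?p * (?p ^ j * (d * u'))"
    have cw: "c2 = ?p ^ m * w" unfolding c2_def c c' j w_def by (simp add: power_add algebra_simps)
    have lw: "leg w = leg u * leg a'" unfolding lm[symmetric] w_def by (rule leg_cong) simp
    then have "leg w \<noteq> 0" using signs leg_unit[OF dm'(2)[OF 5(2)]] by auto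
    then have "w dvd 1" by (simp only: leg_eq_0_iff padic_unit_iff not_False_eq_True)
    then have m2: "m2 = m" "leg u2 = leg u * leg d'"
      using p_power_mult_unit_inj[of m w m2 u2] cw c2u u2 lw dm'(4)[OF 5(2)] by auto
    have "leg d2 = leg (d * d')"
      unfolding d2_def by (rule leg_cong) (use dm(1)[OF 5(1)] in simp)
    then show ?thesis
      using signs leg_unit[OF dm'(3)[OF 5(2)]] leg_unit[OF dm(3)[OF 5(1)]] m2 unfolding H_def
      by (cases "even m"; cases "even m'") (auto simp: lm sign_power)
  next
    case 6
    obtain j where j: "m = m' + Suc j" using 6(3) less_imp_Suc_add by auto
    define w where "w = d * u' + ?p * (?p ^ j * (u * a'))"
    have cw: "c2 = ?p ^ m' * w" unfolding c2_def c c' j w_def by (simp add: power_add algebra_simps)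
    have lw: "leg w = leg d * leg u'" unfolding lm[symmetric] w_def by (rule leg_cong) simp
    then have "leg w \<noteq> 0" using signs leg_unit[OF dm(3)[OF 6(1)]] by auto
    then have "w dvd 1" by (simp only: leg_eq_0_iff padic_unit_iff not_False_eq_True)
    then have m2: "m2 = m'" "leg u2 = leg d * leg u'"
      using p_power_mult_unit_inj[of m' w m2 u2] cw c2u u2 lw by auto
    have "leg d2 = leg (d * d')"
      unfolding d2_def by (rule leg_cong) (use dm(1)[OF 6(1)] in simp)
    then show ?thesis
      using signs leg_unit[OF dm'(3)[OF 6(2)]] leg_unit[OF dm(3)[OF 6(1)]] m2 unfolding H_def
      by (cases "even m"; cases "even m'") (auto simp: lm sign_power)
  next
    case 7
    define w where "w = u * a' + d * u'"
    have cw: "c2 = ?p ^ m * w" unfolding c2_def c c' 7(3)[symmetric] w_def by (simp add: algebra_simps)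
    have ld2: "leg d2 = leg (d * d')"
      unfolding d2_def by (rule leg_cong) (use dm(1)[OF 7(1)] in simp)
    show ?thesis
    proof (cases "?p dvd w")
      case False
      then have "m2 = m"
        using p_power_mult_unit_inj[of m w m2 u2] cw c2u u2 padic_unit_iff by auto
      then show ?thesis
        using signs leg_unit[OF dm'(3)[OF 7(2)]] leg_unit[OF dm(3)[OF 7(1)]] ld2 7 unfolding H_def
        by (cases "even m") (auto simp: lm sign_power)
    next
      case True
      \<comment> \<open>Cancellation of the leading terms is itself a relation among the symbols; it
        makes up for m2 and u2 being undetermined.\<close>
      have "leg (u * a') = leg (- 1 * d * u')"
        by (rule leg_cong) (use True in \<open>simp add: w_def\<close>)
      then have e: "leg u * leg d' = leg (- 1 :: 'p padic_int) * leg d * leg u'"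
        using dm'(4)[OF 7(2)] by (simp only: lm)
      show ?thesis
        using signs leg_unit[OF dm'(3)[OF 7(2)]] leg_unit[OF dm(3)[OF 7(1)]] ld2 e 7 unfolding H_def
        by (cases "even m"; cases "even m2") (auto simp: lm sign_power)
    qed
  qed
  then show ?thesis using cocycle by simp
qed

text \<open>When a lower left entry vanishes, \<open>tau\<close> switches to the lower right one,
  which the determinant makes a unit, and \<open>s_p\<close> of that matrix is 1. The tame formula
  still applies, with that entry of order 0.\<close>

lemma mp_cocycle_SL2_Zp_zmat:
  fixes a b c d a' b' c' d' :: "'p::prime_card padic_int"
  assumes odd: "odd CARD('p)"
    and g: "a * d - b * c = 1" and h: "a' * d' - b' * c' = 1"
  shows "mp_cocycle (zmat a b c d) (zmat a' b' c' d') = 1"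
proof -
  let ?p = "of_nat CARD('p) :: 'p padic_int"
  define c2 where "c2 = c * a' + d * c'"
  define d2 where "d2 = c * b' + d * d'"
  have "(a * a' + b * c') * d2 - (a * b' + b * d') * c2 = (a * d - b * c) * (a' * d' - b' * c')"
    by (simp add: algebra_simps c2_def d2_def)
  then have gh: "(a * a' + b * c') * d2 - (a * b' + b * d') * c2 = 1" by (simp only: g h mult_1)
  have inv_row: "c = c2 * d' - d2 * c'"
  proof -
    have "c2 * d' - d2 * c' = c * (a' * d' - b' * c')" by (simp add: c2_def d2_def algebra_simps)
    then show ?thesis by (simp only: h mult_1_right)
  qed
  have unfolded: "mp_cocycle (zmat a b c d) (zmat a' b' c' d') =
      hilbert_symbol (to_fract ((if c2 \<noteq> 0 then c2 else d2) * (if c \<noteq> 0 then c else d)))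
        (to_fract ((if c2 \<noteq> 0 then c2 else d2) * (if c' \<noteq> 0 then c' else d')))
      * s_p (zmat a b c d) * s_p (zmat a' b' c' d')
      * s_p (zmat (a * a' + b * c') (a * b' + b * d') c2 d2)"
  proof -
    have "tau (zmat a b c d) = to_fract (if c \<noteq> 0 then c else d)" for a b c d :: "'p padic_int"
      by (simp add: tau_def)
    then show ?thesis
      by (simp only: mp_cocycle_def sigma0_def zmat_mult c2_def d2_def to_fract_mult)
  qed
  note lm = leg_mult[OF odd]
  have leg_unit_1: "x dvd 1" "y dvd 1" "leg x = leg y" if "x * y = 1" for x y :: "'p padic_int"
  proof -
    show xy: "x dvd 1" "y dvd 1" using that by (metis dvd_triv_left, metis dvd_triv_right)
    show "leg x = leg y"
      using arg_cong[OF that, of leg] leg_unit[OF xy(1)] leg_unit[OF xy(2)] by (auto simp: lm)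
  qed
  show ?thesis
  proof (cases "c = 0")
    case c0: True
    have ad: "a * d = 1" using g c0 by simp
    note dd = leg_unit_1[OF ad]
    have c2: "c2 = d * c'" and d2: "d2 = d * d'" by (simp_all add: c2_def d2_def c0)
    show ?thesis
    proof (cases "c' = 0")
      case True
      then have "a' * d' = 1" using h by simp
      note dd' = leg_unit_1[OF this]
      have "hilbert_symbol (to_fract (d2 * d)) (to_fract (d2 * d')) = 1"
        using tame_symbol[OF odd, of "d2 * d" "d2 * d'" 0 0] dd dd' by (simp add: d2)
      then show ?thesis unfolding unfolded using True c0 by (simp add: c2 s_p_zmat_0)
    next
      case False
      obtain m u where c': "c' = ?p ^ m * u" and u: "u dvd 1" using padic_decomp[OF False] by metis
      have dv: "?p dvd c'" if "m > 0" using that c' by (metis dvd_mult2 dvd_power)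
      have d': "d' dvd 1" if "m > 0" using det_1_lower_triangular_mod[OF odd h dv[OF that]] by auto
      have "hilbert_symbol (to_fract (c2 * d)) (to_fract (c2 * c')) = leg d ^ m"
      proof -
        have "hilbert_symbol (to_fract (c2 * d)) (to_fract (c2 * c'))
          = leg (-1 :: 'p padic_int) ^ (m * (2 * m)) * leg (d\<^sup>2 * u) ^ (2 * m) * leg (d * u\<^sup>2) ^ m"
          by (rule tame_symbol'[OF odd])
            (use u dd in \<open>simp_all add: c' c2 power2_eq_square mult_2 mult_2_right power_add ac_simps\<close>)
        also have "\<dots> = leg d ^ m"
          using leg_sq[OF odd u] leg_unit[OF u] leg_unit[OF dd(2)]
            leg_unit[of "-1 :: 'p padic_int"] by (auto simp: lm power2_eq_square sign_power)
        finally show ?thesis .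
      qed
      moreover have "s_p (zmat a' b' c' d') = leg d' ^ m" unfolding c' by (rule s_p_zmat[OF odd u d'])
      moreover have "s_p (zmat x y c2 d2) = leg d2 ^ m" for x y
      proof -
        have "c2 = ?p ^ m * (d * u)" by (simp add: c2 c' ac_simps)
        moreover have "d2 dvd 1" if "m > 0" using d'[OF that] dd(2) by (simp add: d2)
        moreover have "d * u dvd 1" using u dd(2) by simp
        ultimately show ?thesis using s_p_zmat[OF odd, of "d * u" m d2] by simp
      qed
      moreover have "c2 \<noteq> 0" using False dd(2) by (auto simp: c2)
      moreover have "leg d ^ m * leg d' ^ m * leg d2 ^ m = 1"
        using leg_unit[OF dd(2)] leg_unit[of d'] d' by (cases "m = 0") (auto simp: d2 lm sign_power)
      ultimately show ?thesis using c0 False unfolding unfolded by (simp add: s_p_zmat_0)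
    qed
  next
    case c: False
    obtain m u where cu: "c = ?p ^ m * u" and u: "u dvd 1" using padic_decomp[OF c] by metis
    have dv: "?p dvd c" if "m > 0" using that cu by (metis dvd_mult2 dvd_power)
    have d: "d dvd 1" if "m > 0" using det_1_lower_triangular_mod[OF odd g dv[OF that]] by auto
    have sg: "s_p (zmat a b c d) = leg d ^ m" unfolding cu by (rule s_p_zmat[OF odd u d])
    show ?thesis
    proof (cases "c' = 0")
      case True
      then have ad': "a' * d' = 1" using h by simp
      note dd' = leg_unit_1[OF ad']
      have c2: "c2 = c * a'" by (simp add: c2_def True)
      have "hilbert_symbol (to_fract (c2 * c)) (to_fract (c2 * d')) = leg a' ^ m"
      proof -
        have "hilbert_symbol (to_fract (c2 * c)) (to_fract (c2 * d'))
          = leg (-1 :: 'p padic_int) ^ ((2 * m) * m) * leg (u\<^sup>2 * a') ^ m * leg u ^ (2 * m)"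
        proof (rule tame_symbol'[OF odd])
          have "c2 * d' = c * (a' * d')" by (simp add: c2 ac_simps)
          then show "c2 * d' = ?p ^ m * u" using ad' cu by simp
        qed (use u dd' in \<open>simp_all add: cu c2 power2_eq_square mult_2 mult_2_right power_add ac_simps\<close>)
        also have "\<dots> = leg a' ^ m"
          using leg_sq[OF odd u] leg_unit[OF u] leg_unit[OF dd'(1)]
            leg_unit[of "-1 :: 'p padic_int"] by (auto simp: lm power2_eq_square sign_power)
        finally show ?thesis .
      qed
      moreover have d2u: "d2 dvd 1 \<and> leg d2 = leg d * leg d'" if "m > 0"
      proof -
        have l: "leg d2 = leg d * leg d'"
          unfolding d2_def lm[symmetric] by (rule leg_cong) (use dv[OF that] in simp)
        moreover have "leg d2 \<noteq> 0" using l leg_unit[OF d[OF that]] leg_unit[OF dd'(2)] by auto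
        then have "d2 dvd 1" by (simp only: leg_eq_0_iff padic_unit_iff not_False_eq_True)
        ultimately show ?thesis by simp
      qed
      moreover have "s_p (zmat x y c2 d2) = leg d2 ^ m" for x y
      proof -
        have "c2 = ?p ^ m * (u * a')" by (simp add: c2 cu ac_simps)
        moreover have "u * a' dvd 1" using u dd'(1) by simp
        ultimately show ?thesis using s_p_zmat[OF odd, of "u * a'" m d2] d2u by simp
      qed
      moreover have "c2 \<noteq> 0" using c dd'(1) by (auto simp: c2)
      moreover have "leg a' ^ m * leg d ^ m * leg d2 ^ m = 1"
        using leg_unit[OF dd'(2)] leg_unit[of d] d d2u dd'(3)
        by (cases "m = 0") (auto simp: lm sign_power)
      ultimately show ?thesis using c True sg unfolding unfolded by (simp add: s_p_zmat_0)
    next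
      case c': False
      show ?thesis
      proof (cases "c2 = 0")
        case False
        then show ?thesis using mp_cocycle_generic[OF odd g h c c'] by (simp add: c2_def)
      next
        case True
        have d2: "(a * a' + b * c') * d2 = 1" using gh True by simp
        note d2u = leg_unit_1(2)[OF d2]
        \<comment> \<open>The row identity at c2 = 0. As d2 is a unit, c and c' have the same
          order.\<close>
        have cc: "c = - d2 * c'" using inv_row True by simp
        obtain m' u' where c'u: "c' = ?p ^ m' * u'" and u': "u' dvd 1" using padic_decomp[OF c'] by metis
        have "?p ^ m * u = ?p ^ m' * (- d2 * u')" using cc cu c'u by (simp add: ac_simps)
        then have mm: "m = m'" "u = - d2 * u'"
          using p_power_mult_unit_inj[of m u m' "- d2 * u'"] u u' d2u by auto
        have dv': "?p dvd c'" if "m > 0" using that c'u mm by (metis dvd_mult2 dvd_power)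
        have d': "d' dvd 1" if "m > 0" using det_1_lower_triangular_mod[OF odd h dv'[OF that]] by auto
        have sh: "s_p (zmat a' b' c' d') = leg d' ^ m" unfolding c'u mm(1)
          by (rule s_p_zmat[OF odd u' d']) (simp add: mm)
        have "hilbert_symbol (to_fract (d2 * c)) (to_fract (d2 * c')) = leg d2 ^ m"
        proof -
          have "hilbert_symbol (to_fract (d2 * c)) (to_fract (d2 * c'))
            = leg (-1 :: 'p padic_int) ^ (m * m) * leg (-1 * d2\<^sup>2 * u') ^ m * leg (d2 * u') ^ m"
            by (rule tame_symbol'[OF odd])
              (use u' d2u in \<open>simp_all add: cc c'u mm power2_eq_square ac_simps\<close>)
          also have "\<dots> = leg d2 ^ m"
            unfolding lm leg_sq[OF odd d2u] using leg_unit[OF u'] leg_unit[OF d2u]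
              leg_unit[of "-1 :: 'p padic_int"] by (auto simp: sign_power)
          finally show ?thesis .
        qed
        moreover have "leg d2 = leg d * leg d'" if "m > 0"
          unfolding d2_def lm[symmetric] by (rule leg_cong) (use dv[OF that] in simp)
        then have "leg d2 ^ m * leg d ^ m * leg d' ^ m = 1"
          using leg_unit[of d'] leg_unit[of d] d d' by (cases "m = 0") (auto simp: lm sign_power)
        ultimately show ?thesis using c c' True sg sh unfolding unfolded by (simp add: s_p_zmat_0)
      qed
    qed
  qed
qed

theorem mp_cocycle_SL2_Zp:
  fixes g h :: "'p::prime_card mat2"
  assumes "odd CARD('p)" "g \<in> SL2_Zp" "h \<in> SL2_Zp"
  shows "mp_cocycle g h = 1"
  using assms by (elim SL2_Zp_cases) (simp add: mp_cocycle_SL2_Zp_zmat)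

section \<open>The compact open subgroup and its subgroups\<close>

lemma to_fract_power: "to_fract (x ^ k) = to_fract x ^ k"
  by (induction k) simp_all

lemma to_fract_of_nat: "to_fract (of_nat k) = of_nat k"
  by (induction k) simp_all

lemma to_fract_in_padic_ideal:
  fixes c :: "'p::prime_card padic_int"
  shows "to_fract c \<in> padic_ideal n \<longleftrightarrow> of_nat CARD('p) ^ n dvd c"
proof -
  have "of_nat CARD('p) ^ n * to_fract a = to_fract (of_nat CARD('p) ^ n * a)" for a :: "'p padic_int"
    by (simp add: to_fract_power to_fract_of_nat)
  then show ?thesis by (auto simp: padic_ideal_def dvd_def simp del: to_fract_mult)
qed

lemma zmat_in_K0:
  fixes a b c d :: "'p::prime_card padic_int"
  shows "zmat a b c d \<in> K0 n \<longleftrightarrow> a * d - b * c = 1 \<and> of_nat CARD('p) ^ n dvd c"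
  by (simp add: K0_def zmat_in_SL2_Zp to_fract_in_padic_ideal)

lemma K0_subset: "K0 n \<subseteq> SL2_Zp"
  by (auto simp: K0_def)

lemma K0_cases:
  fixes A :: "'p::prime_card mat2"
  assumes "A \<in> K0 n"
  obtains a b c d where "A = zmat a b c d" "a * d - b * c = 1" "of_nat CARD('p) ^ n dvd c"
  using assms K0_subset SL2_Zp_cases zmat_in_K0 by (metis subsetD)

lemma zmat_in_principal_congruence:
  fixes a b c d :: "'p::prime_card padic_int"
  shows "zmat a b c d \<in> principal_congruence n \<longleftrightarrow> a * d - b * c = 1 \<and>
    of_nat CARD('p) ^ n dvd a - 1 \<and> of_nat CARD('p) ^ n dvd b \<and>
    of_nat CARD('p) ^ n dvd c \<and> of_nat CARD('p) ^ n dvd d - 1"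
proof -
  have "to_fract x - 1 \<in> padic_ideal n \<longleftrightarrow> of_nat CARD('p) ^ n dvd x - 1" for x :: "'p padic_int"
    using to_fract_in_padic_ideal[of "x - 1" n] by simp
  then show ?thesis
    by (auto simp: principal_congruence_def zmat_in_SL2_Zp forall_2 mat_def to_fract_in_padic_ideal)
qed

lemma principal_congruence_subset: "principal_congruence n \<subseteq> SL2_Zp"
  by (auto simp: principal_congruence_def)

lemma principal_congruence_subset_K0: "principal_congruence n \<subseteq> K0 n"
proof
  fix A assume A: "A \<in> principal_congruence n"
  then have "A \<in> SL2_Zp" using principal_congruence_subset by blast
  then obtain a b c d where "A = zmat a b c d" by (rule SL2_Zp_cases)
  then show "A \<in> K0 n" using A by (simp add: zmat_in_principal_congruence zmat_in_K0)
qed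

lemma mat_1_in_K0: "mat 1 \<in> K0 n"
  by (simp add: mat_1_zmat zmat_in_K0)

lemma mat_1_in_SL2_Zp: "mat 1 \<in> SL2_Zp"
  by (simp add: mat_1_zmat zmat_in_SL2_Zp)

lemma mat_1_in_principal_congruence: "mat 1 \<in> principal_congruence n"
  by (simp add: mat_1_zmat zmat_in_principal_congruence)

lemma K0_mult: "A \<in> K0 n \<Longrightarrow> B \<in> K0 n \<Longrightarrow> A ** B \<in> K0 n"
proof (elim K0_cases)
  fix a b c d a' b' c' d' :: "'a padic_int"
  assume e: "A = zmat a b c d" "B = zmat a' b' c' d'"
    and d: "a * d - b * c = 1" "a' * d' - b' * c' = 1"
    and dv: "of_nat CARD('a) ^ n dvd c" "of_nat CARD('a) ^ n dvd c'"
  have "A ** B \<in> SL2_Zp" using SL2_Zp_mult e d zmat_in_SL2_Zp by blast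
  moreover have "of_nat CARD('a) ^ n dvd c * a' + d * c'" using dv by simp
  ultimately show ?thesis unfolding e zmat_mult zmat_in_K0 zmat_in_SL2_Zp by simp
qed

lemma principal_congruence_mult:
  "A \<in> principal_congruence n \<Longrightarrow> B \<in> principal_congruence n \<Longrightarrow> A ** B \<in> principal_congruence n"
proof -
  assume AB: "A \<in> principal_congruence n" "B \<in> principal_congruence n"
  then obtain a b c d a' b' c' d' where e: "A = zmat a b c d" "B = zmat a' b' c' d'"
    using principal_congruence_subset by (meson SL2_Zp_cases subsetD)
  let ?q = "of_nat CARD('a) ^ n :: 'a padic_int"
  have dv: "?q dvd a - 1" "?q dvd b" "?q dvd c" "?q dvd d - 1"
    "?q dvd a' - 1" "?q dvd b'" "?q dvd c'" "?q dvd d' - 1"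
    using AB unfolding e zmat_in_principal_congruence by auto
  have "A ** B \<in> SL2_Zp" using AB SL2_Zp_mult principal_congruence_subset by blast
  moreover have "?q dvd (a - 1) * a' + (a' - 1) + b * c'"
    "?q dvd a * b' + b * d'" "?q dvd c * a' + d * c'"
    "?q dvd c * b' + ((d - 1) * d' + (d' - 1))"
    using dv by (intro dvd_add dvd_mult2[of ?q] dvd_mult[of ?q]; simp)+
  ultimately show ?thesis
    unfolding e zmat_mult zmat_in_SL2_Zp zmat_in_principal_congruence by (simp add: algebra_simps)
qed

text \<open>The adjugate, used as the inverse of an integral matrix of determinant 1; its entries
  stay polynomial.\<close>

definition adj2 :: "'p::prime_card mat2 \<Rightarrow> 'p mat2" where
  "adj2 A = mat2 (A $ 2 $ 2) (- (A $ 1 $ 2)) (- (A $ 2 $ 1)) (A $ 1 $ 1)"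

lemma adj2_zmat [simp]: "adj2 (zmat a b c d) = zmat d (- b) (- c) a"
  by (simp add: adj2_def zmat_def)

lemma adj2_SL2_Zp:
  assumes "A \<in> SL2_Zp"
  shows "adj2 A \<in> SL2_Zp" "A ** adj2 A = mat 1" "adj2 A ** A = mat 1"
  using assms by (auto elim!: SL2_Zp_cases simp: zmat_in_SL2_Zp zmat_mult mat_1_zmat algebra_simps)

lemma adj2_K0: "A \<in> K0 n \<Longrightarrow> adj2 A \<in> K0 n"
  by (auto elim!: K0_cases simp: zmat_in_K0 algebra_simps)

lemma adj2_mult:
  assumes "A \<in> SL2_Zp" "B \<in> SL2_Zp"
  shows "adj2 (A ** B) = adj2 B ** adj2 A"
  using assms by (auto elim!: SL2_Zp_cases simp: zmat_mult algebra_simps)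

lemma adj2_mult_cancel:
  assumes "A \<in> SL2_Zp"
  shows "adj2 A ** (A ** B) = B" "A ** (adj2 A ** B) = B" "(B ** A) ** adj2 A = B" "(B ** adj2 A) ** A = B"
  using adj2_SL2_Zp[OF assms]
  by (simp_all add: matrix_mul_assoc) (simp_all flip: matrix_mul_assoc)

lemma SL2_Zp_cancel_left:
  assumes "A \<in> SL2_Zp" "A ** B \<in> SL2_Zp"
  shows "B \<in> SL2_Zp"
  using assms adj2_SL2_Zp SL2_Zp_mult adj2_mult_cancel(1) by metis

lemma SL2_Zp_cancel_right:
  assumes "A \<in> SL2_Zp" "B ** A \<in> SL2_Zp"
  shows "B \<in> SL2_Zp"
  using assms adj2_SL2_Zp SL2_Zp_mult adj2_mult_cancel(3) by metis

subsection \<open>The cover over the compact subgroup\<close>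

lemma carrier_Mp2: "carrier Mp2 = SL2_Qp \<times> {1, -1}"
  by (simp add: Mp2_def)

lemma mult_Mp2: "(g, e) \<otimes>\<^bsub>Mp2\<^esub> (h, d) = (g ** h, e * d * mp_cocycle g h)"
  by (simp add: Mp2_def)

lemma fst_mult_Mp2: "fst (x \<otimes>\<^bsub>Mp2\<^esub> y) = fst x ** fst y"
  by (simp add: Mp2_def split_beta)

lemma one_Mp2: "\<one>\<^bsub>Mp2\<^esub> = (mat 1, 1)"
  by (simp add: Mp2_def)

lemma mult_Mp2_SL2_Zp:
  assumes "odd CARD('p::prime_card)" "(g :: 'p mat2) \<in> SL2_Zp" "h \<in> SL2_Zp"
  shows "(g, e) \<otimes>\<^bsub>Mp2\<^esub> (h, d) = (g ** h, e * d)"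
  using mp_cocycle_SL2_Zp[OF assms] by (simp add: mult_Mp2)

lemma mp_cocycle_values: "mp_cocycle g h = 1 \<or> mp_cocycle g h = -1"
proof -
  have s: "s_p A = 1 \<or> s_p A = -1" for A :: "'a mat2"
    using hilbert_symbol_values by (auto simp: s_p_def)
  have "sigma0 g h = 1 \<or> sigma0 g h = -1"
    unfolding sigma0_def by (rule hilbert_symbol_values)
  then show ?thesis
    unfolding mp_cocycle_def using s[of g] s[of h] s[of "g ** h"] by auto
qed

lemma Mp2_closed: "x \<in> carrier Mp2 \<Longrightarrow> y \<in> carrier Mp2 \<Longrightarrow> x \<otimes>\<^bsub>Mp2\<^esub> y \<in> carrier Mp2"
  using mp_cocycle_values[of "fst x" "fst y"]
  by (cases x; cases y) (auto simp: carrier_Mp2 mult_Mp2 SL2_Qp_mult)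

lemma cover_preimage_subset: "S \<subseteq> SL2_Zp \<Longrightarrow> cover_preimage S \<subseteq> carrier Mp2"
  using SL2_Zp_subset by (auto simp: cover_preimage_def carrier_Mp2)

text \<open>The inverse is a definite description: cancellation forces the matrix of any candidate
  to be \<open>adj2 g\<close>, and then triviality of the cocycle forces its sign to be e, which is
  its own inverse.\<close>

lemma inv_Mp2_SL2_Zp:
  fixes g :: "'p::prime_card mat2"
  assumes odd: "odd CARD('p)" and g: "g \<in> SL2_Zp" and e: "e = 1 \<or> e = -1"
  shows "inv\<^bsub>Mp2\<^esub> (g, e) = (adj2 g, e)"
  unfolding m_inv_def one_Mp2
proof (rule the_equality)
  show "(adj2 g, e) \<in> carrier Mp2 \<and> (g, e) \<otimes>\<^bsub>Mp2\<^esub> (adj2 g, e) = (mat 1, 1)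
      \<and> (adj2 g, e) \<otimes>\<^bsub>Mp2\<^esub> (g, e) = (mat 1, 1)"
    using adj2_SL2_Zp[OF g] g e SL2_Zp_subset
    by (auto simp: carrier_Mp2 mult_Mp2_SL2_Zp[OF odd])
  fix y
  assume y: "y \<in> carrier Mp2 \<and> (g, e) \<otimes>\<^bsub>Mp2\<^esub> y = (mat 1, 1) \<and> y \<otimes>\<^bsub>Mp2\<^esub> (g, e) = (mat 1, 1)"
  obtain h d where hd: "y = (h, d)" by (cases y)
  have "g ** h = mat 1" using y by (simp add: hd mult_Mp2)
  then have h: "h = adj2 g" using adj2_mult_cancel(1)[OF g, of h] by simp
  then have "e * d = 1"
    using y by (simp add: hd mult_Mp2_SL2_Zp[OF odd g adj2_SL2_Zp(1)[OF g]])
  then show "y = (adj2 g, e)" using h hd e by auto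
qed

lemma mult_Mp2_not_SL2_Zp:
  assumes "fst x \<in> SL2_Zp" "fst y \<notin> SL2_Zp"
  shows "fst (x \<otimes>\<^bsub>Mp2\<^esub> y) \<notin> SL2_Zp" "fst (y \<otimes>\<^bsub>Mp2\<^esub> x) \<notin> SL2_Zp"
proof -
  show "fst (x \<otimes>\<^bsub>Mp2\<^esub> y) \<notin> SL2_Zp"
    using assms SL2_Zp_cancel_left by (auto simp: fst_mult_Mp2)
  show "fst (y \<otimes>\<^bsub>Mp2\<^esub> x) \<notin> SL2_Zp"
    using assms SL2_Zp_cancel_right by (auto simp: fst_mult_Mp2)
qed

subsection \<open>Topology\<close>

lemma topspace_Mp2 [simp]: "topspace Mp2_topology = (carrier Mp2 :: 'p::prime_card mp2 set)"
proof -
  have "openin Mp2_topology (carrier Mp2 :: 'p mp2 set)"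
    unfolding openin_Mp2_topology Mp2_open_def
  proof (intro conjI ballI exI)
    fix x :: "'p mp2" and u :: "'p mat2"
    assume "x \<in> carrier Mp2" "u \<in> principal_congruence 0"
    then show "x \<otimes>\<^bsub>Mp2\<^esub> (u, 1) \<in> carrier Mp2"
      using principal_congruence_subset SL2_Zp_subset
      by (intro Mp2_closed) (auto simp: carrier_Mp2)
  qed simp
  moreover have "U \<subseteq> carrier Mp2" if "openin Mp2_topology U" for U :: "'p mp2 set"
    using that by (simp add: openin_Mp2_topology Mp2_open_def)
  ultimately show ?thesis
    unfolding topspace_def by blast
qed

text \<open>The cocycle being trivial here, translation by \<open>(u, 1)\<close> changes only the
  matrix, so openness becomes stability under one congruence subgroup.\<close>

lemma openin_Mp2_over_SL2_Zp:
  fixes U :: "'p::prime_card mp2 set"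
  assumes odd: "odd CARD('p)" and U: "U \<subseteq> cover_preimage SL2_Zp"
    and k: "\<And>g e u. (g, e) \<in> U \<Longrightarrow> u \<in> principal_congruence k \<Longrightarrow> (g ** u, e) \<in> U"
  shows "openin Mp2_topology U"
  unfolding openin_Mp2_topology Mp2_open_def
proof (intro conjI ballI exI)
  show "U \<subseteq> carrier Mp2" using U cover_preimage_subset by blast
  fix x :: "'p mp2" and u :: "'p mat2" assume x: "x \<in> U" and u: "u \<in> principal_congruence k"
  obtain g e where ge: "x = (g, e)" by (cases x)
  have "g \<in> SL2_Zp" "u \<in> SL2_Zp" using x ge U u principal_congruence_subset
    by (auto simp: cover_preimage_def)
  then show "x \<otimes>\<^bsub>Mp2\<^esub> (u, 1) \<in> U"
    using k x u unfolding ge by (simp add: mult_Mp2_SL2_Zp[OF odd])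
qed

text \<open>The complement is stable under right translation by integral matrices, so the
  neighbourhood of level 0, which comes from all of \<open>SL2_Zp\<close>, fits at every
  point.\<close>

lemma closedin_cover_SL2_Zp: "closedin Mp2_topology (cover_preimage SL2_Zp :: 'p::prime_card mp2 set)"
  unfolding closedin_def topspace_Mp2
proof
  show "cover_preimage SL2_Zp \<subseteq> (carrier Mp2 :: 'p mp2 set)"
    by (rule cover_preimage_subset) simp
  show "openin Mp2_topology (carrier Mp2 - cover_preimage SL2_Zp :: 'p mp2 set)"
    unfolding openin_Mp2_topology Mp2_open_def
  proof (intro conjI ballI exI)
    fix x :: "'p mp2" and u :: "'p mat2"
    assume x: "x \<in> carrier Mp2 - cover_preimage SL2_Zp" and u: "u \<in> principal_congruence 0"
    have uK: "u \<in> SL2_Zp" using u principal_congruence_subset by blast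
    have "x \<otimes>\<^bsub>Mp2\<^esub> (u, 1) \<in> carrier Mp2"
      using x uK SL2_Zp_subset by (intro Mp2_closed) (auto simp: carrier_Mp2)
    moreover have "fst x \<notin> SL2_Zp"
      using x by (cases x) (auto simp: carrier_Mp2 cover_preimage_def)
    then have "fst (x \<otimes>\<^bsub>Mp2\<^esub> (u, 1)) \<notin> SL2_Zp"
      using mult_Mp2_not_SL2_Zp(2)[of "(u, 1)" x] uK by simp
    then have "x \<otimes>\<^bsub>Mp2\<^esub> (u, 1) \<notin> cover_preimage SL2_Zp"
      by (auto simp: cover_preimage_def)
    ultimately show "x \<otimes>\<^bsub>Mp2\<^esub> (u, 1) \<in> carrier Mp2 - cover_preimage SL2_Zp" by simp
  qed auto
qed

text \<open>The condition persists on the basic open set that freezes the finitely many coordinates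
  it reads.\<close>

lemma open_finite_dependence:
  fixes P :: "('i \<Rightarrow> 'a::discrete_topology) \<Rightarrow> bool"
  assumes F: "finite F" and P: "\<And>s t. (\<And>i. i \<in> F \<Longrightarrow> s i = t i) \<Longrightarrow> P s = P t"
  shows "open {s. P s}"
proof (subst open_subopen, intro ballI)
  fix s assume s: "s \<in> {s. P s}"
  have "open {t. \<forall>i\<in>F. t (id i) \<in> {s i}}"
    by (rule product_topology_basis'[OF F]) (rule open_discrete)
  moreover have "{t. \<forall>i\<in>F. t (id i) \<in> {s i}} \<subseteq> {s. P s}"
  proof
    fix t assume t: "t \<in> {t. \<forall>i\<in>F. t (id i) \<in> {s i}}"
    have "P s = P t" by (rule P) (use t in simp)
    then show "t \<in> {s. P s}" using s by simp
  qed
  ultimately show "\<exists>T. open T \<and> s \<in> T \<and> T \<subseteq> {s. P s}"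
    by (intro exI[of _ "{t. \<forall>i\<in>F. t (id i) \<in> {s i}}"]) auto
qed

lemma closed_finite_dependence:
  fixes P :: "('i \<Rightarrow> 'a::discrete_topology) \<Rightarrow> bool"
  assumes "finite F" "\<And>s t. (\<And>i. i \<in> F \<Longrightarrow> s i = t i) \<Longrightarrow> P s = P t"
  shows "closed {s. P s}"
proof -
  have "open {s. \<not> P s}" using assms by (intro open_finite_dependence[OF assms(1)]) blast
  then show ?thesis by (simp add: closed_def Collect_neg_eq)
qed

text \<open>The group is parametrised by the digits of its four entries together with the sign: the
  coordinate \<open>(i, k)\<close> is the residue mod \<open>p^k\<close> of the \<open>i\<close>-th entry for \<open>i < 4\<close>, and
  \<open>(4, 0)\<close> is the sign. Compactness is then Tychonoff's theorem.\<close>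

lemma compactin_cover_SL2_Zp:
  assumes odd: "odd CARD('p::prime_card)"
  shows "compactin Mp2_topology (cover_preimage SL2_Zp :: 'p mp2 set)"
proof -
  let ?p = "int CARD('p)"
  define B :: "nat \<times> nat \<Rightarrow> int set" where
    "B = (\<lambda>(i, k). if i < 4 then {0..<?p ^ k} else {-1, 1})"
  define coh where "coh i k s \<longleftrightarrow> s (i, Suc k) mod ?p ^ k = s (i, k)"
    for i k :: nat and s :: "nat \<times> nat \<Rightarrow> int"
  define dt where "dt k s \<longleftrightarrow> (s (0, k) * s (3, k) - s (1, k) * s (2, k)) mod ?p ^ k = 1 mod ?p ^ k"
    for k :: nat and s :: "nat \<times> nat \<Rightarrow> int"
  define S where "S = PiE UNIV B \<inter> ((\<Inter>i\<in>{..<4}. \<Inter>k. {s. coh i k s}) \<inter> (\<Inter>k. {s. dt k s}))"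
  have "compact (PiE UNIV B)"
  proof -
    have "finite (B x)" for x by (cases x) (simp add: B_def)
    then have "compactin (product_topology (\<lambda>_. euclidean) UNIV) (PiE UNIV B)"
      unfolding compactin_PiE by (simp add: finite_imp_compact)
    then show ?thesis by (simp add: euclidean_product_topology)
  qed
  moreover have "closed {s. coh i k s}" for i k
    by (rule closed_finite_dependence[of "{(i, k), (i, Suc k)}"]) (auto simp: coh_def)
  moreover have "closed {s. dt k s}" for k
    by (rule closed_finite_dependence[of "{(0, k), (1, k), (2, k), (3, k)}"]) (auto simp: dt_def)
  ultimately have cS: "compact S"
    unfolding S_def by (intro compact_Int_closed closed_Int closed_INT ballI) auto
  define E :: "(nat \<times> nat \<Rightarrow> int) \<Rightarrow> nat \<Rightarrow> 'p padic_int"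
    where "E s i = Abs_padic_int (\<lambda>k. s (i, k))" for s i
  have E: "padic_coord (E s i) k = s (i, k)" if "s \<in> S" "i < 4" for s i k
  proof -
    have "s (i, k) \<in> {0..<?p ^ k}" for k
    proof -
      have "s (i, k) \<in> B (i, k)" using that by (auto simp: S_def PiE_iff)
      then show ?thesis using that by (simp add: B_def)
    qed
    moreover have "s (i, Suc k) mod ?p ^ k = s (i, k)" for k
      using that by (auto simp: S_def coh_def)
    ultimately show ?thesis unfolding E_def by (subst Abs_padic_int_inverse) auto
  qed
  define f where "f s = (zmat (E s 0) (E s 1) (E s 2) (E s 3), s (4, 0))" for s
  have det: "E s 0 * E s 3 - E s 1 * E s 2 = 1" if s: "s \<in> S" for s
  proof (rule padic_eqI)
    fix k
    have "dt k s" using s by (auto simp: S_def)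
    then show "padic_coord (E s 0 * E s 3 - E s 1 * E s 2) k = padic_coord (1 :: 'p padic_int) k"
      using s by (simp add: coord_diff coord_mult coord_1 E dt_def mod_diff_eq)
  qed
  have sgn: "s (4, 0) = -1 \<or> s (4, 0) = 1" if "s \<in> S" for s
  proof -
    have "s (4, 0) \<in> B (4, 0)" using that by (auto simp: S_def PiE_iff)
    then show ?thesis by (simp add: B_def)
  qed
  have img: "f ` S = cover_preimage SL2_Zp"
  proof
    show "f ` S \<subseteq> cover_preimage SL2_Zp"
      using det sgn by (auto simp: f_def cover_preimage_def zmat_in_SL2_Zp)
    show "cover_preimage SL2_Zp \<subseteq> f ` S"
    proof
      fix x :: "'p mp2" assume "x \<in> cover_preimage SL2_Zp"
      then obtain a b c d e where x: "x = (zmat a b c d, e)" "a * d - b * c = 1" "e = 1 \<or> e = -1"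
        by (auto simp: cover_preimage_def elim!: SL2_Zp_cases)
      define y where "y i = [a, b, c, d] ! i" for i
      define s where "s = (\<lambda>(i, k). if i < 4 then padic_coord (y i) k else e)"
      have "s \<in> PiE UNIV B"
        using x(3) coord_range by (auto simp: s_def B_def PiE_iff split: prod.splits)
      moreover have "coh i k s" if "i < 4" for i k
        using that by (simp add: coh_def s_def padic_coord_Suc_mod)
      moreover have "dt k s" for k
        using arg_cong[OF x(2), of "\<lambda>z. padic_coord z k"]
        by (simp add: dt_def s_def y_def coord_diff coord_mult coord_1 mod_diff_eq)
      ultimately have "s \<in> S" by (simp add: S_def)
      moreover have "E s i = y i" if "i < 4" for i
        by (rule padic_eqI) (use that E[OF \<open>s \<in> S\<close>] in \<open>simp add: s_def\<close>)
      then have "f s = x" by (simp add: f_def x y_def s_def)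
      ultimately show "x \<in> f ` S" by blast
    qed
  qed
  have "continuous_map (top_of_set S) Mp2_topology f"
    unfolding continuous_map_def
  proof (intro conjI allI impI)
    show "f \<in> topspace (top_of_set S) \<rightarrow> topspace Mp2_topology"
      using img cover_preimage_subset[OF subset_refl] by (auto simp del: image_subset_iff)
    fix U :: "'p mp2 set" assume U: "openin Mp2_topology U"
    show "openin (top_of_set S) {x \<in> topspace (top_of_set S). f x \<in> U}"
    proof (subst openin_subopen, intro ballI)
      fix s assume "s \<in> {x \<in> topspace (top_of_set S). f x \<in> U}"
      then have s: "s \<in> S" "f s \<in> U" by auto
      then obtain k where k: "\<And>u. u \<in> principal_congruence k \<Longrightarrow> f s \<otimes>\<^bsub>Mp2\<^esub> (u, 1) \<in> U"
        using U unfolding openin_Mp2_topology Mp2_open_def by blast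
      \<comment> \<open>Agreement of the four entries mod p^k and of the sign, which is agreement up
        to right translation by the congruence subgroup of level k.\<close>
      define N where "N = {t. \<forall>x\<in>{(0, k), (1, k), (2, k), (3, k), (4, 0)}. t x = s x}"
      have "open N"
        unfolding N_def by (rule open_finite_dependence[of "{(0, k), (1, k), (2, k), (3, k), (4, 0)}"]) auto
      have "f t \<in> U" if t: "t \<in> S" "t \<in> N" for t
      proof -
        define g where "g = zmat (E s 0) (E s 1) (E s 2) (E s 3)"
        define h where "h = zmat (E t 0) (E t 1) (E t 2) (E t 3)"
        have gK: "g \<in> SL2_Zp" and hK: "h \<in> SL2_Zp"
          using det s t by (auto simp: g_def h_def zmat_in_SL2_Zp)
        have dv: "of_nat CARD('p) ^ k dvd E t i - E s i" if "i < 4" for i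
        proof -
          have "i = 0 \<or> i = 1 \<or> i = 2 \<or> i = 3" using that by auto
          then have "padic_coord (E t i) k = padic_coord (E s i) k"
            using E s(1) t by (auto simp: N_def)
          then show ?thesis by (simp only: coord_eq_iff)
        qed
        have "adj2 g ** h \<in> principal_congruence k"
        proof -
          let ?s = "E s" and ?t = "E t"
          have m: "adj2 g ** h = zmat (?s 3 * ?t 0 + - ?s 1 * ?t 2) (?s 3 * ?t 1 + - ?s 1 * ?t 3)
            (- ?s 2 * ?t 0 + ?s 0 * ?t 2) (- ?s 2 * ?t 1 + ?s 0 * ?t 3)"
            by (simp only: g_def h_def adj2_zmat zmat_mult)
          \<comment> \<open>The determinant of g turns each entry of g^-1 h - 1 into a combination
            of entrywise differences, all divisible by p^k.\<close>
          have e: "?s 3 * ?t 0 + - ?s 1 * ?t 2 - 1 = ?s 3 * (?t 0 - ?s 0) - ?s 1 * (?t 2 - ?s 2)"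
            "?s 3 * ?t 1 + - ?s 1 * ?t 3 = ?s 3 * (?t 1 - ?s 1) - ?s 1 * (?t 3 - ?s 3)"
            "- ?s 2 * ?t 0 + ?s 0 * ?t 2 = - ?s 2 * (?t 0 - ?s 0) + ?s 0 * (?t 2 - ?s 2)"
            "- ?s 2 * ?t 1 + ?s 0 * ?t 3 - 1 = - ?s 2 * (?t 1 - ?s 1) + ?s 0 * (?t 3 - ?s 3)"
            using det[OF s(1)] by (simp_all add: algebra_simps)
          have "adj2 g ** h \<in> SL2_Zp"
            by (intro SL2_Zp_mult adj2_SL2_Zp gK hK)
          moreover have "of_nat CARD('p) ^ k dvd x * (?t i - ?s i)" if "i < 4" for i x
            using dv[OF that] by simp
          note d = dvd_diff[OF this this] dvd_add[OF this this]
          ultimately show ?thesis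
            using d unfolding m zmat_in_SL2_Zp zmat_in_principal_congruence e by simp
        qed
        note k[OF this]
        moreover have "f s = (g, s (4, 0))" by (simp only: f_def g_def)
        then have "f s \<otimes>\<^bsub>Mp2\<^esub> (adj2 g ** h, 1) = (h, s (4, 0))"
          using gK SL2_Zp_mult[OF adj2_SL2_Zp(1)[OF gK] hK] adj2_mult_cancel(2)[OF gK]
          by (simp add: mult_Mp2_SL2_Zp[OF odd])
        moreover have "f t = (h, s (4, 0))" using t by (simp add: f_def h_def N_def)
        ultimately show ?thesis by simp
      qed
      then show "\<exists>T. openin (top_of_set S) T \<and> s \<in> T \<and> T \<subseteq> {x \<in> topspace (top_of_set S). f x \<in> U}"
        using s \<open>open N\<close> by (intro exI[of _ "S \<inter> N"]) (auto simp: N_def)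
    qed
  qed
  moreover have "compactin (top_of_set S) S"
    using cS by (simp add: compactin_subtopology)
  ultimately have "compactin Mp2_topology (f ` S)"
    using image_compactin by blast
  then show ?thesis by (simp only: img)
qed

text \<open>One congruence level serves everywhere: translates of it are open sets on which f is
  constant, f vanishes on the open complement of the integral matrices, and the closure of the
  support sits in a compact set.\<close>

lemma Cc_inftyI:
  fixes f :: "'p::prime_card mp2 \<Rightarrow> complex"
  assumes odd: "odd CARD('p)"
    and supp: "{x. f x \<noteq> 0} \<subseteq> cover_preimage SL2_Zp"
    and inv: "\<And>g e u. g \<in> SL2_Zp \<Longrightarrow> e = 1 \<or> e = -1 \<Longrightarrow> u \<in> principal_congruence k \<Longrightarrow> f (g ** u, e) = f (g, e)"
  shows "f \<in> Cc_infty Mp2_topology"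
  unfolding Cc_infty_def mem_Collect_eq topspace_Mp2
proof (intro conjI allI ballI impI)
  fix x assume "x \<notin> (carrier Mp2 :: 'p mp2 set)"
  then show "f x = 0" using supp cover_preimage_subset[OF subset_refl] by blast
next
  fix x :: "'p mp2" assume x: "x \<in> carrier Mp2"
  show "\<exists>U. openin Mp2_topology U \<and> x \<in> U \<and> (\<forall>y\<in>U. f y = f x)"
  proof (cases "x \<in> cover_preimage SL2_Zp")
    case True
    then obtain g e where ge: "x = (g, e)" "g \<in> SL2_Zp" "e = 1 \<or> e = -1"
      by (auto simp: cover_preimage_def)
    let ?U = "(\<lambda>u. (g ** u, e)) ` principal_congruence k"
    have "openin Mp2_topology ?U"
    proof (rule openin_Mp2_over_SL2_Zp[OF odd])
      show "?U \<subseteq> cover_preimage SL2_Zp"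
        using ge SL2_Zp_mult principal_congruence_subset by (auto simp: cover_preimage_def)
      fix h d and v :: "'p mat2" assume "(h, d) \<in> ?U" "v \<in> principal_congruence k"
      then show "(h ** v, d) \<in> ?U"
        using principal_congruence_mult by (fastforce simp: matrix_mul_assoc[symmetric])
    qed
    moreover have "x \<in> ?U" using mat_1_in_principal_congruence ge by (force intro!: image_eqI[of _ _ "mat 1"])
    moreover have "\<forall>y\<in>?U. f y = f x" using inv ge by auto
    ultimately show ?thesis by blast
  next
    case False
    have "openin Mp2_topology (carrier Mp2 - cover_preimage SL2_Zp :: 'p mp2 set)"
      using closedin_cover_SL2_Zp[where 'p = 'p] by (simp add: closedin_def)
    moreover have "f y = 0" if "y \<notin> cover_preimage SL2_Zp" for y using that supp by blast
    ultimately show ?thesis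
      using False x by (intro exI[of _ "carrier Mp2 - cover_preimage SL2_Zp"]) auto
  qed
next
  have "Mp2_topology closure_of {x. f x \<noteq> 0} \<subseteq> cover_preimage SL2_Zp"
    by (rule closure_of_minimal[OF supp closedin_cover_SL2_Zp])
  then show "compactin Mp2_topology (Mp2_topology closure_of {x. f x \<noteq> 0})"
    using closed_compactin[OF compactin_cover_SL2_Zp[OF odd]] by simp
qed

section \<open>A transversal of the cosets\<close>

definition low :: "int \<Rightarrow> 'p::prime_card mat2" where
  "low s = zmat 1 0 (of_int s) 1"

text \<open>The upper unipotent matrix with corner x, times w(1); thus \<open>upw 0\<close> is
  w(1).\<close>

definition upw :: "int \<Rightarrow> 'p::prime_card mat2" where
  "upw x = zmat (- of_int x) 1 (-1) 0"

definition residues_below :: "'p::prime_card itself \<Rightarrow> nat \<Rightarrow> int set" where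
  "residues_below _ n = {0..<int CARD('p) ^ n}"

definition p_residues_below :: "'p::prime_card itself \<Rightarrow> nat \<Rightarrow> int set" where
  "p_residues_below _ n = {s \<in> {0..<int CARD('p) ^ n}. int CARD('p) dvd s}"

text \<open>A left coset of K_0(p^n) is a point (a : c) of the projective line mod p^n, read off
  from the first column. Either a is a unit and c / a = s, or a / c = x with p dividing x.\<close>

definition transversal :: "nat \<Rightarrow> 'p::prime_card mat2 set" where
  "transversal n = low ` residues_below TYPE('p) n \<union> upw ` p_residues_below TYPE('p) n"

lemma low_in_SL2_Zp: "low s \<in> SL2_Zp"
  by (simp add: low_def zmat_in_SL2_Zp)

lemma upw_in_SL2_Zp: "upw x \<in> SL2_Zp"
  by (simp add: upw_def zmat_in_SL2_Zp)

lemma transversal_subset: "transversal n \<subseteq> SL2_Zp"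
  using low_in_SL2_Zp upw_in_SL2_Zp by (auto simp: transversal_def)

lemma finite_p_residues_below: "finite (p_residues_below TYPE('p::prime_card) n)"
  by (rule finite_subset[of _ "{0..<int CARD('p) ^ n}"]) (auto simp: p_residues_below_def)

lemma finite_transversal: "finite (transversal n)"
  by (simp add: transversal_def finite_p_residues_below residues_below_def)

lemma of_int_eq_residues:
  assumes "(of_int s :: 'p::prime_card padic_int) = of_int t"
    "s \<in> {0..<int CARD('p) ^ n}" "t \<in> {0..<int CARD('p) ^ n}"
  shows "s = t"
proof -
  have "s mod int CARD('p) ^ n = t mod int CARD('p) ^ n"
    using arg_cong[OF assms(1), of "\<lambda>x. padic_coord x n"] by (simp only: coord_of_int)
  then show ?thesis using assms(2,3) by simp
qed

lemma sum_transversal: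
  "(\<Sum>Z\<in>transversal n. \<Phi> (Z :: 'p::prime_card mat2)) =
    (\<Sum>s\<in>{0..<int CARD('p) ^ n}. \<Phi> (low s)) + (\<Sum>x\<in>p_residues_below TYPE('p) n. \<Phi> (upw x))"
proof -
  have "inj_on (low :: int \<Rightarrow> 'p mat2) (residues_below TYPE('p) n)"
    using of_int_eq_residues by (fastforce simp: inj_on_def low_def residues_below_def)
  moreover have "inj_on (upw :: int \<Rightarrow> 'p mat2) (p_residues_below TYPE('p) n)"
    using of_int_eq_residues[where 'p = 'p and n = n] by (auto simp: inj_on_def upw_def p_residues_below_def)
  moreover have "low ` residues_below TYPE('p) n \<inter> upw ` p_residues_below TYPE('p) n = ({} :: 'p mat2 set)"
    by (auto simp: low_def upw_def)
  ultimately show ?thesis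
    unfolding transversal_def
    by (subst sum.union_disjoint)
      (auto simp: sum.reindex finite_p_residues_below residues_below_def)
qed

lemma ex1_residue_quotient:
  fixes a c :: "'p::prime_card padic_int"
  assumes a: "a dvd 1"
  shows "\<exists>!s. s \<in> {0..<int CARD('p) ^ n} \<and> of_nat CARD('p) ^ n dvd c - of_int s * a"
proof -
  obtain b where b: "a * b = 1" using a by (metis dvdE)
  have *: "of_nat CARD('p) ^ n dvd c - of_int s * a \<longleftrightarrow> padic_coord (c * b) n = s mod int CARD('p) ^ n" for s
  proof -
    have "c - of_int s * a = a * (c * b - of_int s)"
      using b by (simp add: algebra_simps)
    moreover have "of_nat CARD('p) ^ n dvd a * x \<longleftrightarrow> of_nat CARD('p) ^ n dvd x" for x
      using a dvd_mult_unit_iff'[of a "of_nat CARD('p) ^ n" x] by simp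
    ultimately show ?thesis by (simp only: coord_eq_iff[symmetric] coord_of_int)
  qed
  show ?thesis
  proof (rule ex1I[of _ "padic_coord (c * b) n"])
    show "padic_coord (c * b) n \<in> {0..<int CARD('p) ^ n}
        \<and> of_nat CARD('p) ^ n dvd c - of_int (padic_coord (c * b) n) * a"
      using coord_range[of "c * b" n] by (simp add: *)
  qed (auto simp: *)
qed

lemma det_1_not_both_dvd:
  fixes a b c d :: "'p::prime_card padic_int"
  assumes "a * d - b * c = 1" "of_nat CARD('p) dvd a"
  shows "\<not> of_nat CARD('p) dvd c"
proof
  assume "of_nat CARD('p) dvd c"
  then have "of_nat CARD('p) dvd a * d - b * c" using assms(2) by simp
  then show False using assms(1) padic_unit_iff[of "of_nat CARD('p) :: 'p padic_int"] by simp
qed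

lemma low_coset_iff:
  fixes a b c d :: "'p::prime_card padic_int"
  assumes "a * d - b * c = 1"
  shows "adj2 (low s) ** zmat a b c d \<in> K0 n \<longleftrightarrow> of_nat CARD('p) ^ n dvd c - of_int s * a"
proof -
  have "adj2 (low s) ** zmat a b c d \<in> SL2_Zp"
    using assms by (intro SL2_Zp_mult adj2_SL2_Zp low_in_SL2_Zp) (simp add: zmat_in_SL2_Zp)
  then show ?thesis
    by (simp add: low_def zmat_mult zmat_in_K0 zmat_in_SL2_Zp)
qed

lemma upw_coset_iff:
  fixes a b c d :: "'p::prime_card padic_int"
  assumes "a * d - b * c = 1"
  shows "adj2 (upw x) ** zmat a b c d \<in> K0 n \<longleftrightarrow> of_nat CARD('p) ^ n dvd a - of_int x * c"
proof -
  have "adj2 (upw x) ** zmat a b c d \<in> SL2_Zp"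
    using assms by (intro SL2_Zp_mult adj2_SL2_Zp upw_in_SL2_Zp) (simp add: zmat_in_SL2_Zp)
  then show ?thesis
    by (simp add: upw_def zmat_mult zmat_in_K0 zmat_in_SL2_Zp)
qed

lemma p_dvd_of_int: "of_nat CARD('p) dvd (of_int m :: 'p::prime_card padic_int) \<longleftrightarrow> int CARD('p) dvd m"
  using p_power_dvd_of_int[where k = 1 and m = m and 'p = 'p] by simp

text \<open>The determinant keeps p from dividing both a and c, so exactly one of the two charts
  applies, and in it the ratio of the first column fixes the representative.\<close>

lemma transversal_ex1:
  fixes A :: "'p::prime_card mat2"
  assumes n: "n > 0" and A: "A \<in> SL2_Zp"
  shows "\<exists>!M. M \<in> transversal n \<and> adj2 M ** A \<in> K0 n"
proof -
  let ?q = "of_nat CARD('p) ^ n :: 'p padic_int"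
  obtain a b c d where e: "A = zmat a b c d" and det: "a * d - b * c = 1"
    using A by (rule SL2_Zp_cases)
  have pq: "of_nat CARD('p) dvd x" if "?q dvd x" for x
    using that n dvd_power dvd_trans by blast
  show ?thesis
  proof (cases "of_nat CARD('p) dvd a")
    case False
    then have "a dvd 1" by (simp add: padic_unit_iff)
    then obtain s where s: "s \<in> {0..<int CARD('p) ^ n}" "?q dvd c - of_int s * a"
      and uniq: "\<And>t. t \<in> {0..<int CARD('p) ^ n} \<Longrightarrow> ?q dvd c - of_int t * a \<Longrightarrow> t = s"
      using ex1_residue_quotient[of a n c] by blast
    have nu: "\<not> ?q dvd a - of_int x * c" if "x \<in> p_residues_below TYPE('p) n" for x
    proof
      assume "?q dvd a - of_int x * c"
      moreover have "of_nat CARD('p) dvd of_int x * c"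
        using that by (simp add: p_residues_below_def p_dvd_of_int)
      ultimately show False using pq False by (metis dvd_diff_right_iff dvd_diff_left_iff)
    qed
    show ?thesis
    proof (rule ex1I[of _ "low s :: 'p mat2"])
      show "(low s :: 'p mat2) \<in> transversal n \<and> adj2 (low s) ** A \<in> K0 n"
        using s low_coset_iff[OF det] by (auto simp: e transversal_def residues_below_def)
      fix M assume "M \<in> transversal n \<and> adj2 M ** A \<in> K0 n"
      then show "M = low s"
        using uniq nu low_coset_iff[OF det] upw_coset_iff[OF det]
        by (auto simp: e transversal_def residues_below_def)
    qed
  next
    case True
    then have nc: "\<not> of_nat CARD('p) dvd c" using det_1_not_both_dvd[OF det] by simp
    then have "c dvd 1" by (simp add: padic_unit_iff)
    then obtain x where x: "x \<in> {0..<int CARD('p) ^ n}" "?q dvd a - of_int x * c"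
      and uniq: "\<And>t. t \<in> {0..<int CARD('p) ^ n} \<Longrightarrow> ?q dvd a - of_int t * c \<Longrightarrow> t = x"
      using ex1_residue_quotient[of c n a] by blast
    have "of_nat CARD('p) dvd of_int x * c" using pq[OF x(2)] True by (metis dvd_diff_right_iff)
    then have px: "int CARD('p) dvd x"
      using nc prime_elem_dvd_mult_iff[OF prime_elem_p] p_dvd_of_int by blast
    have nl: "\<not> ?q dvd c - of_int s * a" for s
    proof
      assume "?q dvd c - of_int s * a"
      then have "of_nat CARD('p) dvd c - of_int s * a" by (rule pq)
      then show False using True nc by (metis dvd_diff_left_iff dvd_mult)
    qed
    show ?thesis
    proof (rule ex1I[of _ "upw x :: 'p mat2"])
      show "(upw x :: 'p mat2) \<in> transversal n \<and> adj2 (upw x) ** A \<in> K0 n"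
        using x px upw_coset_iff[OF det] by (auto simp: e transversal_def p_residues_below_def)
      fix M assume "M \<in> transversal n \<and> adj2 M ** A \<in> K0 n"
      then show "M = upw x"
        using uniq nl low_coset_iff[OF det] upw_coset_iff[OF det]
        by (auto simp: e transversal_def p_residues_below_def)
    qed
  qed
qed

text \<open>Left translation permutes the left cosets, and \<open>\<Phi>\<close> sees only the
  coset; \<open>\<rho>\<close> picks the representative of a coset.\<close>

lemma sum_transversal_left_mult:
  fixes g :: "'p::prime_card mat2" and \<Phi> :: "'p mat2 \<Rightarrow> complex"
  assumes n: "n > 0" and g: "g \<in> SL2_Zp"
    and inv: "\<And>M k. M \<in> SL2_Zp \<Longrightarrow> k \<in> K0 n \<Longrightarrow> \<Phi> (M ** k) = \<Phi> M"
  shows "(\<Sum>Z\<in>transversal n. \<Phi> (g ** Z)) = (\<Sum>Z\<in>transversal n. \<Phi> Z)"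
proof -
  define \<rho> where "\<rho> A = (THE M. M \<in> transversal n \<and> adj2 M ** A \<in> K0 n)" for A :: "'p mat2"
  have \<rho>: "\<rho> A \<in> transversal n" "adj2 (\<rho> A) ** A \<in> K0 n" if "A \<in> SL2_Zp" for A
    using theI'[OF transversal_ex1[OF n that]] by (simp_all add: \<rho>_def)
  have \<Phi>\<rho>: "\<Phi> (\<rho> A) = \<Phi> A" if "A \<in> SL2_Zp" for A
  proof -
    have "\<rho> A \<in> SL2_Zp" using \<rho>(1)[OF that] transversal_subset by blast
    then show ?thesis
      using inv[of "\<rho> A" "adj2 (\<rho> A) ** A"] \<rho>(2)[OF that] adj2_mult_cancel(2)[of "\<rho> A" A] by simp
  qed
  have gX: "g ** M \<in> SL2_Zp" if "M \<in> transversal n" for M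
    using that transversal_subset SL2_Zp_mult g by blast
  have "inj_on (\<lambda>M. \<rho> (g ** M)) (transversal n)"
  proof
    fix M Y assume M: "M \<in> transversal n" and Y: "Y \<in> transversal n" and eq: "\<rho> (g ** M) = \<rho> (g ** Y)"
    have XK: "M \<in> SL2_Zp" and YK: "Y \<in> SL2_Zp" using M Y transversal_subset by auto
    define Z where "Z = \<rho> (g ** M)"
    have ZK: "Z \<in> SL2_Zp" unfolding Z_def using \<rho>(1)[OF gX[OF M]] transversal_subset by blast
    \<comment> \<open>Both factors compare their point with the common representative Z; dividing
      them removes Z and g and leaves M^-1 Y.\<close>
    have "adj2 (adj2 Z ** (g ** M)) ** (adj2 Z ** (g ** Y)) \<in> K0 n"
      using \<rho>(2)[OF gX[OF M]] \<rho>(2)[OF gX[OF Y]] eq by (simp add: Z_def K0_mult adj2_K0)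
    also have "adj2 (adj2 Z ** (g ** M)) ** (adj2 Z ** (g ** Y)) = adj2 M ** Y"
    proof -
      have "adj2 (adj2 Z ** (g ** M)) = adj2 (g ** M) ** adj2 (adj2 Z)"
        by (rule adj2_mult[OF adj2_SL2_Zp(1)[OF ZK] gX[OF M]])
      also have "adj2 (adj2 Z) = Z" using ZK by (auto elim!: SL2_Zp_cases)
      also have "adj2 (g ** M) = adj2 M ** adj2 g" by (rule adj2_mult[OF g XK])
      finally show ?thesis
        by (simp add: matrix_mul_assoc[symmetric] adj2_mult_cancel[OF ZK] adj2_mult_cancel[OF g])
    qed
    finally have "M \<in> transversal n \<and> adj2 M ** Y \<in> K0 n" using M by simp
    moreover have "Y \<in> transversal n \<and> adj2 Y ** Y \<in> K0 n"
      using Y adj2_SL2_Zp(3)[OF YK] mat_1_in_K0 by metis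
    ultimately show "M = Y" using transversal_ex1[OF n YK] by blast
  qed
  moreover have "(\<lambda>M. \<rho> (g ** M)) ` transversal n = transversal n"
    by (rule endo_inj_surj[OF finite_transversal _ calculation]) (use \<rho> gX in auto)
  ultimately have "bij_betw (\<lambda>M. \<rho> (g ** M)) (transversal n) (transversal n)"
    by (simp add: bij_betw_def)
  then have "(\<Sum>Z\<in>transversal n. \<Phi> (\<rho> (g ** Z))) = (\<Sum>Z\<in>transversal n. \<Phi> Z)"
    by (rule sum.reindex_bij_betw)
  then show ?thesis using \<Phi>\<rho> gX by simp
qed

section \<open>Genuine equivariant functions\<close>

definition quadratic_char :: "('p::prime_card padic_int \<Rightarrow> complex) \<Rightarrow> bool" where
  "quadratic_char \<eta> \<longleftrightarrow> \<eta> = (\<lambda>_. 1) \<or> \<eta> = legendre_char"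

definition diag_char :: "('p::prime_card padic_int \<Rightarrow> complex) \<Rightarrow> 'p mat2 \<Rightarrow> complex" where
  "diag_char \<eta> A = \<eta> (inv_into UNIV to_fract (A $ 2 $ 2))"

lemma diag_char_zmat [simp]: "diag_char \<eta> (zmat a b c d) = \<eta> d"
proof -
  have "inj (to_fract :: 'a padic_int \<Rightarrow> _)" by (simp add: inj_on_def)
  then show ?thesis by (simp add: diag_char_def inv_f_f)
qed

lemma genuine_char_diag: "genuine_char \<eta> (A, e) = of_int e * diag_char \<eta> A"
  by (simp add: genuine_char_def diag_char_def)

context
  fixes \<eta> :: "'p::prime_card padic_int \<Rightarrow> complex"
  assumes odd: "odd CARD('p)" and \<eta>: "quadratic_char \<eta>"
begin

lemma quadratic_char_mult: "\<eta> (x * y) = \<eta> x * \<eta> y"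
  using \<eta> by (auto simp: quadratic_char_def legendre_char_leg leg_mult[OF odd])

lemma quadratic_char_1: "\<eta> 1 = 1"
  using \<eta> by (auto simp: quadratic_char_def legendre_char_leg)

lemma quadratic_char_cnj: "cnj (\<eta> x) = \<eta> x"
  using \<eta> by (auto simp: quadratic_char_def legendre_char_leg)

lemma quadratic_char_leg: "leg x = leg y \<Longrightarrow> \<eta> x = \<eta> y"
  using \<eta> by (auto simp: quadratic_char_def legendre_char_leg)

lemma quadratic_char_cong: "of_nat CARD('p) dvd x - y \<Longrightarrow> \<eta> x = \<eta> y"
  by (rule quadratic_char_leg[OF leg_cong])

lemma quadratic_char_sq: "x dvd 1 \<Longrightarrow> \<eta> x * \<eta> x = 1"
  using \<eta> leg_unit[of x] by (auto simp: quadratic_char_def legendre_char_leg)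

lemma diag_char_K0:
  assumes n: "n > 0" and k: "k \<in> K0 n"
  shows "diag_char \<eta> (adj2 k) = diag_char \<eta> k" "diag_char \<eta> k * diag_char \<eta> k = 1"
    "cnj (diag_char \<eta> k) = diag_char \<eta> k"
proof -
  obtain a b c d where e: "k = zmat a b c d" "a * d - b * c = 1" "of_nat CARD('p) ^ n dvd c"
    using k by (rule K0_cases)
  have "of_nat CARD('p) dvd c" using e(3) n dvd_power dvd_trans by blast
  note l = det_1_lower_triangular_mod[OF odd e(2) this]
  show "diag_char \<eta> (adj2 k) = diag_char \<eta> k" using quadratic_char_leg[OF l(3)] by (simp add: e)
  show "diag_char \<eta> k * diag_char \<eta> k = 1" using quadratic_char_sq[OF l(2)] by (simp add: e)
  show "cnj (diag_char \<eta> k) = diag_char \<eta> k" by (simp add: e quadratic_char_cnj)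
qed

lemma diag_char_principal:
  assumes "n > 0" "k \<in> principal_congruence n"
  shows "diag_char \<eta> k = 1"
proof -
  have "k \<in> SL2_Zp" using assms principal_congruence_subset by blast
  then obtain a b c d where e: "k = zmat a b c d" by (rule SL2_Zp_cases)
  then have "of_nat CARD('p) ^ n dvd d - 1" using assms by (simp add: zmat_in_principal_congruence)
  then have "of_nat CARD('p) dvd d - 1" using assms(1) dvd_power dvd_trans by blast
  then show ?thesis using quadratic_char_cong quadratic_char_1 by (simp add: e)
qed

end

definition equivariant ::
  "nat \<Rightarrow> ('p::prime_card padic_int \<Rightarrow> complex) \<Rightarrow> ('p mat2 \<Rightarrow> complex) \<Rightarrow> bool" where
  "equivariant n \<eta> F \<longleftrightarrow> (\<forall>A\<in>SL2_Zp. \<forall>k\<in>K0 n.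
     F (k ** A) = diag_char \<eta> k * F A \<and> F (A ** k) = diag_char \<eta> k * F A)"

text \<open>Inverse to restricting a genuine function to sign 1; the value 0 elsewhere encodes the
  support condition.\<close>

definition genuine_ext :: "('p::prime_card mat2 \<Rightarrow> complex) \<Rightarrow> 'p mp2 \<Rightarrow> complex" where
  "genuine_ext F x = (if x \<in> cover_preimage SL2_Zp then of_int (snd x) * F (fst x) else 0)"

lemma genuine_ext_apply: "A \<in> SL2_Zp \<Longrightarrow> genuine_ext F (A, 1) = F A"
  by (simp add: genuine_ext_def cover_preimage_def)

lemma genuine_ext_cong: "(\<And>A. A \<in> SL2_Zp \<Longrightarrow> F A = G A) \<Longrightarrow> genuine_ext F = genuine_ext G"
  by (auto simp: genuine_ext_def cover_preimage_def fun_eq_iff)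

context
  fixes \<eta> :: "'p::prime_card padic_int \<Rightarrow> complex" and n :: nat
  assumes odd: "odd CARD('p)" and \<eta>: "quadratic_char \<eta>" and n: "n > 0"
begin

lemma genuine_ext_in_hecke_space:
  assumes F: "equivariant n \<eta> F"
  shows "genuine_ext F \<in> hecke_space n \<eta>"
  unfolding hecke_space_def mem_Collect_eq
proof (intro conjI ballI)
  show "genuine_ext F \<in> Cc_infty Mp2_topology"
  proof (rule Cc_inftyI[OF odd])
    show "{x. genuine_ext F x \<noteq> 0} \<subseteq> cover_preimage SL2_Zp"
      by (auto simp: genuine_ext_def split: if_splits)
    fix g u :: "'p mat2" and e
    assume g: "g \<in> SL2_Zp" and e: "e = 1 \<or> e = (-1 :: int)" and u: "u \<in> principal_congruence n"
    have "u \<in> K0 n" "u \<in> SL2_Zp" using u principal_congruence_subset_K0 principal_congruence_subset by auto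
    then show "genuine_ext F (g ** u, e) = genuine_ext F (g, e)"
      using F g e SL2_Zp_mult[OF g, of u] diag_char_principal[OF odd \<eta> n u]
      by (simp add: genuine_ext_def cover_preimage_def equivariant_def)
  qed
  show "{x. genuine_ext F x \<noteq> 0} \<subseteq> cover_preimage SL2_Zp"
    by (auto simp: genuine_ext_def split: if_splits)
  fix k k' g :: "'p mp2"
  assume k: "k \<in> cover_preimage (K0 n)" and k': "k' \<in> cover_preimage (K0 n)" and g: "g \<in> carrier Mp2"
  obtain A e where Ae: "k = (A, e)" "A \<in> K0 n" "e = 1 \<or> e = -1" using k by (auto simp: cover_preimage_def)
  obtain B f where Bf: "k' = (B, f)" "B \<in> K0 n" "f = 1 \<or> f = -1" using k' by (auto simp: cover_preimage_def)
  obtain C h where Ch: "g = (C, h)" "h = 1 \<or> h = -1" using g by (auto simp: carrier_Mp2)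
  have AK: "A \<in> SL2_Zp" and BK: "B \<in> SL2_Zp" using Ae Bf K0_subset by auto
  show "genuine_ext F (k \<otimes>\<^bsub>Mp2\<^esub> g \<otimes>\<^bsub>Mp2\<^esub> k') =
      cnj (genuine_char \<eta> k) * cnj (genuine_char \<eta> k') * genuine_ext F g"
  proof (cases "C \<in> SL2_Zp")
    case True
    have "k \<otimes>\<^bsub>Mp2\<^esub> g \<otimes>\<^bsub>Mp2\<^esub> k' = (A ** C ** B, e * h * f)"
      unfolding Ae Bf Ch using AK BK True by (simp add: mult_Mp2_SL2_Zp[OF odd] SL2_Zp_mult)
    moreover have "F (A ** C ** B) = diag_char \<eta> A * diag_char \<eta> B * F C"
      using F Ae(2) Bf(2) True SL2_Zp_mult[OF AK True] by (simp add: equivariant_def)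
    moreover have "A ** C ** B \<in> SL2_Zp" using AK BK True by (simp add: SL2_Zp_mult)
    moreover have "e * h * f = 1 \<or> e * h * f = -1" using Ae Bf Ch by auto
    ultimately show ?thesis
      using Ae Bf Ch True diag_char_K0(3)[OF odd \<eta> n]
      by (simp add: genuine_ext_def cover_preimage_def genuine_char_diag)
  next
    case False
    have "fst (k \<otimes>\<^bsub>Mp2\<^esub> g) \<notin> SL2_Zp" using mult_Mp2_not_SL2_Zp(1)[of k g] Ae Ch AK False by simp
    then have "fst (k \<otimes>\<^bsub>Mp2\<^esub> g \<otimes>\<^bsub>Mp2\<^esub> k') \<notin> SL2_Zp"
      using mult_Mp2_not_SL2_Zp(2)[of k' "k \<otimes>\<^bsub>Mp2\<^esub> g"] Bf BK by simp
    then have "k \<otimes>\<^bsub>Mp2\<^esub> g \<otimes>\<^bsub>Mp2\<^esub> k' \<notin> cover_preimage SL2_Zp" by (auto simp: cover_preimage_def)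
    moreover have "g \<notin> cover_preimage SL2_Zp" using False Ch by (auto simp: cover_preimage_def)
    ultimately show ?thesis by (simp add: genuine_ext_def)
  qed
qed

text \<open>The central element (1, -1) lies in the preimage of K_0(p^n) and its character value is
  -1, so values at the two signs differ by -1 and restriction to sign 1 loses nothing.\<close>

lemma hecke_space_genuine:
  fixes f :: "'p mp2 \<Rightarrow> complex"
  assumes f: "f \<in> hecke_space n \<eta>"
  shows "equivariant n \<eta> (\<lambda>A. f (A, 1))" and "f = genuine_ext (\<lambda>A. f (A, 1))"
proof -
  have eq: "f (k ** A ** k', e * e') = of_int (e * e') * diag_char \<eta> k * diag_char \<eta> k' * f (A, 1)"
    if A: "A \<in> SL2_Zp" and k: "k \<in> K0 n" and k': "k' \<in> K0 n" and e: "e = 1 \<or> e = -1" "e' = 1 \<or> e' = -1"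
    for A k k' :: "'p mat2" and e e' :: int
  proof -
    have K: "k \<in> SL2_Zp" "k' \<in> SL2_Zp" using k k' K0_subset by auto
    have "(k, e) \<in> cover_preimage (K0 n)" "(k', e') \<in> cover_preimage (K0 n)" "(A, 1) \<in> carrier Mp2"
      using k k' e A SL2_Zp_subset by (auto simp: cover_preimage_def carrier_Mp2)
    then have "f ((k, e) \<otimes>\<^bsub>Mp2\<^esub> (A, 1) \<otimes>\<^bsub>Mp2\<^esub> (k', e'))
        = cnj (genuine_char \<eta> (k, e)) * cnj (genuine_char \<eta> (k', e')) * f (A, 1)"
      using f unfolding hecke_space_def by blast
    moreover have "(k, e) \<otimes>\<^bsub>Mp2\<^esub> (A, 1) \<otimes>\<^bsub>Mp2\<^esub> (k', e') = (k ** A ** k', e * e')"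
      using K A by (simp add: mult_Mp2_SL2_Zp[OF odd] SL2_Zp_mult)
    ultimately show ?thesis
      using diag_char_K0(3)[OF odd \<eta> n] k k' by (simp add: genuine_char_diag)
  qed
  have d1: "diag_char \<eta> (mat 1) = 1" by (simp add: mat_1_zmat quadratic_char_1[OF odd \<eta>])
  show "equivariant n \<eta> (\<lambda>A. f (A, 1))"
    unfolding equivariant_def
  proof (intro ballI conjI)
    fix A k :: "'p mat2" assume Ak: "A \<in> SL2_Zp" "k \<in> K0 n"
    show "f (k ** A, 1) = diag_char \<eta> k * f (A, 1)"
      using eq[OF Ak mat_1_in_K0, of 1 1] d1 by simp
    show "f (A ** k, 1) = diag_char \<eta> k * f (A, 1)"
      using eq[OF Ak(1) mat_1_in_K0 Ak(2), of 1 1] d1 by simp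
  qed
  show "f = genuine_ext (\<lambda>A. f (A, 1))"
  proof
    fix x :: "'p mp2"
    obtain A e where x: "x = (A, e)" by (cases x)
    show "f x = genuine_ext (\<lambda>A. f (A, 1)) x"
    proof (cases "x \<in> cover_preimage SL2_Zp")
      case True
      then have "A \<in> SL2_Zp" "e = 1 \<or> e = -1" by (auto simp: x cover_preimage_def)
      then show ?thesis
        using True eq[OF _ mat_1_in_K0 mat_1_in_K0, of A e 1] d1 by (simp add: x genuine_ext_def)
    next
      case False
      have "{x. f x \<noteq> 0} \<subseteq> cover_preimage SL2_Zp" using f by (simp add: hecke_space_def)
      then show ?thesis using False by (auto simp: genuine_ext_def)
    qed
  qed
qed

lemma hecke_space_eqI:
  assumes "f \<in> hecke_space n \<eta>" "g \<in> hecke_space n \<eta>"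
    and "\<And>A. A \<in> SL2_Zp \<Longrightarrow> f (A, 1) = g (A, 1)"
  shows "f = g"
  using hecke_space_genuine(2)[OF assms(1)] hecke_space_genuine(2)[OF assms(2)]
    genuine_ext_cong[of "\<lambda>A. f (A, 1)" "\<lambda>A. g (A, 1)"] assms(3) by metis

lemma hecke_space_add:
  assumes "f \<in> hecke_space n \<eta>" "g \<in> hecke_space n \<eta>"
  shows "f + g \<in> hecke_space n \<eta>"
proof -
  have "f + g = genuine_ext (\<lambda>A. f (A, 1)) + genuine_ext (\<lambda>A. g (A, 1))"
    using hecke_space_genuine(2)[OF assms(1)] hecke_space_genuine(2)[OF assms(2)] by metis
  also have "\<dots> = genuine_ext (\<lambda>A. f (A, 1) + g (A, 1))"
    by (auto simp: genuine_ext_def fun_eq_iff distrib_left)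
  also have "\<dots> \<in> hecke_space n \<eta>"
    using hecke_space_genuine(1)[OF assms(1)] hecke_space_genuine(1)[OF assms(2)]
    by (intro genuine_ext_in_hecke_space) (simp add: equivariant_def distrib_left)
  finally show ?thesis .
qed

lemma hecke_space_scale:
  assumes "f \<in> hecke_space n \<eta>"
  shows "c *\<^sub>C f \<in> hecke_space n \<eta>"
proof -
  have "c *\<^sub>C f = c *\<^sub>C genuine_ext (\<lambda>A. f (A, 1))"
    using hecke_space_genuine(2)[OF assms] by metis
  also have "\<dots> = genuine_ext (\<lambda>A. c * f (A, 1))"
    by (auto simp: genuine_ext_def fun_eq_iff cscale_def)
  also have "\<dots> \<in> hecke_space n \<eta>"
    using hecke_space_genuine(1)[OF assms]
    by (intro genuine_ext_in_hecke_space) (simp add: equivariant_def)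
  finally show ?thesis .
qed

lemma hecke_space_zero: "0 \<in> hecke_space n \<eta>"
proof -
  have "(0 :: 'p mp2 \<Rightarrow> complex) = genuine_ext (\<lambda>A. 0)" by (auto simp: genuine_ext_def)
  also have "\<dots> \<in> hecke_space n \<eta>"
    by (intro genuine_ext_in_hecke_space) (simp add: equivariant_def)
  finally show ?thesis .
qed

lemma subspace_hecke_space: "cfun.subspace (hecke_space n \<eta>)"
  unfolding cfun.subspace_def using hecke_space_zero hecke_space_add hecke_space_scale by blast

end

section \<open>Convolution as a sum over cosets\<close>

definition coset_conv ::
  "nat \<Rightarrow> ('p::prime_card mat2 \<Rightarrow> complex) \<Rightarrow> ('p mat2 \<Rightarrow> complex) \<Rightarrow> 'p mat2 \<Rightarrow> complex" where
  "coset_conv n F G A = (\<Sum>Z\<in>transversal n. F Z * G (adj2 Z ** A))"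

context
  fixes \<eta> :: "'p::prime_card padic_int \<Rightarrow> complex" and n :: nat
  assumes odd: "odd CARD('p)" and \<eta>: "quadratic_char \<eta>" and n: "n > 0"
begin

lemma equivariant_left: "equivariant n \<eta> F \<Longrightarrow> A \<in> SL2_Zp \<Longrightarrow> k \<in> K0 n \<Longrightarrow> F (k ** A) = diag_char \<eta> k * F A"
  by (simp add: equivariant_def)

lemma equivariant_right: "equivariant n \<eta> F \<Longrightarrow> A \<in> SL2_Zp \<Longrightarrow> k \<in> K0 n \<Longrightarrow> F (A ** k) = diag_char \<eta> k * F A"
  by (simp add: equivariant_def)

text \<open>The character values coming out of F and G multiply to \<eta>(d)^2 = 1, since k and its
  inverse have the same character value.\<close>

lemma conv_integrand_invariant:
  assumes F: "equivariant n \<eta> F" and G: "equivariant n \<eta> G"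
    and A: "A \<in> SL2_Zp" and Z: "Z \<in> SL2_Zp" and k: "k \<in> K0 n"
  shows "F (Z ** k) * G (adj2 (Z ** k) ** A) = F Z * G (adj2 Z ** A)"
proof -
  have kK: "k \<in> SL2_Zp" using k K0_subset by blast
  have "adj2 (Z ** k) ** A = adj2 k ** (adj2 Z ** A)"
    using adj2_mult[OF Z kK] by (simp add: matrix_mul_assoc)
  moreover have "adj2 Z ** A \<in> SL2_Zp" using SL2_Zp_mult adj2_SL2_Zp(1)[OF Z] A by blast
  ultimately have "G (adj2 (Z ** k) ** A) = diag_char \<eta> k * G (adj2 Z ** A)"
    using equivariant_left[OF G _ adj2_K0[OF k]] diag_char_K0(1)[OF odd \<eta> n k] by simp
  then have "F (Z ** k) * G (adj2 (Z ** k) ** A)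
      = (diag_char \<eta> k * diag_char \<eta> k) * (F Z * G (adj2 Z ** A))"
    using equivariant_right[OF F Z k] by simp
  then show ?thesis by (simp only: diag_char_K0(2)[OF odd \<eta> n k] mult_1)
qed

text \<open>On the left, summing over k Z in place of Z lets k cancel inside G, so the character
  comes out of F; on the right it comes out of G.\<close>

lemma equivariant_coset_conv:
  assumes F: "equivariant n \<eta> F" and G: "equivariant n \<eta> G"
  shows "equivariant n \<eta> (coset_conv n F G)"
  unfolding equivariant_def
proof (intro ballI conjI)
  fix A k :: "'p mat2" assume A: "A \<in> SL2_Zp" and k: "k \<in> K0 n"
  have kK: "k \<in> SL2_Zp" using k K0_subset by blast
  have ZA: "adj2 Z ** A \<in> SL2_Zp" if "Z \<in> transversal n" for Z
    using that transversal_subset SL2_Zp_mult adj2_SL2_Zp(1) A by blast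
  have "coset_conv n F G (A ** k) = (\<Sum>Z\<in>transversal n. diag_char \<eta> k * (F Z * G (adj2 Z ** A)))"
    unfolding coset_conv_def
  proof (rule sum.cong[OF refl])
    fix Z :: "'p mat2" assume "Z \<in> transversal n"
    then show "F Z * G (adj2 Z ** (A ** k)) = diag_char \<eta> k * (F Z * G (adj2 Z ** A))"
      using equivariant_right[OF G ZA k] by (simp add: matrix_mul_assoc)
  qed
  then show "coset_conv n F G (A ** k) = diag_char \<eta> k * coset_conv n F G A"
    by (simp add: coset_conv_def sum_distrib_left)
  have "coset_conv n F G (k ** A) = (\<Sum>Z\<in>transversal n. F (k ** Z) * G (adj2 (k ** Z) ** (k ** A)))"
    unfolding coset_conv_def
    by (rule sum_transversal_left_mult[OF n kK, symmetric])
      (rule conv_integrand_invariant[OF F G SL2_Zp_mult[OF kK A]])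
  also have "\<dots> = (\<Sum>Z\<in>transversal n. diag_char \<eta> k * (F Z * G (adj2 Z ** A)))"
  proof (rule sum.cong[OF refl])
    fix Z :: "'p mat2" assume "Z \<in> transversal n"
    then have Z: "Z \<in> SL2_Zp" using transversal_subset by blast
    have "adj2 (k ** Z) ** (k ** A) = adj2 Z ** (adj2 k ** (k ** A))"
      using adj2_mult[OF kK Z] by (simp add: matrix_mul_assoc)
    then have "adj2 (k ** Z) ** (k ** A) = adj2 Z ** A" by (simp only: adj2_mult_cancel(1)[OF kK])
    then show "F (k ** Z) * G (adj2 (k ** Z) ** (k ** A)) = diag_char \<eta> k * (F Z * G (adj2 Z ** A))"
      using equivariant_left[OF F Z k] by simp
  qed
  finally show "coset_conv n F G (k ** A) = diag_char \<eta> k * coset_conv n F G A"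
    by (simp add: coset_conv_def sum_distrib_left)
qed

text \<open>After exchanging the sums, the inner variable Y is translated by Z; this is legitimate
  because the inner summand depends only on the coset of Y.\<close>

lemma coset_conv_assoc:
  assumes F: "equivariant n \<eta> F" and G: "equivariant n \<eta> G" and H: "equivariant n \<eta> H"
    and A: "A \<in> SL2_Zp"
  shows "coset_conv n (coset_conv n F G) H A = coset_conv n F (coset_conv n G H) A"
proof -
  have "coset_conv n (coset_conv n F G) H A
      = (\<Sum>Y\<in>transversal n. \<Sum>Z\<in>transversal n. F Z * G (adj2 Z ** Y) * H (adj2 Y ** A))"
    by (simp add: coset_conv_def sum_distrib_right)
  also have "\<dots> = (\<Sum>Z\<in>transversal n. \<Sum>Y\<in>transversal n. F Z * G (adj2 Z ** Y) * H (adj2 Y ** A))"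
    by (rule sum.swap)
  also have "\<dots> = (\<Sum>Z\<in>transversal n. F Z * coset_conv n G H (adj2 Z ** A))"
  proof (rule sum.cong[OF refl])
    fix Z :: "'p mat2" assume "Z \<in> transversal n"
    then have Z: "Z \<in> SL2_Zp" using transversal_subset by blast
    have "(\<Sum>Y\<in>transversal n. G (adj2 Z ** Y) * H (adj2 Y ** A))
        = (\<Sum>Y\<in>transversal n. G (adj2 Z ** (Z ** Y)) * H (adj2 (Z ** Y) ** A))"
    proof (rule sum_transversal_left_mult[OF n Z, symmetric])
      fix Y k :: "'p mat2" assume Y: "Y \<in> SL2_Zp" and k: "k \<in> K0 n"
      have kK: "k \<in> SL2_Zp" using k K0_subset by blast
      have ZY: "adj2 Z ** Y \<in> SL2_Zp" using SL2_Zp_mult adj2_SL2_Zp(1)[OF Z] Y by blast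
      have YA: "adj2 Y ** A \<in> SL2_Zp" using SL2_Zp_mult adj2_SL2_Zp(1)[OF Y] A by blast
      have 1: "G (adj2 Z ** (Y ** k)) = diag_char \<eta> k * G (adj2 Z ** Y)"
        using equivariant_right[OF G ZY k] by (simp add: matrix_mul_assoc)
      have "adj2 (Y ** k) ** A = adj2 k ** (adj2 Y ** A)"
        using adj2_mult[OF Y kK] by (simp add: matrix_mul_assoc)
      then have 2: "H (adj2 (Y ** k) ** A) = diag_char \<eta> k * H (adj2 Y ** A)"
        using equivariant_left[OF H YA adj2_K0[OF k]] diag_char_K0(1)[OF odd \<eta> n k] by simp
      have "G (adj2 Z ** (Y ** k)) * H (adj2 (Y ** k) ** A)
          = (diag_char \<eta> k * diag_char \<eta> k) * (G (adj2 Z ** Y) * H (adj2 Y ** A))"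
        by (simp add: 1 2)
      then show "G (adj2 Z ** (Y ** k)) * H (adj2 (Y ** k) ** A) = G (adj2 Z ** Y) * H (adj2 Y ** A)"
        by (simp only: diag_char_K0(2)[OF odd \<eta> n k] mult_1)
    qed
    also have "\<dots> = coset_conv n G H (adj2 Z ** A)"
      unfolding coset_conv_def
    proof (rule sum.cong[OF refl])
      fix Y :: "'p mat2" assume "Y \<in> transversal n"
      then have Y: "Y \<in> SL2_Zp" using transversal_subset by blast
      have "adj2 (Z ** Y) ** A = adj2 Y ** (adj2 Z ** A)"
        using adj2_mult[OF Z Y] by (simp add: matrix_mul_assoc)
      then show "G (adj2 Z ** (Z ** Y)) * H (adj2 (Z ** Y) ** A) = G Y * H (adj2 Y ** (adj2 Z ** A))"
        by (simp only: adj2_mult_cancel(1)[OF Z])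
    qed
    finally show "(\<Sum>Y\<in>transversal n. F Z * G (adj2 Z ** Y) * H (adj2 Y ** A))
        = F Z * coset_conv n G H (adj2 Z ** A)"
      by (simp add: mult.assoc flip: sum_distrib_left)
  qed
  finally show ?thesis by (simp add: coset_conv_def)
qed

text \<open>The integrand vanishes off the integral matrices and is constant on each full coset over
  Z K_0(p^n), which has volume 1 by left invariance. It is thus a finite combination of indicators.
  At a non-integral argument one of the two factors is always 0.\<close>

lemma hecke_conv_eq:
  fixes f g :: "'p mp2 \<Rightarrow> complex" and \<mu> :: "'p mp2 measure"
  assumes \<mu>: "left_haar_measure Mp2 Mp2_topology \<mu>" "emeasure \<mu> (cover_preimage (K0 n)) = 1"
    and f: "f \<in> hecke_space n \<eta>" and g: "g \<in> hecke_space n \<eta>"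
  shows "hecke_conv \<mu> f g = genuine_ext (coset_conv n (\<lambda>A. f (A, 1)) (\<lambda>A. g (A, 1)))"
proof
  fix x :: "'p mp2"
  define F where "F A = f (A, 1)" for A
  define G where "G A = g (A, 1)" for A
  note eF = hecke_space_genuine[OF odd \<eta> n f, folded F_def]
  note eG = hecke_space_genuine[OF odd \<eta> n g, folded G_def]
  have space: "space \<mu> = carrier Mp2" and sets: "sets \<mu> = sigma_sets (carrier Mp2) {U. openin Mp2_topology U}"
    and inv: "\<And>y S. y \<in> carrier Mp2 \<Longrightarrow> S \<in> sets \<mu> \<Longrightarrow> emeasure \<mu> ((\<lambda>z. y \<otimes>\<^bsub>Mp2\<^esub> z) ` S) = emeasure \<mu> S"
    using \<mu>(1) by (auto simp: left_haar_measure_def)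
  obtain A e where x: "x = (A, e)" by (cases x)
  show "hecke_conv \<mu> f g x = genuine_ext (coset_conv n F G) x"
  proof (cases "x \<in> carrier Mp2")
    case False
    then have "x \<notin> cover_preimage SL2_Zp" using cover_preimage_subset[OF subset_refl] by blast
    then show ?thesis using False by (simp add: hecke_conv_def genuine_ext_def)
  next
    case xc: True
    have outside: "f y = 0" if "y \<notin> cover_preimage SL2_Zp" for y
      using that by (subst eF(2)) (simp add: genuine_ext_def)
    show ?thesis
    proof (cases "A \<in> SL2_Zp")
      case False
      have "f y * g (inv\<^bsub>Mp2\<^esub> y \<otimes>\<^bsub>Mp2\<^esub> x) = 0" for y
      proof (cases "y \<in> cover_preimage SL2_Zp")
        case True
        then obtain B b where y: "y = (B, b)" "B \<in> SL2_Zp" "b = 1 \<or> b = -1" by (auto simp: cover_preimage_def)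
        then have "inv\<^bsub>Mp2\<^esub> y = (adj2 B, b)" using inv_Mp2_SL2_Zp[OF odd] by blast
        then have "fst (inv\<^bsub>Mp2\<^esub> y \<otimes>\<^bsub>Mp2\<^esub> x) \<notin> SL2_Zp"
          using mult_Mp2_not_SL2_Zp(1)[of "inv\<^bsub>Mp2\<^esub> y" x] adj2_SL2_Zp(1)[OF y(2)] False x by simp
        then have "inv\<^bsub>Mp2\<^esub> y \<otimes>\<^bsub>Mp2\<^esub> x \<notin> cover_preimage SL2_Zp" by (auto simp: cover_preimage_def)
        then have "g (inv\<^bsub>Mp2\<^esub> y \<otimes>\<^bsub>Mp2\<^esub> x) = 0" by (subst eG(2)) (simp add: genuine_ext_def)
        then show ?thesis by simp
      qed (simp add: outside)
      then have "hecke_conv \<mu> f g x = (LINT y|\<mu>. 0)" using xc by (simp only: hecke_conv_def if_True)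
      then have "hecke_conv \<mu> f g x = 0" by simp
      moreover have "x \<notin> cover_preimage SL2_Zp" using False by (auto simp: x cover_preimage_def)
      ultimately show ?thesis by (simp add: genuine_ext_def)
    next
      case A: True
      have e: "e = 1 \<or> e = -1" using xc by (auto simp: x carrier_Mp2)
      define C where "C Z = cover_preimage ((\<lambda>k. Z ** k) ` K0 n)" for Z :: "'p mat2"
      have C_iff: "(B, b) \<in> C Z \<longleftrightarrow> adj2 Z ** B \<in> K0 n" if "Z \<in> SL2_Zp" "b = 1 \<or> b = -1" for Z B b
        using that adj2_mult_cancel(1,2)[OF that(1)]
        by (auto simp: C_def cover_preimage_def intro!: image_eqI[of _ _ "adj2 Z ** B"])
      have C_meas: "C Z \<in> sets \<mu>" if Z: "Z \<in> SL2_Zp" for Z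
      proof -
        have "openin Mp2_topology (C Z)"
        proof (rule openin_Mp2_over_SL2_Zp[OF odd])
          show "C Z \<subseteq> cover_preimage SL2_Zp"
            using Z SL2_Zp_mult K0_subset by (auto simp: C_def cover_preimage_def)
          fix h u :: "'p mat2" and b assume h: "(h, b) \<in> C Z" and "u \<in> principal_congruence n"
          then have "u \<in> K0 n" using principal_congruence_subset_K0 by blast
          moreover obtain k where "h = Z ** k" "k \<in> K0 n" "b = 1 \<or> b = -1"
            using h by (auto simp: C_def cover_preimage_def)
          ultimately show "(h ** u, b) \<in> C Z"
            using K0_mult by (auto simp: C_def cover_preimage_def matrix_mul_assoc[symmetric])
        qed
        then show ?thesis unfolding sets by (intro sigma_sets.Basic) simp
      qed
      have C_1: "C (mat 1) = cover_preimage (K0 n)" by (simp add: C_def)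
      have C_vol: "emeasure \<mu> (C Z) = 1" if Z: "Z \<in> SL2_Zp" for Z
      proof -
        have "(\<lambda>z. (Z, 1) \<otimes>\<^bsub>Mp2\<^esub> z) ` cover_preimage (K0 n) = C Z"
        proof -
          have "(Z, 1) \<otimes>\<^bsub>Mp2\<^esub> z = (Z ** fst z, snd z)" if "z \<in> cover_preimage (K0 n)" for z
            using that K0_subset mult_Mp2_SL2_Zp[OF odd Z, of "fst z" 1 "snd z"]
            by (cases z) (auto simp: cover_preimage_def)
          then have "(\<lambda>z. (Z, 1) \<otimes>\<^bsub>Mp2\<^esub> z) ` cover_preimage (K0 n)
              = (\<lambda>z. (Z ** fst z, snd z)) ` cover_preimage (K0 n)" by (rule image_cong[OF refl])
          also have "\<dots> = C Z" by (auto simp: C_def cover_preimage_def image_iff)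
          finally show ?thesis .
        qed
        moreover have "(Z, 1) \<in> carrier Mp2" using Z SL2_Zp_subset by (auto simp: carrier_Mp2)
        ultimately show ?thesis
          using inv[of "(Z, 1)" "cover_preimage (K0 n)"] C_meas[OF mat_1_in_SL2_Zp] \<mu>(2) C_1 by simp
      qed
      define t where "t Z = of_int e * (F Z * G (adj2 Z ** A))" for Z
      have pointwise: "f y * g (inv\<^bsub>Mp2\<^esub> y \<otimes>\<^bsub>Mp2\<^esub> x) = (\<Sum>Z\<in>transversal n. indicator (C Z) y *\<^sub>R t Z)"
        if ysp: "y \<in> space \<mu>" for y
      proof -
        obtain B b where y: "y = (B, b)" "b = 1 \<or> b = -1" using ysp by (cases y) (auto simp: space carrier_Mp2)
        show ?thesis
        proof (cases "B \<in> SL2_Zp")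
          case False
          have "B \<notin> (\<lambda>k. Z ** k) ` K0 n" if "Z \<in> transversal n" for Z
            using False that transversal_subset SL2_Zp_mult K0_subset by blast
          then have "(\<Sum>Z\<in>transversal n. indicator (C Z) y *\<^sub>R t Z) = 0"
            by (intro sum.neutral) (auto simp: y C_def cover_preimage_def)
          moreover have "f y = 0" by (rule outside) (use False in \<open>simp add: y cover_preimage_def\<close>)
          ultimately show ?thesis by simp
        next
          case B: True
          obtain Y where Y: "Y \<in> transversal n" "adj2 Y ** B \<in> K0 n"
            and uniq: "\<And>Z. Z \<in> transversal n \<Longrightarrow> adj2 Z ** B \<in> K0 n \<Longrightarrow> Z = Y"
            using transversal_ex1[OF n B] by blast
          have YK: "Y \<in> SL2_Zp" using Y transversal_subset by blast
          have "(\<Sum>Z\<in>transversal n. indicator (C Z) y *\<^sub>R t Z) = (\<Sum>Z\<in>transversal n. if Z = Y then t Z else 0)"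
          proof (rule sum.cong[OF refl])
            fix Z :: "'p mat2" assume Z: "Z \<in> transversal n"
            then have "y \<in> C Z \<longleftrightarrow> Z = Y"
              using C_iff[of Z b B] transversal_subset uniq[OF Z] Y(2) y by blast
            then show "indicator (C Z) y *\<^sub>R t Z = (if Z = Y then t Z else 0)" by (cases "Z = Y") simp_all
          qed
          also have "\<dots> = t Y" using Y by (simp add: finite_transversal)
          finally have rhs: "(\<Sum>Z\<in>transversal n. indicator (C Z) y *\<^sub>R t Z) = t Y" .
          have fy: "f y = of_int b * F B"
            using B y by (subst eF(2)) (auto simp: genuine_ext_def cover_preimage_def)
          have BA: "adj2 B ** A \<in> SL2_Zp" using SL2_Zp_mult adj2_SL2_Zp(1)[OF B] A by blast
          have "inv\<^bsub>Mp2\<^esub> y \<otimes>\<^bsub>Mp2\<^esub> x = (adj2 B ** A, b * e)"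
            using inv_Mp2_SL2_Zp[OF odd B y(2)] mult_Mp2_SL2_Zp[OF odd adj2_SL2_Zp(1)[OF B] A]
            by (simp add: y x)
          then have gy: "g (inv\<^bsub>Mp2\<^esub> y \<otimes>\<^bsub>Mp2\<^esub> x) = of_int (b * e) * G (adj2 B ** A)"
            using BA y e by (subst eG(2)) (auto simp: genuine_ext_def cover_preimage_def)
          have "Y ** (adj2 Y ** B) = B" by (rule adj2_mult_cancel(2)[OF YK])
          then have "F B * G (adj2 B ** A) = F Y * G (adj2 Y ** A)"
            using conv_integrand_invariant[OF eF(1) eG(1) A YK Y(2)] by simp
          \<comment> \<open>The sign b of the integration variable enters both factors and cancels;
            only the sign of x remains.\<close>
          then have "f y * g (inv\<^bsub>Mp2\<^esub> y \<otimes>\<^bsub>Mp2\<^esub> x) = t Y"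
            using y(2) unfolding fy gy t_def by auto
          then show ?thesis by (simp only: rhs)
        qed
      qed
      have int: "has_bochner_integral \<mu> (\<lambda>y. \<Sum>Z\<in>transversal n. indicator (C Z) y *\<^sub>R t Z)
          (\<Sum>Z\<in>transversal n. measure \<mu> (C Z) *\<^sub>R t Z)"
      proof (intro has_bochner_integral_sum has_bochner_integral_indicator)
        fix Z :: "'p mat2" assume "Z \<in> transversal n"
        then have Z: "Z \<in> SL2_Zp" using transversal_subset by blast
        show "C Z \<in> sets \<mu>" "emeasure \<mu> (C Z) < \<infinity>" using C_meas[OF Z] C_vol[OF Z] by auto
      qed
      have vol: "(\<Sum>Z\<in>transversal n. measure \<mu> (C Z) *\<^sub>R t Z) = (\<Sum>Z\<in>transversal n. t Z)"
      proof (rule sum.cong[OF refl])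
        fix Z :: "'p mat2" assume "Z \<in> transversal n"
        then have "emeasure \<mu> (C Z) = 1" using C_vol transversal_subset by blast
        then show "measure \<mu> (C Z) *\<^sub>R t Z = t Z" by (simp add: measure_def)
      qed
      have "(LINT y|\<mu>. (\<Sum>Z\<in>transversal n. indicator (C Z) y *\<^sub>R t Z)) = (\<Sum>Z\<in>transversal n. t Z)"
        using has_bochner_integral_integral_eq[OF int] by (simp only: vol)
      moreover have "hecke_conv \<mu> f g x = (LINT y|\<mu>. (\<Sum>Z\<in>transversal n. indicator (C Z) y *\<^sub>R t Z))"
        using xc pointwise by (simp add: hecke_conv_def cong: Bochner_Integration.integral_cong)
      ultimately show ?thesis
        using A e by (simp add: x genuine_ext_def cover_preimage_def t_def coset_conv_def sum_distrib_left)
    qed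
  qed
qed

end

section \<open>Double cosets\<close>

text \<open>Bruhat decomposition with the unit c as pivot. The left factor has lower right entry -c,
  the source of the value \<eta>(-c) on this cell.\<close>

lemma zmat_big_cell:
  fixes a b c d :: "'p::prime_card padic_int"
  assumes det: "a * d - b * c = 1" and c: "\<not> of_nat CARD('p) dvd c"
  obtains x y z where "zmat x y 0 (- c) \<in> K0 n" "zmat 1 z 0 1 \<in> K0 n"
    "zmat a b c d = zmat x y 0 (- c) ** upw 0 ** zmat 1 z 0 1"
proof -
  obtain ci where ci: "c * ci = 1" using c padic_unit_iff by (metis dvdE)
  define \<beta> where "\<beta> = d * ci"
  have cb: "c * \<beta> = d" using ci by (simp add: \<beta>_def algebra_simps)
  have "(b - a * \<beta>) * (- c) = a * (c * \<beta>) - b * c" by (simp add: algebra_simps)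
  then have "zmat (b - a * \<beta>) (- a) 0 (- c) \<in> K0 n" using det unfolding zmat_in_K0 cb by simp
  moreover have "zmat 1 \<beta> 0 1 \<in> K0 n" by (simp add: zmat_in_K0)
  moreover have "zmat a b c d = zmat (b - a * \<beta>) (- a) 0 (- c) ** upw 0 ** zmat 1 \<beta> 0 1"
    using cb by (simp add: upw_def zmat_mult algebra_simps)
  ultimately show ?thesis using that by blast
qed

text \<open>The matrix is equivalent to y(c / d), and diagonal matrices change this parameter by
  squares of units. As c / d and c d differ by the square d^2, only the order and the square class
  of v count, and \<open>leg\<close> detects the latter.\<close>

lemma zmat_small_cell:
  fixes a b c d \<delta> :: "'p::prime_card padic_int"
  assumes odd: "odd CARD('p)" and det: "a * d - b * c = 1" and pc: "of_nat CARD('p) dvd c"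
    and c: "c * d = of_nat CARD('p) ^ r * v" and v: "leg v = leg \<delta>" and \<delta>: "\<delta> dvd 1"
  obtains k k' where "k \<in> K0 n" "k' \<in> K0 n"
    "zmat a b c d = k ** zmat 1 0 (\<delta> * of_nat CARD('p) ^ r) 1 ** k'"
proof -
  let ?p = "of_nat CARD('p) :: 'p padic_int"
  have d: "d dvd 1" by (rule det_1_lower_triangular_mod(2)[OF odd det pc])
  then obtain di where di: "d * di = 1" by (metis dvdE)
  obtain ei where ei: "\<delta> * ei = 1" using \<delta> by (metis dvdE)
  have "leg (v * \<delta>) = 1" using leg_unit[OF \<delta>] v by (auto simp: leg_mult[OF odd])
  moreover have "leg ((di * ei)\<^sup>2) = 1" "leg (\<delta>\<^sup>2) = 1" "leg (ei\<^sup>2) = 1" "leg (di\<^sup>2) = 1"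
    using di ei by (auto intro!: leg_sq[OF odd] simp: dvd_def) (metis mult.commute mult.left_commute mult_1)+
  ultimately have "leg (v * \<delta> * (ei\<^sup>2 * di\<^sup>2)) = 1" by (simp only: leg_mult[OF odd])
  \<comment> \<open>Here \<alpha>^2 = v / (\<delta> d^2), the ratio of c / d to \<delta>
    p^r.\<close>
  then obtain \<alpha> where \<alpha>: "v * \<delta> * (ei\<^sup>2 * di\<^sup>2) = \<alpha>\<^sup>2" "\<alpha> dvd 1" using padic_sqrt[OF odd] by metis
  then obtain \<beta> where \<beta>: "\<alpha> * \<beta> = 1" by (metis dvdE)
  define s where "s = \<delta> * ?p ^ r"
  have csd: "c = s * d * \<alpha>\<^sup>2"
  proof -
    have "s * d * \<alpha>\<^sup>2 = (?p ^ r * v) * (\<delta> * ei)\<^sup>2 * (d * di) * di"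
      unfolding \<alpha>(1)[symmetric] s_def by (simp add: power2_eq_square ac_simps)
    also have "\<dots> = c * (d * di)" unfolding c[symmetric] by (simp only: di ei) (simp add: di mult.assoc)
    finally show ?thesis using di by simp
  qed
  \<comment> \<open>The given matrix times the inverse of \<open>k'\<close> times y(-s); its lower
    left corner vanishes by \<open>csd\<close>.\<close>
  define k where "k = zmat (a * \<beta> - s * b * \<alpha>) (b * \<alpha>) 0 (d * \<alpha>)"
  define k' where "k' = zmat \<alpha> 0 0 \<beta>"
  have "(a * \<beta> - s * b * \<alpha>) * (d * \<alpha>) = a * d * (\<alpha> * \<beta>) - b * (s * d * \<alpha>\<^sup>2)"
    by (simp add: algebra_simps power2_eq_square)
  then have "k \<in> K0 n" using det \<beta> by (simp add: k_def zmat_in_K0 csd[symmetric])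
  moreover have "k' \<in> K0 n" using \<beta> by (simp add: k'_def zmat_in_K0)
  moreover have "zmat a b c d = k ** zmat 1 0 s 1 ** k'"
  proof -
    have "(a * \<beta> - s * b * \<alpha> + b * \<alpha> * s) * \<alpha> = a * (\<alpha> * \<beta>)" "b * \<alpha> * \<beta> = b * (\<alpha> * \<beta>)"
      "d * \<alpha> * s * \<alpha> = s * d * \<alpha>\<^sup>2" "d * \<alpha> * \<beta> = d * (\<alpha> * \<beta>)"
      by (simp_all add: algebra_simps power2_eq_square)
    then show ?thesis by (simp add: k_def k'_def zmat_mult \<beta> csd[symmetric])
  qed
  ultimately show ?thesis using that unfolding s_def by blast
qed

lemma low_0: "low 0 = mat 1"
  by (simp add: low_def mat_1_zmat)

lemma low_mult: "low s ** low t = low (s + t)"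
  by (simp add: low_def zmat_mult)

lemma adj2_low: "adj2 (low s) = low (- s)"
  by (simp add: low_def)

lemma low_in_K0: "(low s :: 'p::prime_card mat2) \<in> K0 n \<longleftrightarrow> int CARD('p) ^ n dvd s"
  by (simp add: low_def zmat_in_K0 p_power_dvd_of_int)

lemma double_cosetI:
  assumes odd: "odd CARD('p::prime_card)" and k: "k \<in> K0 n" "k' \<in> K0 n" and Z: "(Z :: 'p mat2) \<in> SL2_Zp"
    and e: "e = 1 \<or> e = -1"
  shows "(k ** Z ** k', e) \<in> double_coset n (Z, 1)"
proof -
  have "k \<in> SL2_Zp" "k' \<in> SL2_Zp" using k K0_subset by auto
  then have "(k ** Z ** k', e) = (k, e) \<otimes>\<^bsub>Mp2\<^esub> (Z, 1) \<otimes>\<^bsub>Mp2\<^esub> (k', 1)"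
    using Z by (simp add: mult_Mp2_SL2_Zp[OF odd] SL2_Zp_mult)
  moreover have "(k, e) \<in> cover_preimage (K0 n)" "(k', 1) \<in> cover_preimage (K0 n)"
    using k e by (auto simp: cover_preimage_def)
  ultimately show ?thesis unfolding double_coset_def by blast
qed

section \<open>Equivariant functions in coordinates\<close>

context
  fixes \<eta> :: "'p::prime_card padic_int \<Rightarrow> complex" and n :: nat
  assumes odd: "odd CARD('p)" and \<eta>: "quadratic_char \<eta>" and n: "n > 0"
begin

lemma equivariant_big_cell:
  assumes F: "equivariant n \<eta> F" and det: "a * d - b * c = 1" and c: "\<not> of_nat CARD('p) dvd c"
  shows "F (zmat a b c d) = \<eta> (- c) * F (upw 0)"
proof -
  obtain x y z where k: "zmat x y 0 (- c) \<in> K0 n" "zmat 1 z 0 1 \<in> K0 n"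
    and e: "zmat a b c d = zmat x y 0 (- c) ** upw 0 ** zmat 1 z 0 1"
    using zmat_big_cell[OF det c] by metis
  have "zmat x y 0 (- c) \<in> SL2_Zp" using k(1) K0_subset by blast
  then have "F (zmat x y 0 (- c) ** upw 0 ** zmat 1 z 0 1) = \<eta> 1 * (\<eta> (- c) * F (upw 0))"
    using equivariant_right[OF odd \<eta> n F SL2_Zp_mult[OF _ upw_in_SL2_Zp] k(2)]
      equivariant_left[OF odd \<eta> n F upw_in_SL2_Zp k(1)] by simp
  then show ?thesis using e quadratic_char_1[OF odd \<eta>] by simp
qed

lemma equivariant_low_cong:
  assumes F: "equivariant n \<eta> F" and st: "[s = t] (mod int CARD('p) ^ n)"
  shows "F (low s) = F (low t)"
proof -
  have "(low (s - t) :: 'p mat2) \<in> K0 n" using st by (simp add: low_in_K0 cong_iff_dvd_diff)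
  then have "F (low t ** low (s - t)) = diag_char \<eta> (low (s - t)) * F (low t)"
    by (rule equivariant_right[OF odd \<eta> n F low_in_SL2_Zp])
  then show ?thesis by (simp add: low_mult) (simp add: low_def quadratic_char_1[OF odd \<eta>])
qed

text \<open>With t = c / a mod p^n the matrix is \<open>low t\<close> times an element of K_0(p^n)
  with lower right entry d - t b. Since p divides c and hence t, this entry is d mod p and
  contributes \<eta>(d).\<close>

lemma equivariant_small_cell:
  assumes F: "equivariant n \<eta> F" and det: "a * d - b * c = 1" and pc: "of_nat CARD('p) dvd c"
    and t: "of_nat CARD('p) ^ n dvd c - of_int t * a"
  shows "F (zmat a b c d) = \<eta> d * F (low t)" and "int CARD('p) dvd t"
proof -
  let ?p = "of_nat CARD('p) :: 'p padic_int"
  have a: "a dvd 1" by (rule det_1_lower_triangular_mod(1)[OF odd det pc])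
  have "?p dvd c - of_int t * a" using t n dvd_power dvd_trans by blast
  then have "?p dvd of_int t * a" using pc by (metis dvd_diff_right_iff)
  then have pt: "?p dvd of_int t" using a padic_unit_iff prime_elem_dvd_mult_iff[OF prime_elem_p] by blast
  then show "int CARD('p) dvd t" by (simp only: p_dvd_of_int)
  have AK: "zmat a b c d \<in> SL2_Zp" using det by (simp add: zmat_in_SL2_Zp)
  define k where "k = adj2 (low t) ** zmat a b c d"
  have k: "k \<in> K0 n" unfolding k_def using low_coset_iff[OF det] t by blast
  have "diag_char \<eta> k = \<eta> (d - of_int t * b)" by (simp add: k_def low_def zmat_mult)
  also have "\<dots> = \<eta> d" by (rule quadratic_char_cong[OF odd \<eta>]) (use pt in simp)
  finally have "F (low t ** k) = \<eta> d * F (low t)"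
    using equivariant_right[OF odd \<eta> n F low_in_SL2_Zp k] by simp
  then show "F (zmat a b c d) = \<eta> d * F (low t)"
    using adj2_mult_cancel(2)[OF low_in_SL2_Zp, of t "zmat a b c d"] by (simp add: k_def)
qed

text \<open>Later identities are checked in these coordinates: w(1) accounts for all matrices with
  unit lower left entry, the points \<open>low t\<close> for the others.\<close>

lemma equivariant_eqI:
  assumes F: "equivariant n \<eta> F" and G: "equivariant n \<eta> G"
    and w: "F (upw 0) = G (upw 0)"
    and l: "\<And>t. t \<in> p_residues_below TYPE('p) n \<Longrightarrow> F (low t) = G (low t)"
    and A: "A \<in> SL2_Zp"
  shows "F A = G A"
proof -
  obtain a b c d where e: "A = zmat a b c d" and det: "a * d - b * c = 1"
    using A by (rule SL2_Zp_cases)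
  show ?thesis
  proof (cases "of_nat CARD('p) dvd c")
    case False
    then show ?thesis using equivariant_big_cell[OF F det False] equivariant_big_cell[OF G det False] w by (simp add: e)
  next
    case True
    have a: "a dvd 1" by (rule det_1_lower_triangular_mod(1)[OF odd det True])
    obtain t where t: "t \<in> {0..<int CARD('p) ^ n}" "of_nat CARD('p) ^ n dvd c - of_int t * a"
      using ex1_residue_quotient[OF a, of n c] by blast
    have "t \<in> p_residues_below TYPE('p) n"
      using t equivariant_small_cell(2)[OF F det True t(2)] by (simp add: p_residues_below_def)
    then show ?thesis
      using l equivariant_small_cell(1)[OF F det True t(2)] equivariant_small_cell(1)[OF G det True t(2)]
      by (simp add: e)
  qed
qed

lemma card_p_residues_below: "int (card (p_residues_below TYPE('p) n)) = int CARD('p) ^ (n - 1)"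
proof -
  have pw: "int CARD('p) ^ n = int CARD('p) * int CARD('p) ^ (n - 1)"
    using n by (cases n) auto
  have pos: "int CARD('p) > 0" by (rule card_pos)
  have "p_residues_below TYPE('p) n = (\<lambda>i. int CARD('p) * i) ` {0..<int CARD('p) ^ (n - 1)}"
  proof
    show "p_residues_below TYPE('p) n \<subseteq> (\<lambda>i. int CARD('p) * i) ` {0..<int CARD('p) ^ (n - 1)}"
      using pos by (auto simp: p_residues_below_def pw elim!: dvdE simp: zero_le_mult_iff)
    show "(\<lambda>i. int CARD('p) * i) ` {0..<int CARD('p) ^ (n - 1)} \<subseteq> p_residues_below TYPE('p) n"
      using pos by (auto simp: p_residues_below_def pw)
  qed
  moreover have "inj_on (\<lambda>i. int CARD('p) * i) {0..<int CARD('p) ^ (n - 1)}"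
    using pos by (simp add: inj_on_def)
  ultimately show ?thesis by (simp add: card_image)
qed

text \<open>The coefficient of U_0 in its own square: for a unit s the representative
  \<open>low s\<close> lies in the cell of w(1) and carries the weight \<eta>(-s).\<close>

definition unit_sum :: complex where
  "unit_sum = (\<Sum>s\<in>{s \<in> {0..<int CARD('p) ^ n}. \<not> int CARD('p) dvd s}. \<eta> (- of_int s))"

lemma sum_residues_split:
  fixes g :: "int \<Rightarrow> complex"
  shows "(\<Sum>s\<in>{0..<int CARD('p) ^ n}. g s) = (\<Sum>s\<in>p_residues_below TYPE('p) n. g s)
    + (\<Sum>s\<in>{s \<in> {0..<int CARD('p) ^ n}. \<not> int CARD('p) dvd s}. g s)"
proof -
  have "{0..<int CARD('p) ^ n} = p_residues_below TYPE('p) n \<union> {s \<in> {0..<int CARD('p) ^ n}. \<not> int CARD('p) dvd s}"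
    by (auto simp: p_residues_below_def)
  moreover have "finite {s \<in> {0..<int CARD('p) ^ n}. \<not> int CARD('p) dvd s}"
    by (rule finite_subset[of _ "{0..<int CARD('p) ^ n}"]) auto
  ultimately show ?thesis
    by (metis (no_types, lifting) sum.union_disjoint finite_p_residues_below disjoint_iff mem_Collect_eq p_residues_below_def)
qed

lemma equivariant_upw:
  assumes F: "equivariant n \<eta> F"
  shows "F (upw x) = F (upw 0)"
  using equivariant_big_cell[OF F, of "- of_int x" 0 1 "-1"] quadratic_char_1[OF odd \<eta>]
    padic_unit_iff[of "-1 :: 'p padic_int"]
  by (simp add: upw_def)

lemma sum_equivariant_upw:
  assumes F: "equivariant n \<eta> F"
  shows "(\<Sum>x\<in>S. F (upw x) * h x) = (\<Sum>x\<in>S. F (upw 0) * h x)"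
  by (rule sum.cong[OF refl]) (subst equivariant_upw[OF F], rule refl)

lemma equivariant_low_unit:
  assumes F: "equivariant n \<eta> F" and s: "\<not> int CARD('p) dvd s"
  shows "F (low s) = \<eta> (- of_int s) * F (upw 0)"
  using equivariant_big_cell[OF F, of 1 1 0 "of_int s"] s by (simp add: low_def p_dvd_of_int)

text \<open>Each \<open>low s\<close> takes w(1) to a matrix with lower left entry -1, where G has
  its value at w(1); each \<open>upw x\<close> takes w(1) to \<open>low x\<close>. The units s add
  the weights \<eta>(-s) collected in \<open>unit_sum\<close>.\<close>

lemma coset_conv_upw:
  assumes F: "equivariant n \<eta> F" and G: "equivariant n \<eta> G"
  shows "coset_conv n F G (upw 0) =
    F (upw 0) * (\<Sum>s\<in>p_residues_below TYPE('p) n. G (low s))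
    + G (upw 0) * (\<Sum>s\<in>p_residues_below TYPE('p) n. F (low s)) + unit_sum * F (upw 0) * G (upw 0)"
proof -
  have "adj2 (low s) ** upw 0 = (zmat 0 1 (-1) (- of_int s) :: 'p mat2)" for s
    by (simp add: low_def upw_def zmat_mult)
  then have 1: "G (adj2 (low s) ** upw 0) = G (upw 0)" for s
    using equivariant_big_cell[OF G, of 0 "- of_int s" 1 "-1"] quadratic_char_1[OF odd \<eta>]
      padic_unit_iff[of "-1 :: 'p padic_int"] by simp
  have 2: "adj2 (upw x) ** upw 0 = (low x :: 'p mat2)" for x
    by (simp add: low_def upw_def zmat_mult)
  have "coset_conv n F G (upw 0) = (\<Sum>s\<in>p_residues_below TYPE('p) n. F (low s) * G (upw 0))
     + (\<Sum>s\<in>{s \<in> {0..<int CARD('p) ^ n}. \<not> int CARD('p) dvd s}. F (low s) * G (upw 0))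
     + (\<Sum>s\<in>p_residues_below TYPE('p) n. F (upw 0) * G (low s))"
    unfolding coset_conv_def sum_transversal sum_residues_split 1 2 by (simp only: sum_equivariant_upw[OF F])
  also have "(\<Sum>s\<in>{s \<in> {0..<int CARD('p) ^ n}. \<not> int CARD('p) dvd s}. F (low s) * G (upw 0))
      = (\<Sum>s\<in>{s \<in> {0..<int CARD('p) ^ n}. \<not> int CARD('p) dvd s}. \<eta> (- of_int s) * (F (upw 0) * G (upw 0)))"
    by (rule sum.cong[OF refl]) (simp add: equivariant_low_unit[OF F])
  finally show ?thesis
    by (simp add: unit_sum_def algebra_simps flip: sum_distrib_left sum_distrib_right)
qed

text \<open>The multiples s of p give additive convolution. For a unit s the weights are \<eta>(-s)
  \<eta>(s) = \<eta>(-1), and every \<open>upw x\<close> gives the same term; the units s and the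
  multiples x of p together number p^n.\<close>

lemma coset_conv_low:
  assumes F: "equivariant n \<eta> F" and G: "equivariant n \<eta> G" and t: "int CARD('p) dvd t"
  shows "coset_conv n F G (low t) =
    (\<Sum>s\<in>p_residues_below TYPE('p) n. F (low s) * G (low (t - s)))
    + \<eta> (-1) * of_nat CARD('p) ^ n * F (upw 0) * G (upw 0)"
proof -
  let ?p = "of_nat CARD('p) :: 'p padic_int"
  let ?U = "{s \<in> {0..<int CARD('p) ^ n}. \<not> int CARD('p) dvd s}"
  note em = quadratic_char_mult[OF odd \<eta>]
  have tp: "?p dvd of_int t" using t by (simp add: p_dvd_of_int)
  have 1: "adj2 (low s) ** low t = (low (t - s) :: 'p mat2)" for s
    by (simp add: adj2_low low_mult)
  have 2: "G (adj2 (upw x) ** low t) = \<eta> (-1) * G (upw 0)" for x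
  proof -
    have "adj2 (upw x) ** low t = (zmat (- of_int t) (-1) (1 - of_int x * of_int t) (- of_int x) :: 'p mat2)"
      by (simp add: low_def upw_def zmat_mult)
    moreover have nd: "\<not> ?p dvd 1 - of_int x * of_int t"
    proof
      assume "?p dvd 1 - of_int x * of_int t"
      then have "?p dvd 1" using tp by (metis dvd_diff_left_iff dvd_mult)
      then show False using padic_unit_iff[of ?p] by simp
    qed
    moreover have "- of_int t * - of_int x - (-1) * (1 - of_int x * of_int t) = (1 :: 'p padic_int)"
      by (simp add: algebra_simps)
    ultimately have "G (adj2 (upw x) ** low t) = \<eta> (- (1 - of_int x * of_int t)) * G (upw 0)"
      using equivariant_big_cell[OF G] by metis
    also have "\<eta> (- (1 - of_int x * of_int t)) = \<eta> (-1)"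
      by (rule quadratic_char_cong[OF odd \<eta>]) (use tp in simp)
    finally show ?thesis .
  qed
  have 3: "F (low s) * G (low (t - s)) = \<eta> (-1) * (F (upw 0) * G (upw 0))" if s: "s \<in> ?U" for s
  proof -
    have su: "(of_int s :: 'p padic_int) dvd 1" using s by (simp add: padic_unit_iff p_dvd_of_int)
    have ts: "\<not> int CARD('p) dvd t - s" using s t by (simp add: dvd_diff_right_iff)
    have "F (low s) * G (low (t - s)) = \<eta> (- of_int s) * \<eta> (- of_int (t - s)) * (F (upw 0) * G (upw 0))"
      using s by (simp add: equivariant_low_unit[OF F] equivariant_low_unit[OF G ts])
    also have "\<eta> (- of_int (t - s)) = \<eta> (of_int s)"
      by (rule quadratic_char_cong[OF odd \<eta>]) (use tp in simp)
    also have "\<eta> (- of_int s) * \<eta> (of_int s) = \<eta> (-1) * (\<eta> (of_int s) * \<eta> (of_int s))"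
      using em[of "-1" "of_int s"] by simp
    also have "\<eta> (of_int s) * \<eta> (of_int s) = 1" by (rule quadratic_char_sq[OF odd \<eta> su])
    finally show ?thesis by simp
  qed
  have c1: "of_nat (card (p_residues_below TYPE('p) n)) = (of_nat CARD('p) ^ (n - 1) :: complex)"
    using card_p_residues_below by (metis of_int_of_nat_eq of_int_power)
  have c2: "of_nat (card (p_residues_below TYPE('p) n)) + of_nat (card ?U) = (of_nat CARD('p) ^ n :: complex)"
  proof -
    have "(\<Sum>s\<in>{0..<int CARD('p) ^ n}. 1 :: complex) = of_nat CARD('p) ^ n"
      by (simp add: nat_power_eq)
    then show ?thesis unfolding sum_residues_split by simp
  qed
  have "coset_conv n F G (low t) = (\<Sum>s\<in>p_residues_below TYPE('p) n. F (low s) * G (low (t - s)))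
      + (\<Sum>s\<in>?U. F (low s) * G (low (t - s)))
      + (\<Sum>x\<in>p_residues_below TYPE('p) n. F (upw 0) * (\<eta> (-1) * G (upw 0)))"
    unfolding coset_conv_def sum_transversal sum_residues_split 1 2 by (simp only: sum_equivariant_upw[OF F])
  also have "(\<Sum>s\<in>?U. F (low s) * G (low (t - s))) = (\<Sum>s\<in>?U. \<eta> (-1) * (F (upw 0) * G (upw 0)))"
    by (rule sum.cong[OF refl]) (rule 3)
  finally have "coset_conv n F G (low t) = (\<Sum>s\<in>p_residues_below TYPE('p) n. F (low s) * G (low (t - s)))
      + (of_nat (card (p_residues_below TYPE('p) n)) + of_nat (card ?U)) * (\<eta> (-1) * (F (upw 0) * G (upw 0)))"
    by (simp only: sum_constant algebra_simps)
  then show ?thesis unfolding c2 by (simp only: mult.assoc mult.left_commute mult.commute)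
qed

text \<open>The formula at w(1) is symmetric, and at \<open>low t\<close> the reflection of s to t -
  s exchanges the two factors.\<close>

lemma coset_conv_commute:
  assumes F: "equivariant n \<eta> F" and G: "equivariant n \<eta> G" and A: "A \<in> SL2_Zp"
  shows "coset_conv n F G A = coset_conv n G F A"
proof (rule equivariant_eqI[OF equivariant_coset_conv[OF odd \<eta> n F G] equivariant_coset_conv[OF odd \<eta> n G F] _ _ A])
  show "coset_conv n F G (upw 0) = coset_conv n G F (upw 0)"
    by (simp add: coset_conv_upw[OF F G] coset_conv_upw[OF G F] algebra_simps)
  fix t assume t: "t \<in> p_residues_below TYPE('p) n"
  then have pt: "int CARD('p) dvd t" by (simp add: p_residues_below_def)
  have "(\<Sum>s\<in>p_residues_below TYPE('p) n. F (low (t - s)) * G (low (t - (t - s))))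
      = (\<Sum>s\<in>p_residues_below TYPE('p) n. F (low s) * G (low (t - s)))"
  proof (rule sum_mod_permute[of "int CARD('p) ^ n" _ "\<lambda>s. F (low s) * G (low (t - s))" "\<lambda>s. t - s"])
    show "p_residues_below TYPE('p) n \<subseteq> {0..<int CARD('p) ^ n}" by (auto simp: p_residues_below_def)
    fix x y assume "[x = y] (mod int CARD('p) ^ n)"
    then show "F (low x) * G (low (t - x)) = F (low y) * G (low (t - y))"
      using equivariant_low_cong[OF F] equivariant_low_cong[OF G] by (metis cong_diff cong_refl)
  next
    fix s assume s: "s \<in> p_residues_below TYPE('p) n"
    have "int CARD('p) dvd int CARD('p) ^ n" using n by (simp add: dvd_power)
    then show "(t - s) mod int CARD('p) ^ n \<in> p_residues_below TYPE('p) n"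
      using s pt by (simp add: p_residues_below_def dvd_mod_iff)
  next
    fix s u assume "[t - s = t - u] (mod int CARD('p) ^ n)"
    then show "[s = u] (mod int CARD('p) ^ n)"
      using cong_diff[of t t "int CARD('p) ^ n" "t - s" "t - u"] by simp
  qed simp
  then show "coset_conv n F G (low t) = coset_conv n G F (low t)"
    by (simp add: coset_conv_low[OF F G pt] coset_conv_low[OF G F pt] mult.commute ac_simps)
qed

end

section \<open>The coset elements\<close>

text \<open>A function on the compact group given by its values on the two kinds of cells: on matrices with
  lower left entry divisible by p it is governed by the square class of \<open>c / d\<close>, which is that
  of \<open>c d\<close>.\<close>

definition cell_fun ::
  "('p::prime_card padic_int \<Rightarrow> complex) \<Rightarrow> ('p padic_int \<Rightarrow> complex) \<Rightarrow> complex \<Rightarrow> 'p mat2 \<Rightarrow> complex" where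
  "cell_fun \<eta> \<phi> u A = (let c = inv_into UNIV to_fract (A $ 2 $ 1); d = inv_into UNIV to_fract (A $ 2 $ 2)
     in if of_nat CARD('p) dvd c then \<eta> d * \<phi> (c * d) else \<eta> (- c) * u)"

lemma cell_fun_zmat:
  "cell_fun \<eta> \<phi> u (zmat a b c d :: 'p::prime_card mat2)
    = (if of_nat CARD('p) dvd c then \<eta> d * \<phi> (c * d) else \<eta> (- c) * u)"
proof -
  have "inj (to_fract :: 'p padic_int \<Rightarrow> _)" by (simp add: inj_on_def)
  then show ?thesis by (simp add: cell_fun_def inv_f_f)
qed

text \<open>By \<open>padic_sqrt\<close>, \<open>leg v = 1\<close> says that v is the square of a
  unit. The two conditions are what translations by K_0(p^n) demand of a function of c d.\<close>

definition square_class_fun :: "nat \<Rightarrow> ('p::prime_card padic_int \<Rightarrow> complex) \<Rightarrow> bool" where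
  "square_class_fun n \<phi> \<longleftrightarrow>
     (\<forall>x y. of_nat CARD('p) ^ n dvd x - y \<longrightarrow> \<phi> x = \<phi> y) \<and>
     (\<forall>x v. leg v = 1 \<longrightarrow> \<phi> (v * x) = \<phi> x)"

text \<open>For \<open>e\<close> = 1 or -1 the witness is a unit, so this singles out order r and
  one square class of units.\<close>

definition unit_class_ind :: "nat \<Rightarrow> int \<Rightarrow> 'p::prime_card padic_int \<Rightarrow> complex" where
  "unit_class_ind r e x = (if \<exists>v. x = of_nat CARD('p) ^ r * v \<and> leg v = e then 1 else 0)"

definition zero_class_ind :: "nat \<Rightarrow> 'p::prime_card padic_int \<Rightarrow> complex" where
  "zero_class_ind n x = (if of_nat CARD('p) ^ n dvd x then 1 else 0)"

lemma leg_1_unit: "leg v = 1 \<Longrightarrow> (v :: 'p::prime_card padic_int) dvd 1"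
  using leg_eq_0_iff[of v] padic_unit_iff[of v] by simp

text \<open>As r < n, adding a multiple of p^n changes the cofactor v by a multiple of p, and a
  factor of symbol 1 leaves its symbol alone.\<close>

lemma square_class_unit_class_ind:
  assumes odd: "odd CARD('p::prime_card)" and r: "r < n"
  shows "square_class_fun n (unit_class_ind r e :: 'p padic_int \<Rightarrow> complex)"
proof -
  let ?p = "of_nat CARD('p) :: 'p padic_int"
  have 1: "\<exists>w. y = ?p ^ r * w \<and> leg w = e" if xy: "?p ^ n dvd x - y" and x: "x = ?p ^ r * v" "leg v = e" for x y v
  proof -
    obtain z where z: "x - y = ?p ^ n * z" using xy by (elim dvdE)
    obtain j where j: "n = r + Suc j" using r less_imp_Suc_add by auto
    have "y = x - ?p ^ n * z" using z by (simp add: algebra_simps)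
    then have y: "y = ?p ^ r * (v - ?p * (?p ^ j * z))" by (simp add: x j power_add algebra_simps)
    moreover have "leg (v - ?p * (?p ^ j * z)) = leg v" by (rule leg_cong) simp
    ultimately show ?thesis using x(2) by blast
  qed
  have "unit_class_ind r e x = unit_class_ind r e y" if "?p ^ n dvd x - y" for x y :: "'p padic_int"
  proof -
    have "?p ^ n dvd y - x" using that dvd_minus_iff[of "?p ^ n" "x - y"] by simp
    then have "(\<exists>v. x = ?p ^ r * v \<and> leg v = e) \<longleftrightarrow> (\<exists>v. y = ?p ^ r * v \<and> leg v = e)"
      using 1[OF that] 1[of y x] by blast
    then show ?thesis by (simp add: unit_class_ind_def)
  qed
  moreover have "unit_class_ind r e (v * x) = unit_class_ind r e x" if v: "leg v = 1" for x v :: "'p padic_int"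
  proof -
    obtain w where w: "v * w = 1" using leg_1_unit[OF v] by (metis dvdE)
    have lw: "leg w = 1" using arg_cong[OF w, of leg] v by (simp add: leg_mult[OF odd])
    have "(\<exists>z. v * x = ?p ^ r * z \<and> leg z = e) \<longleftrightarrow> (\<exists>z. x = ?p ^ r * z \<and> leg z = e)"
    proof
      assume "\<exists>z. v * x = ?p ^ r * z \<and> leg z = e"
      then obtain z where z: "v * x = ?p ^ r * z" "leg z = e" by blast
      have "x = w * (v * x)" using w by (simp flip: mult.assoc) (simp add: mult.commute)
      then have "x = ?p ^ r * (w * z)" using z by (simp add: ac_simps)
      moreover have "leg (w * z) = e" using z lw by (simp add: leg_mult[OF odd])
      ultimately show "\<exists>z. x = ?p ^ r * z \<and> leg z = e" by blast
    next
      assume "\<exists>z. x = ?p ^ r * z \<and> leg z = e"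
      then obtain z where z: "x = ?p ^ r * z" "leg z = e" by blast
      then have "v * x = ?p ^ r * (v * z)" "leg (v * z) = e" using v by (simp_all add: leg_mult[OF odd] ac_simps)
      then show "\<exists>z. v * x = ?p ^ r * z \<and> leg z = e" by blast
    qed
    then show ?thesis by (simp add: unit_class_ind_def)
  qed
  ultimately show ?thesis by (simp add: square_class_fun_def)
qed

lemma square_class_zero_class_ind: "square_class_fun n (zero_class_ind n :: 'p::prime_card padic_int \<Rightarrow> complex)"
proof -
  have "zero_class_ind n x = zero_class_ind n y"
    if "of_nat CARD('p) ^ n dvd x - y" for x y :: "'p padic_int"
  proof -
    have "of_nat CARD('p) ^ n dvd x \<longleftrightarrow> of_nat CARD('p) ^ n dvd y"
      using dvd_add_right_iff[OF that, of y] by simp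
    then show ?thesis by (simp only: zero_class_ind_def)
  qed
  moreover have "zero_class_ind n (v * x) = zero_class_ind n x" if "leg v = 1" for x v :: "'p padic_int"
    unfolding zero_class_ind_def by (simp only: dvd_mult_unit_iff'[OF leg_1_unit[OF that]])
  ultimately show ?thesis unfolding square_class_fun_def by blast
qed

lemma square_class_const: "square_class_fun n (\<lambda>_. c)"
  by (simp add: square_class_fun_def)

text \<open>Passage from p-adic square classes to Legendre symbols of integers, where the counting
  takes place.\<close>

lemma of_int_eq_p_power_mult:
  "(\<exists>v. (of_int t :: 'p::prime_card padic_int) = of_nat CARD('p) ^ r * v \<and> leg v = e)
    \<longleftrightarrow> int CARD('p) ^ r dvd t \<and> Legendre (t div int CARD('p) ^ r) (int CARD('p)) = e"
proof
  let ?p = "of_nat CARD('p) :: 'p padic_int"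
  assume "\<exists>v. of_int t = ?p ^ r * v \<and> leg v = e"
  then obtain v where v: "of_int t = ?p ^ r * v" "leg v = e" by blast
  then have "?p ^ r dvd of_int t" by simp
  then have d: "int CARD('p) ^ r dvd t" by (simp only: p_power_dvd_of_int)
  then obtain u where u: "t = int CARD('p) ^ r * u" by (elim dvdE)
  then have "?p ^ r * of_int u = ?p ^ r * v" using v(1) by simp
  then have "v = of_int u" using p_nonzero[where 'p = 'p] by simp
  then show "int CARD('p) ^ r dvd t \<and> Legendre (t div int CARD('p) ^ r) (int CARD('p)) = e"
    using v(2) d by (simp add: u leg_of_int)
next
  assume a: "int CARD('p) ^ r dvd t \<and> Legendre (t div int CARD('p) ^ r) (int CARD('p)) = e"
  then obtain u where u: "t = int CARD('p) ^ r * u" by (elim conjE dvdE)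
  then have "leg (of_int u :: 'p padic_int) = e" using a by (simp add: leg_of_int)
  moreover have "of_int t = of_nat CARD('p) ^ r * (of_int u :: 'p padic_int)" by (simp add: u)
  ultimately show "\<exists>v. (of_int t :: 'p padic_int) = of_nat CARD('p) ^ r * v \<and> leg v = e" by blast
qed

lemma rep_U_eq: "rep_U = (upw 0, 1)"
  by (simp add: rep_U_def upw_def zmat_def)

lemma rep_V_eq: "rep_V r a = (zmat 1 0 (a * of_nat CARD('p) ^ r) 1, 1)" for a :: "'p::prime_card padic_int"
  by (simp add: rep_V_def zmat_def to_fract_power to_fract_of_nat)

text \<open>Equivariance expresses every value on the double coset through the value 1 at g, so the
  definite description in \<open>coset_element\<close> denotes f.\<close>

lemma is_coset_element_unique:
  assumes f: "is_coset_element n \<eta> g f" and g: "g \<in> carrier Mp2"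
  shows "coset_element n \<eta> g = f"
  unfolding coset_element_def
proof (rule the_equality[where P = "is_coset_element n \<eta> g"], rule f)
  fix h assume h: "is_coset_element n \<eta> g h"
  have val: "f' x = (if x \<in> double_coset n g then f x else 0)" if f': "is_coset_element n \<eta> g f'" for f' x
  proof (cases "x \<in> double_coset n g")
    case True
    then obtain k k' where k: "k \<in> cover_preimage (K0 n)" "k' \<in> cover_preimage (K0 n)"
      and x: "x = k \<otimes>\<^bsub>Mp2\<^esub> g \<otimes>\<^bsub>Mp2\<^esub> k'" unfolding double_coset_def by blast
    have "f' x = cnj (genuine_char \<eta> k) * cnj (genuine_char \<eta> k') * f' g"
      "f x = cnj (genuine_char \<eta> k) * cnj (genuine_char \<eta> k') * f g"
      using f f' k g unfolding is_coset_element_def hecke_space_def x by blast+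
    moreover have "f' g = 1" "f g = 1" using f f' by (simp_all add: is_coset_element_def)
    ultimately show ?thesis using True by simp
  next
    case False
    then show ?thesis using f' by (auto simp: is_coset_element_def)
  qed
  show "h = f"
  proof
    fix x show "h x = f x" using val[OF h, of x] val[OF f, of x] by simp
  qed
qed

context
  fixes \<eta> :: "'p::prime_card padic_int \<Rightarrow> complex" and n :: nat
  assumes odd: "odd CARD('p)" and \<eta>: "quadratic_char \<eta>" and n: "n > 0"
begin

text \<open>Left translation scales the row (c, d) by t mod p^n and so multiplies c d by the square
  t^2. If p divides c, right translation multiplies c d, mod p^n, by a unit congruent to x t = 1 mod
  p, again a square. For c a unit only \<eta>(x) = \<eta>(t) is used.\<close>

lemma equivariant_cell_fun:
  assumes \<phi>: "square_class_fun n \<phi>"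
  shows "equivariant n \<eta> (cell_fun \<eta> \<phi> u)"
  unfolding equivariant_def
proof (intro ballI)
  let ?p = "of_nat CARD('p) :: 'p padic_int"
  fix A k :: "'p mat2" assume A: "A \<in> SL2_Zp" and k: "k \<in> K0 n"
  obtain a b c d where eA: "A = zmat a b c d" and det: "a * d - b * c = 1" using A by (rule SL2_Zp_cases)
  obtain x y z t where ek: "k = zmat x y z t" and detk: "x * t - y * z = 1" and z: "?p ^ n dvd z"
    using k by (rule K0_cases)
  have pz: "?p dvd z" using z n dvd_power dvd_trans by blast
  note xt = det_1_lower_triangular_mod[OF odd detk pz]
  note em = quadratic_char_mult[OF odd \<eta>] and ec = quadratic_char_cong[OF odd \<eta>]
  have unit_dvd: "?p dvd s * c \<longleftrightarrow> ?p dvd c" if "s dvd 1" for s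
    using that prime_elem_dvd_mult_iff[OF prime_elem_p] padic_unit_iff by blast
  have \<phi>1: "\<phi> v = \<phi> w" if "?p ^ n dvd v - w" for v w using \<phi> that by (simp add: square_class_fun_def)
  have \<phi>2: "\<phi> (v * w) = \<phi> w" if "leg v = 1" for v w using \<phi> that by (simp add: square_class_fun_def)
  have exx: "\<eta> x = \<eta> t" by (rule quadratic_char_leg[OF odd \<eta> xt(3)])
  have l: "cell_fun \<eta> \<phi> u (k ** A) = diag_char \<eta> k * cell_fun \<eta> \<phi> u A"
  proof -
    define c1 where "c1 = z * a + t * c"
    define d1 where "d1 = z * b + t * d"
    have m: "k ** A = zmat (x * a + y * c) (x * b + y * d) c1 d1"
      by (simp add: ek eA zmat_mult c1_def d1_def)
    have "?p dvd c1 \<longleftrightarrow> ?p dvd t * c" unfolding c1_def using pz by (simp add: dvd_add_right_iff)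
    then have dv: "?p dvd c1 \<longleftrightarrow> ?p dvd c" using unit_dvd[OF xt(2)] by simp
    show ?thesis
    proof (cases "?p dvd c")
      case True
      have "c1 * d1 - t\<^sup>2 * (c * d) = z * (a * d1 + t * c * b)"
        by (simp add: c1_def d1_def power2_eq_square algebra_simps)
      then have "\<phi> (c1 * d1) = \<phi> (t\<^sup>2 * (c * d))" using z by (intro \<phi>1) simp
      also have "\<dots> = \<phi> (c * d)" by (rule \<phi>2[OF leg_sq[OF odd xt(2)]])
      finally have "\<phi> (c1 * d1) = \<phi> (c * d)" .
      moreover have "\<eta> d1 = \<eta> (t * d)" by (rule ec) (use pz in \<open>simp add: d1_def\<close>)
      ultimately show ?thesis using True dv unfolding m unfolding eA ek cell_fun_zmat by (simp add: em)
    next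
      case False
      have "\<eta> (- c1) = \<eta> (t * (- c))" by (rule ec) (use pz in \<open>simp add: c1_def\<close>)
      then show ?thesis using False dv unfolding m unfolding eA ek cell_fun_zmat by (simp only: em diag_char_zmat) simp
    qed
  qed
  have r: "cell_fun \<eta> \<phi> u (A ** k) = diag_char \<eta> k * cell_fun \<eta> \<phi> u A"
  proof -
    define c1 where "c1 = c * x + d * z"
    define d1 where "d1 = c * y + d * t"
    have m: "A ** k = zmat (a * x + b * z) (a * y + b * t) c1 d1"
      by (simp add: ek eA zmat_mult c1_def d1_def)
    have "?p dvd c1 \<longleftrightarrow> ?p dvd x * c" unfolding c1_def using pz by (simp add: dvd_add_left_iff mult.commute)
    then have dv: "?p dvd c1 \<longleftrightarrow> ?p dvd c" using unit_dvd[OF xt(1)] by simp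
    show ?thesis
    proof (cases "?p dvd c")
      case True
      obtain di where di: "d * di = 1" using det_1_lower_triangular_mod(2)[OF odd det True] by (metis dvdE)
      \<comment> \<open>Chosen so that v c d = c x (c y + d t) holds exactly; as p divides c, v is x
        t mod p.\<close>
      define v where "v = x * t + c * (x * y * di)"
      have "leg v = leg (x * t)" by (rule leg_cong) (use True in \<open>simp add: v_def\<close>)
      also have "\<dots> = 1" using leg_unit[OF xt(2)] xt(3) by (auto simp: leg_mult[OF odd])
      finally have lv: "leg v = 1" .
      have "v * (c * d) = c * (x * (d * t + (d * di) * c * y))"
        by (simp add: v_def algebra_simps)
      then have vcd: "v * (c * d) = c * x * d1" by (simp add: di d1_def algebra_simps)
      have "c1 * d1 - v * (c * d) = z * (d * d1)" unfolding vcd by (simp add: c1_def algebra_simps)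
      then have "\<phi> (c1 * d1) = \<phi> (v * (c * d))" using z by (intro \<phi>1) simp
      also have "\<dots> = \<phi> (c * d)" by (rule \<phi>2[OF lv])
      finally have "\<phi> (c1 * d1) = \<phi> (c * d)" .
      moreover have "\<eta> d1 = \<eta> (t * d)" by (rule ec) (use True in \<open>simp add: d1_def mult.commute\<close>)
      ultimately show ?thesis using True dv unfolding m unfolding eA ek cell_fun_zmat by (simp add: em)
    next
      case False
      have "\<eta> (- c1) = \<eta> (x * (- c))" by (rule ec) (use pz in \<open>simp add: c1_def mult.commute\<close>)
      then show ?thesis using False dv unfolding m unfolding eA ek cell_fun_zmat by (simp only: em diag_char_zmat exx) simp
    qed
  qed
  show "cell_fun \<eta> \<phi> u (k ** A) = diag_char \<eta> k * cell_fun \<eta> \<phi> u A \<and>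
      cell_fun \<eta> \<phi> u (A ** k) = diag_char \<eta> k * cell_fun \<eta> \<phi> u A" using l r by simp
qed

text \<open>Reduces a support condition in the cover to one on matrices: the sign is absorbed by the
  left factor, as in \<open>double_cosetI\<close>.\<close>

lemma is_coset_element_cell_fun:
  assumes \<phi>: "square_class_fun n \<phi>" and Z: "Z \<in> SL2_Zp" and one: "cell_fun \<eta> \<phi> u Z = 1"
    and supp: "\<And>a b c d. a * d - b * c = 1 \<Longrightarrow> cell_fun \<eta> \<phi> u (zmat a b c d) \<noteq> 0
      \<Longrightarrow> \<exists>k k'. k \<in> K0 n \<and> k' \<in> K0 n \<and> zmat a b c d = k ** Z ** k'"
  shows "is_coset_element n \<eta> (Z, 1) (genuine_ext (cell_fun \<eta> \<phi> u))"
    and "coset_element n \<eta> (Z, 1) = genuine_ext (cell_fun \<eta> \<phi> u)"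
proof -
  show 1: "is_coset_element n \<eta> (Z, 1) (genuine_ext (cell_fun \<eta> \<phi> u))"
    unfolding is_coset_element_def
  proof (intro conjI subsetI)
    show "genuine_ext (cell_fun \<eta> \<phi> u) \<in> hecke_space n \<eta>"
      by (rule genuine_ext_in_hecke_space[OF odd \<eta> n equivariant_cell_fun[OF \<phi>]])
    show "genuine_ext (cell_fun \<eta> \<phi> u) (Z, 1) = 1"
      by (simp add: genuine_ext_apply[OF Z] one)
    fix x assume "x \<in> {x. genuine_ext (cell_fun \<eta> \<phi> u) x \<noteq> 0}"
    then obtain A e where x: "x = (A, e)" "A \<in> SL2_Zp" "e = 1 \<or> e = -1" "cell_fun \<eta> \<phi> u A \<noteq> 0"
      by (auto simp: genuine_ext_def cover_preimage_def split: if_splits)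
    obtain a b c d where A: "A = zmat a b c d" "a * d - b * c = 1" using x(2) by (rule SL2_Zp_cases)
    obtain k k' where "k \<in> K0 n" "k' \<in> K0 n" "A = k ** Z ** k'"
      using supp[OF A(2)] x(4) A(1) by blast
    then show "x \<in> double_coset n (Z, 1)" using double_cosetI[OF odd _ _ Z x(3)] x(1) by simp
  qed
  have "(Z, 1) \<in> carrier Mp2" using Z SL2_Zp_subset by (auto simp: carrier_Mp2)
  then show "coset_element n \<eta> (Z, 1) = genuine_ext (cell_fun \<eta> \<phi> u)"
    by (rule is_coset_element_unique[OF 1])
qed

lemma coset_element_I:
  "is_coset_element n \<eta> rep_I (coset_element n \<eta> rep_I)"
  "coset_element n \<eta> rep_I = genuine_ext (cell_fun \<eta> (zero_class_ind n) 0)"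
proof -
  have one: "cell_fun \<eta> (zero_class_ind n) 0 (mat 1) = 1"
    by (simp add: mat_1_zmat cell_fun_zmat zero_class_ind_def quadratic_char_1[OF odd \<eta>])
  have supp: "\<exists>k k'. k \<in> K0 n \<and> k' \<in> K0 n \<and> zmat a b c d = k ** mat 1 ** k'"
    if det: "a * d - b * c = 1" and nz: "cell_fun \<eta> (zero_class_ind n) 0 (zmat a b c d) \<noteq> 0"
    for a b c d :: "'p padic_int"
  proof -
    have c: "of_nat CARD('p) dvd c" "of_nat CARD('p) ^ n dvd c * d"
      using nz by (auto simp: cell_fun_zmat zero_class_ind_def split: if_splits)
    then have "of_nat CARD('p) ^ n dvd c"
      using dvd_mult_unit_iff[OF det_1_lower_triangular_mod(2)[OF odd det c(1)]] by blast
    then have "zmat a b c d \<in> K0 n" using det by (simp add: zmat_in_K0)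
    then show ?thesis using mat_1_in_K0
      by (intro exI[of _ "zmat a b c d"] exI[of _ "mat 1"]) simp
  qed
  note ce = is_coset_element_cell_fun[OF square_class_zero_class_ind mat_1_in_SL2_Zp one supp]
  show "coset_element n \<eta> rep_I = genuine_ext (cell_fun \<eta> (zero_class_ind n) 0)"
    unfolding rep_I_def by (rule ce(2))
  then show "is_coset_element n \<eta> rep_I (coset_element n \<eta> rep_I)"
    using ce(1) by (simp add: rep_I_def)
qed

lemma coset_element_U:
  "is_coset_element n \<eta> rep_U (coset_element n \<eta> rep_U)"
  "coset_element n \<eta> rep_U = genuine_ext (cell_fun \<eta> (\<lambda>_. 0) 1)"
proof -
  have one: "cell_fun \<eta> (\<lambda>_. 0) 1 (upw 0) = 1"
    using padic_unit_iff[of "-1 :: 'p padic_int"]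
    by (simp add: upw_def cell_fun_zmat quadratic_char_1[OF odd \<eta>])
  have supp: "\<exists>k k'. k \<in> K0 n \<and> k' \<in> K0 n \<and> zmat a b c d = k ** upw 0 ** k'"
    if det: "a * d - b * c = 1" and nz: "cell_fun \<eta> (\<lambda>_. 0) 1 (zmat a b c d) \<noteq> 0"
    for a b c d :: "'p padic_int"
  proof -
    have "\<not> of_nat CARD('p) dvd c" using nz by (auto simp: cell_fun_zmat split: if_splits)
    then show ?thesis using zmat_big_cell[OF det] by metis
  qed
  note ce = is_coset_element_cell_fun[OF square_class_const upw_in_SL2_Zp one supp]
  show "coset_element n \<eta> rep_U = genuine_ext (cell_fun \<eta> (\<lambda>_. 0) 1)"
    unfolding rep_U_eq by (rule ce(2))
  then show "is_coset_element n \<eta> rep_U (coset_element n \<eta> rep_U)"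
    using ce(1) by (simp add: rep_U_eq)
qed

lemma coset_element_V:
  assumes r: "r \<in> {1..<n}" and \<delta>: "\<delta> dvd 1"
  shows "is_coset_element n \<eta> (rep_V r \<delta>) (coset_element n \<eta> (rep_V r \<delta>))"
    and "coset_element n \<eta> (rep_V r \<delta>) = genuine_ext (cell_fun \<eta> (unit_class_ind r (leg \<delta>)) 0)"
proof -
  let ?p = "of_nat CARD('p) :: 'p padic_int"
  let ?Z = "zmat 1 0 (\<delta> * ?p ^ r) 1"
  have ZK: "?Z \<in> SL2_Zp" by (simp add: zmat_in_SL2_Zp)
  have "?p dvd ?p ^ r" using r by (intro dvd_power) auto
  then have "?p dvd \<delta> * ?p ^ r" by simp
  moreover have "unit_class_ind r (leg \<delta>) (\<delta> * ?p ^ r) = 1"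
    by (auto simp: unit_class_ind_def intro: exI[of _ \<delta>])
  ultimately have one: "cell_fun \<eta> (unit_class_ind r (leg \<delta>)) 0 ?Z = 1"
    by (simp add: cell_fun_zmat quadratic_char_1[OF odd \<eta>])
  have supp: "\<exists>k k'. k \<in> K0 n \<and> k' \<in> K0 n \<and> zmat a b c d = k ** ?Z ** k'"
    if det: "a * d - b * c = 1" and nz: "cell_fun \<eta> (unit_class_ind r (leg \<delta>)) 0 (zmat a b c d) \<noteq> 0"
    for a b c d :: "'p padic_int"
  proof -
    have c: "?p dvd c" "\<exists>v. c * d = ?p ^ r * v \<and> leg v = leg \<delta>"
      using nz by (auto simp: cell_fun_zmat unit_class_ind_def split: if_splits)
    then obtain v where "c * d = ?p ^ r * v" "leg v = leg \<delta>" by blast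
    then show ?thesis using zmat_small_cell[OF odd det c(1) _ _ \<delta>] by metis
  qed
  have "r < n" using r by simp
  note ce = is_coset_element_cell_fun[OF square_class_unit_class_ind[OF odd this] ZK one supp]
  show "coset_element n \<eta> (rep_V r \<delta>) = genuine_ext (cell_fun \<eta> (unit_class_ind r (leg \<delta>)) 0)"
    unfolding rep_V_eq by (rule ce(2))
  then show "is_coset_element n \<eta> (rep_V r \<delta>) (coset_element n \<eta> (rep_V r \<delta>))"
    using ce(1) by (simp add: rep_V_eq)
qed

section \<open>Values of the coset elements at the coordinate points, and vanishing criteria\<close>

lemma genuine_cell_fun_upw: "genuine_ext (cell_fun \<eta> \<phi> u) (upw 0, 1) = u"
  using padic_unit_iff[of "-1 :: 'p padic_int"]
  by (simp add: genuine_ext_apply[OF upw_in_SL2_Zp]) (simp add: upw_def cell_fun_zmat quadratic_char_1[OF odd \<eta>])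

lemma genuine_cell_fun_lower:
  assumes "of_nat CARD('p) dvd c"
  shows "genuine_ext (cell_fun \<eta> \<phi> u) (zmat 1 0 c 1, 1) = \<phi> c"
proof -
  have "zmat 1 0 c 1 \<in> SL2_Zp" by (simp add: zmat_in_SL2_Zp)
  then show ?thesis using assms by (simp add: genuine_ext_apply cell_fun_zmat quadratic_char_1[OF odd \<eta>])
qed

lemma genuine_cell_fun_low:
  assumes "int CARD('p) dvd t"
  shows "genuine_ext (cell_fun \<eta> \<phi> u) (low t, 1) = \<phi> (of_int t)"
  using genuine_cell_fun_lower[of "of_int t"] assms by (simp add: low_def p_dvd_of_int)

lemma coset_element_I_low:
  "int CARD('p) dvd t \<Longrightarrow> coset_element n \<eta> rep_I (low t, 1) = (if int CARD('p) ^ n dvd t then 1 else 0)"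
  by (simp add: coset_element_I genuine_cell_fun_low zero_class_ind_def p_power_dvd_of_int)

lemma coset_element_U_low:
  "int CARD('p) dvd t \<Longrightarrow> coset_element n \<eta> rep_U (low t, 1) = 0"
  by (simp add: coset_element_U genuine_cell_fun_low)

lemma coset_element_V_low:
  assumes "r \<in> {1..<n}" "\<delta> dvd 1" "int CARD('p) dvd t"
  shows "coset_element n \<eta> (rep_V r \<delta>) (low t, 1) =
    (if int CARD('p) ^ r dvd t \<and> Legendre (t div int CARD('p) ^ r) (int CARD('p)) = leg \<delta> then 1 else 0)"
  using assms by (simp add: coset_element_V genuine_cell_fun_low unit_class_ind_def of_int_eq_p_power_mult)

lemma coset_element_upw:
  "coset_element n \<eta> rep_I (upw 0, 1) = 0" "coset_element n \<eta> rep_U (upw 0, 1) = 1"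
  "r \<in> {1..<n} \<Longrightarrow> \<delta> dvd 1 \<Longrightarrow> coset_element n \<eta> (rep_V r \<delta>) (upw 0, 1) = 0"
  by (simp_all add: coset_element_I coset_element_U coset_element_V genuine_cell_fun_upw)

lemma hecke_space_eqI_low:
  assumes f: "f \<in> hecke_space n \<eta>" and g: "g \<in> hecke_space n \<eta>"
    and "f (upw 0, 1) = g (upw 0, 1)"
    and "\<And>t. t \<in> p_residues_below TYPE('p) n \<Longrightarrow> f (low t, 1) = g (low t, 1)"
  shows "f = g"
  by (rule hecke_space_eqI[OF odd \<eta> n f g],
      rule equivariant_eqI[OF odd \<eta> n hecke_space_genuine(1)[OF odd \<eta> n f]
        hecke_space_genuine(1)[OF odd \<eta> n g]]) (use assms in auto)

text \<open>The entry c is a unit, divisible by p^n, or of some order r with 1 \<le> r < n; in the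
  last case the symbol of the unit part of c d selects 1 or \<open>lam\<close>. So every matrix lies
  in the double coset of a listed representative.\<close>

lemma hecke_space_vanishing:
  assumes f: "f \<in> hecke_space n \<eta>" and lam: "lam dvd 1" "leg lam = -1"
    and I: "f rep_I = 0" and U: "f rep_U = 0"
    and V: "\<And>r \<delta>. r \<in> {1..<n} \<Longrightarrow> \<delta> \<in> {1, lam} \<Longrightarrow> f (rep_V r \<delta>) = 0"
  shows "f = 0"
proof (rule hecke_space_eqI[OF odd \<eta> n f hecke_space_zero[OF odd \<eta> n]])
  let ?p = "of_nat CARD('p) :: 'p padic_int"
  define F where "F A = f (A, 1)" for A
  have F: "equivariant n \<eta> F" unfolding F_def by (rule hecke_space_genuine(1)[OF odd \<eta> n f])
  fix A :: "'p mat2" assume "A \<in> SL2_Zp"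
  then obtain a b c d where A: "A = zmat a b c d" and det: "a * d - b * c = 1" by (rule SL2_Zp_cases)
  have "F A = 0"
  proof (cases "?p dvd c")
    case False
    then show ?thesis using equivariant_big_cell[OF odd \<eta> n F det] U by (simp add: A F_def rep_U_eq)
  next
    case pc: True
    show ?thesis
    proof (cases "?p ^ n dvd c")
      case True
      then have "A \<in> K0 n" using det by (simp add: A zmat_in_K0)
      then have "F (A ** mat 1) = diag_char \<eta> A * F (mat 1)"
        by (rule equivariant_left[OF odd \<eta> n F mat_1_in_SL2_Zp])
      then show ?thesis using I by (simp add: F_def rep_I_def)
    next
      case False
      then have "c \<noteq> 0" by auto
      then obtain r w where w: "c = ?p ^ r * w" "w dvd 1" using padic_decomp by metis
      have d: "d dvd 1" by (rule det_1_lower_triangular_mod(2)[OF odd det pc])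
      have "r < n" using False w(1) by (metis dvd_triv_left le_imp_power_dvd dvd_trans not_less dvd_mult2)
      moreover have "r \<noteq> 0" using pc w padic_unit_iff by (metis mult_1 power_0)
      ultimately have r: "r \<in> {1..<n}" by simp
      obtain \<delta> where \<delta>: "\<delta> \<in> {1, lam}" "leg \<delta> = leg (w * d)"
      proof (cases "leg (w * d) = 1")
        case False
        then have "leg (w * d) = -1" using leg_unit[of "w * d"] w d by auto
        then show ?thesis using that[of lam] lam by simp
      qed (use that[of 1] in simp)
      have \<delta>u: "\<delta> dvd 1" using \<delta> lam by auto
      have "c * d = ?p ^ r * (w * d)" by (simp add: w)
      then obtain k k' where k: "k \<in> K0 n" "k' \<in> K0 n" "A = k ** zmat 1 0 (\<delta> * ?p ^ r) 1 ** k'"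
        using zmat_small_cell[OF odd det pc _ \<delta>(2)[symmetric] \<delta>u] A by metis
      have Z: "zmat 1 0 (\<delta> * ?p ^ r) 1 \<in> SL2_Zp" by (simp add: zmat_in_SL2_Zp)
      have "k \<in> SL2_Zp" using k K0_subset by blast
      then have "F A = diag_char \<eta> k' * (diag_char \<eta> k * F (zmat 1 0 (\<delta> * ?p ^ r) 1))"
        unfolding k(3) using equivariant_right[OF odd \<eta> n F SL2_Zp_mult[OF _ Z] k(2)]
          equivariant_left[OF odd \<eta> n F Z k(1)] by simp
      then show ?thesis using V[OF r \<delta>(1)] by (simp add: F_def rep_V_eq)
    qed
  qed
  then show "f (A, 1) = 0 (A, 1)" by (simp add: F_def)
qed

section \<open>Convolution on the Hecke space and the algebra laws\<close>

lemma hecke_conv_in_hecke_space: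
  assumes \<mu>: "left_haar_measure Mp2 Mp2_topology \<mu>" "emeasure \<mu> (cover_preimage (K0 n)) = 1"
    and f: "f \<in> hecke_space n \<eta>" and g: "g \<in> hecke_space n \<eta>"
  shows "hecke_conv \<mu> f g \<in> hecke_space n \<eta>"
  unfolding hecke_conv_eq[OF odd \<eta> n \<mu> f g]
  by (intro genuine_ext_in_hecke_space[OF odd \<eta> n] equivariant_coset_conv[OF odd \<eta> n]
      hecke_space_genuine(1)[OF odd \<eta> n] f g)

lemma hecke_conv_apply:
  assumes \<mu>: "left_haar_measure Mp2 Mp2_topology \<mu>" "emeasure \<mu> (cover_preimage (K0 n)) = 1"
    and f: "f \<in> hecke_space n \<eta>" and g: "g \<in> hecke_space n \<eta>" and A: "A \<in> SL2_Zp"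
  shows "hecke_conv \<mu> f g (A, 1) = coset_conv n (\<lambda>A. f (A, 1)) (\<lambda>A. g (A, 1)) A"
  unfolding hecke_conv_eq[OF odd \<eta> n \<mu> f g] by (rule genuine_ext_apply[OF A])

lemma hecke_conv_commute:
  assumes \<mu>: "left_haar_measure Mp2 Mp2_topology \<mu>" "emeasure \<mu> (cover_preimage (K0 n)) = 1"
    and f: "f \<in> hecke_space n \<eta>" and g: "g \<in> hecke_space n \<eta>"
  shows "hecke_conv \<mu> f g = hecke_conv \<mu> g f"
  unfolding hecke_conv_eq[OF odd \<eta> n \<mu> f g] hecke_conv_eq[OF odd \<eta> n \<mu> g f]
  by (intro genuine_ext_cong coset_conv_commute[OF odd \<eta> n] hecke_space_genuine(1)[OF odd \<eta> n] f g)

lemma hecke_conv_assoc: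
  assumes \<mu>: "left_haar_measure Mp2 Mp2_topology \<mu>" "emeasure \<mu> (cover_preimage (K0 n)) = 1"
    and f: "f \<in> hecke_space n \<eta>" and g: "g \<in> hecke_space n \<eta>" and h: "h \<in> hecke_space n \<eta>"
  shows "hecke_conv \<mu> (hecke_conv \<mu> f g) h = hecke_conv \<mu> f (hecke_conv \<mu> g h)"
proof (rule hecke_space_eqI[OF odd \<eta> n])
  note closed = hecke_conv_in_hecke_space[OF \<mu>]
  show "hecke_conv \<mu> (hecke_conv \<mu> f g) h \<in> hecke_space n \<eta>"
    "hecke_conv \<mu> f (hecke_conv \<mu> g h) \<in> hecke_space n \<eta>" using closed f g h by blast+
  fix A :: "'p mat2" assume A: "A \<in> SL2_Zp"
  have ZA: "adj2 Z ** A \<in> SL2_Zp" if "Z \<in> transversal n" for Z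
    using that transversal_subset SL2_Zp_mult adj2_SL2_Zp(1) A by blast
  have "hecke_conv \<mu> (hecke_conv \<mu> f g) h (A, 1) =
      coset_conv n (\<lambda>A. hecke_conv \<mu> f g (A, 1)) (\<lambda>A. h (A, 1)) A"
    by (rule hecke_conv_apply[OF \<mu> closed[OF f g] h A])
  also have "\<dots> = coset_conv n (coset_conv n (\<lambda>A. f (A, 1)) (\<lambda>A. g (A, 1))) (\<lambda>A. h (A, 1)) A"
    unfolding coset_conv_def[of n _ "\<lambda>A. h (A, 1)"]
  proof (rule sum.cong[OF refl])
    fix Z :: "'p mat2" assume "Z \<in> transversal n"
    then have "Z \<in> SL2_Zp" using transversal_subset by blast
    then show "hecke_conv \<mu> f g (Z, 1) * h (adj2 Z ** A, 1)
        = coset_conv n (\<lambda>A. f (A, 1)) (\<lambda>A. g (A, 1)) Z * h (adj2 Z ** A, 1)"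
      by (simp add: hecke_conv_apply[OF \<mu> f g])
  qed
  also have "\<dots> = coset_conv n (\<lambda>A. f (A, 1)) (coset_conv n (\<lambda>A. g (A, 1)) (\<lambda>A. h (A, 1))) A"
    by (rule coset_conv_assoc[OF odd \<eta> n _ _ _ A]) (rule hecke_space_genuine(1)[OF odd \<eta> n], fact)+
  also have "\<dots> = coset_conv n (\<lambda>A. f (A, 1)) (\<lambda>A. hecke_conv \<mu> g h (A, 1)) A"
    unfolding coset_conv_def[of n "\<lambda>A. f (A, 1)"]
    by (rule sum.cong[OF refl]) (simp add: hecke_conv_apply[OF \<mu> g h] ZA)
  also have "\<dots> = hecke_conv \<mu> f (hecke_conv \<mu> g h) (A, 1)"
    by (rule hecke_conv_apply[OF \<mu> f closed[OF g h] A, symmetric])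
  finally show "hecke_conv \<mu> (hecke_conv \<mu> f g) h (A, 1) = hecke_conv \<mu> f (hecke_conv \<mu> g h) (A, 1)" .
qed

lemma hecke_conv_low:
  assumes \<mu>: "left_haar_measure Mp2 Mp2_topology \<mu>" "emeasure \<mu> (cover_preimage (K0 n)) = 1"
    and f: "f \<in> hecke_space n \<eta>" and g: "g \<in> hecke_space n \<eta>" and t: "int CARD('p) dvd t"
  shows "hecke_conv \<mu> f g (low t, 1) =
    (\<Sum>s\<in>p_residues_below TYPE('p) n. f (low s, 1) * g (low (t - s), 1))
    + \<eta> (-1) * of_nat CARD('p) ^ n * f (upw 0, 1) * g (upw 0, 1)"
  unfolding hecke_conv_apply[OF \<mu> f g low_in_SL2_Zp]
  by (rule coset_conv_low[OF odd \<eta> n _ _ t]) (rule hecke_space_genuine(1)[OF odd \<eta> n], fact)+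

lemma hecke_conv_upw:
  assumes \<mu>: "left_haar_measure Mp2 Mp2_topology \<mu>" "emeasure \<mu> (cover_preimage (K0 n)) = 1"
    and f: "f \<in> hecke_space n \<eta>" and g: "g \<in> hecke_space n \<eta>"
  shows "hecke_conv \<mu> f g (upw 0, 1) =
    f (upw 0, 1) * (\<Sum>s\<in>p_residues_below TYPE('p) n. g (low s, 1))
    + g (upw 0, 1) * (\<Sum>s\<in>p_residues_below TYPE('p) n. f (low s, 1))
    + unit_sum \<eta> n * f (upw 0, 1) * g (upw 0, 1)"
  unfolding hecke_conv_apply[OF \<mu> f g upw_in_SL2_Zp]
  by (rule coset_conv_upw[OF odd \<eta> n]) (rule hecke_space_genuine(1)[OF odd \<eta> n], fact)+

text \<open>In coordinates the element of \<open>rep_I\<close> is the point mass at s = 0 with value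
  0 at w(1), which is neutral in both convolution formulas.\<close>

lemma hecke_conv_one:
  assumes \<mu>: "left_haar_measure Mp2 Mp2_topology \<mu>" "emeasure \<mu> (cover_preimage (K0 n)) = 1"
    and f: "f \<in> hecke_space n \<eta>"
  shows "hecke_conv \<mu> (coset_element n \<eta> rep_I) f = f"
proof -
  have I: "coset_element n \<eta> rep_I \<in> hecke_space n \<eta>"
    using coset_element_I(1) by (simp add: is_coset_element_def)
  have 0: "0 \<in> p_residues_below TYPE('p) n" by (simp add: p_residues_below_def)
  have "coset_element n \<eta> rep_I (low s, 1) = (if s = 0 then 1 else 0)"
    if "s \<in> p_residues_below TYPE('p) n" for s
    using that coset_element_I_low[of s] zdvd_not_zless[of s "int CARD('p) ^ n"]
    by (cases "s = 0") (auto simp: p_residues_below_def)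
  then have sum: "(\<Sum>s\<in>p_residues_below TYPE('p) n. coset_element n \<eta> rep_I (low s, 1) * h s)
      = h 0" for h
  proof -
    assume a: "\<And>s. s \<in> p_residues_below TYPE('p) n \<Longrightarrow>
      coset_element n \<eta> rep_I (low s, 1) = (if s = 0 then 1 else 0)"
    have "(\<Sum>s\<in>p_residues_below TYPE('p) n. coset_element n \<eta> rep_I (low s, 1) * h s)
      = (\<Sum>s\<in>p_residues_below TYPE('p) n. if s = 0 then h s else 0)"
      by (rule sum.cong[OF refl]) (simp add: a)
    then show ?thesis using 0 by (simp add: finite_p_residues_below)
  qed
  show ?thesis
  proof (rule hecke_space_eqI_low[OF hecke_conv_in_hecke_space[OF \<mu> I f] f])
    show "hecke_conv \<mu> (coset_element n \<eta> rep_I) f (upw 0, 1) = f (upw 0, 1)"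
      using sum[of "\<lambda>_. 1"] by (simp add: hecke_conv_upw[OF \<mu> I f] coset_element_upw)
    fix t assume "t \<in> p_residues_below TYPE('p) n"
    then show "hecke_conv \<mu> (coset_element n \<eta> rep_I) f (low t, 1) = f (low t, 1)"
      using sum[of "\<lambda>s. f (low (t - s), 1)"]
      by (simp add: hecke_conv_low[OF \<mu> I f] coset_element_upw p_residues_below_def)
  qed
qed

lemma hecke_conv_add_left:
  assumes \<mu>: "left_haar_measure Mp2 Mp2_topology \<mu>" "emeasure \<mu> (cover_preimage (K0 n)) = 1"
    and f: "f \<in> hecke_space n \<eta>" and g: "g \<in> hecke_space n \<eta>" and h: "h \<in> hecke_space n \<eta>"
  shows "hecke_conv \<mu> (f + g) h = hecke_conv \<mu> f h + hecke_conv \<mu> g h"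
proof (rule hecke_space_eqI[OF odd \<eta> n])
  note closed = hecke_conv_in_hecke_space[OF \<mu>] hecke_space_add[OF odd \<eta> n]
  show "hecke_conv \<mu> (f + g) h \<in> hecke_space n \<eta>"
    "hecke_conv \<mu> f h + hecke_conv \<mu> g h \<in> hecke_space n \<eta>" using closed f g h by blast+
  fix A :: "'p mat2" assume A: "A \<in> SL2_Zp"
  show "hecke_conv \<mu> (f + g) h (A, 1) = (hecke_conv \<mu> f h + hecke_conv \<mu> g h) (A, 1)"
    by (simp add: hecke_conv_apply[OF \<mu> _ _ A] closed f g h coset_conv_def distrib_right sum.distrib)
qed

lemma hecke_conv_scale_left:
  assumes \<mu>: "left_haar_measure Mp2 Mp2_topology \<mu>" "emeasure \<mu> (cover_preimage (K0 n)) = 1"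
    and f: "f \<in> hecke_space n \<eta>" and h: "h \<in> hecke_space n \<eta>"
  shows "hecke_conv \<mu> (c *\<^sub>C f) h = c *\<^sub>C hecke_conv \<mu> f h"
proof (rule hecke_space_eqI[OF odd \<eta> n])
  note closed = hecke_conv_in_hecke_space[OF \<mu>] hecke_space_scale[OF odd \<eta> n]
  show "hecke_conv \<mu> (c *\<^sub>C f) h \<in> hecke_space n \<eta>"
    "c *\<^sub>C hecke_conv \<mu> f h \<in> hecke_space n \<eta>" using closed f h by blast+
  fix A :: "'p mat2" assume A: "A \<in> SL2_Zp"
  have "hecke_conv \<mu> (c *\<^sub>C f) h (A, 1) = c * hecke_conv \<mu> f h (A, 1)"
    unfolding hecke_conv_apply[OF \<mu> closed(2)[OF f] h A] hecke_conv_apply[OF \<mu> f h A]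
    by (simp add: coset_conv_def cscale_def sum_distrib_left mult.assoc)
  then show "hecke_conv \<mu> (c *\<^sub>C f) h (A, 1) = (c *\<^sub>C hecke_conv \<mu> f h) (A, 1)"
    by (simp add: cscale_def)
qed

lemma algebra_hecke_algebra:
  assumes \<mu>: "left_haar_measure Mp2 Mp2_topology \<mu>" "emeasure \<mu> (cover_preimage (K0 n)) = 1"
  shows "Module.algebra (ring_of_type_algebra :: complex ring) (hecke_algebra \<mu> n \<eta>)"
proof (rule algebraI)
  note simps = hecke_algebra_def ring_of_type_algebra_def
  note closed = hecke_conv_in_hecke_space[OF \<mu>] hecke_space_add[OF odd \<eta> n] hecke_space_scale[OF odd \<eta> n]
    hecke_space_zero[OF odd \<eta> n]
  have one: "coset_element n \<eta> rep_I \<in> hecke_space n \<eta>"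
    using coset_element_I(1) by (simp add: is_coset_element_def)
  show "cring (ring_of_type_algebra :: complex ring)" by (rule cring_from_type_algebra)
  show "cring (hecke_algebra \<mu> n \<eta>)"
  proof (rule cringI)
    show "abelian_group (hecke_algebra \<mu> n \<eta>)"
    proof (rule abelian_groupI)
      fix f assume "f \<in> carrier (hecke_algebra \<mu> n \<eta>)"
      then show "\<exists>g\<in>carrier (hecke_algebra \<mu> n \<eta>). g \<oplus>\<^bsub>hecke_algebra \<mu> n \<eta>\<^esub> f = \<zero>\<^bsub>hecke_algebra \<mu> n \<eta>\<^esub>"
        using closed(3)[of f "-1"]
        by (intro bexI[of _ "(-1) *\<^sub>C f"]) (auto simp: simps cscale_def fun_eq_iff)
    qed (use closed in \<open>auto simp: simps add.assoc add.commute\<close>)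
    show "Group.comm_monoid (hecke_algebra \<mu> n \<eta>)"
      by (rule comm_monoidI)
        (use closed one hecke_conv_assoc[OF \<mu>] hecke_conv_commute[OF \<mu>] hecke_conv_one[OF \<mu>]
          in \<open>auto simp: simps\<close>)
  qed (auto simp: simps hecke_conv_add_left[OF \<mu>])
qed (use hecke_space_scale[OF odd \<eta> n] hecke_conv_scale_left[OF \<mu>] in \<open>auto simp: hecke_algebra_def ring_of_type_algebra_def cscale_def fun_eq_iff algebra_simps\<close>)

end

section \<open>Counting\<close>

text \<open>Integer form of \<open>unit_class_ind\<close>: the values of the elements V_r at
  \<open>low t\<close>.\<close>

definition class_ind :: "nat \<Rightarrow> nat \<Rightarrow> int \<Rightarrow> int \<Rightarrow> int" where
  "class_ind p r e t = (if int p ^ r dvd t \<and> Legendre (t div int p ^ r) (int p) = e then 1 else 0)"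

lemma sum_periodic_int:
  fixes k :: "int \<Rightarrow> 'a::comm_ring_1"
  assumes k: "\<And>u v. [u = v] (mod int p) \<Longrightarrow> k u = k v"
  shows "(\<Sum>u\<in>{0..<int p * int m}. k u) = of_nat m * (\<Sum>u\<in>{0..<int p}. k u)"
proof (induction m)
  case (Suc m)
  have "{0..<int p * int (Suc m)} = {0..<int p * int m} \<union> {int p * int m..<int p * int m + int p}"
    by (auto simp: algebra_simps) (smt (verit) zero_le_mult_iff of_nat_0_le_iff)+
  moreover have "{int p * int m..<int p * int m + int p} = (\<lambda>u. int p * int m + u) ` {0..<int p}"
    using image_add_atLeastLessThan[of "int p * int m" 0 "int p"] by (simp add: add.commute)
  moreover have "(\<Sum>u\<in>(\<lambda>u. int p * int m + u) ` {0..<int p}. k u) = (\<Sum>u\<in>{0..<int p}. k u)"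
    by (subst sum.reindex) (auto intro!: sum.cong k simp: cong_def)
  moreover have "{0..<int p * int m} \<inter> {int p * int m..<int p * int m + int p} = {}" by auto
  ultimately show ?case using Suc by (simp add: sum.union_disjoint algebra_simps)
qed simp

text \<open>Substitute s = p^r u: as r \<ge> 1, divisibility of s by p is then automatic, and u runs
  over the residues mod p^(n - r).\<close>

lemma sum_class_ind_mult:
  fixes h :: "int \<Rightarrow> int"
  assumes p: "p > 0" and r: "1 \<le> r" "r < n"
  shows "(\<Sum>s\<in>{s \<in> {0..<int p ^ n}. int p dvd s}. class_ind p r e s * h s)
    = (\<Sum>u\<in>{0..<int p ^ (n - r)}. (if Legendre u (int p) = e then h (int p ^ r * u) else 0))"
proof -
  let ?q = "int p ^ r"
  have q: "?q > 0" using p by simp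
  have nr: "int p ^ n = ?q * int p ^ (n - r)" using r by (simp flip: power_add)
  have pq: "int p dvd ?q" using r by (intro dvd_power) auto
  have "(\<Sum>s\<in>{s \<in> {0..<int p ^ n}. int p dvd s}. class_ind p r e s * h s)
      = (\<Sum>s\<in>{s \<in> {0..<int p ^ n}. ?q dvd s}. class_ind p r e s * h s)"
    by (rule sum.mono_neutral_right)
      (use pq dvd_trans in \<open>auto simp: class_ind_def intro: finite_subset[of _ "{0..<int p ^ n}"]\<close>)
  also have "{s \<in> {0..<int p ^ n}. ?q dvd s} = (\<lambda>u. ?q * u) ` {0..<int p ^ (n - r)}"
  proof -
    have "0 \<le> ?q * u \<longleftrightarrow> 0 \<le> u" "?q * u < ?q * v \<longleftrightarrow> u < v" for u v
      using mult_le_cancel_left_pos[OF q, of 0 u] mult_less_cancel_left_pos[OF q] by simp_all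
    then show ?thesis unfolding nr by (auto elim!: dvdE)
  qed
  also have "(\<Sum>s\<in>(\<lambda>u. ?q * u) ` {0..<int p ^ (n - r)}. class_ind p r e s * h s)
      = (\<Sum>u\<in>{0..<int p ^ (n - r)}. class_ind p r e (?q * u) * h (?q * u))"
    using q by (subst sum.reindex) (auto simp: inj_on_def)
  also have "\<dots> = (\<Sum>u\<in>{0..<int p ^ (n - r)}. (if Legendre u (int p) = e then h (?q * u) else 0))"
    by (rule sum.cong[OF refl]) (use q in \<open>simp add: class_ind_def\<close>)
  finally show ?thesis .
qed

lemma power_split_p: "r < n \<Longrightarrow> int p ^ (n - r) = int p * int (p ^ (n - r - 1))"
  by (cases "n - r") (simp_all flip: diff_Suc_eq_diff_pred)

text \<open>Turns an indicator into a polynomial in the symbol, so that counts become character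
  sums; the factor 2 keeps them in the integers.\<close>

lemma Legendre_ind_sign:
  assumes "e = 1 \<or> e = -1"
  shows "2 * (if Legendre u p = e then 1 else 0 :: int) = (Legendre u p)\<^sup>2 + e * Legendre u p"
  using Legendre_values[of u p] assms by auto

lemma sum_Legendre_sq:
  assumes p: "Factorial_Ring.prime (p::nat)"
  shows "(\<Sum>u\<in>{0..<int p}. (Legendre u p)\<^sup>2) = int p - 1"
proof -
  have "int p > 0" using p by (simp add: prime_gt_0_nat)
  then have "{0..<int p} = insert 0 {1..<int p}" by auto
  moreover have "(\<Sum>u\<in>{1..<int p}. (Legendre u p)\<^sup>2) = (\<Sum>u\<in>{1..<int p}. 1)"
    by (rule sum.cong[OF refl]) (simp add: Legendre_sq zdvd_not_zless)
  ultimately show ?thesis using \<open>int p > 0\<close> by (simp add: Legendre_sq)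
qed

text \<open>Each sign is the symbol of (p - 1) / 2 classes mod p, and the u below p^(n - r) meet
  each class p^(n - r - 1) times.\<close>

lemma sum_class_ind:
  fixes p :: nat
  assumes p: "Factorial_Ring.prime p" "odd p" and c: "Legendre c p = -1"
    and r: "1 \<le> r" "r < n" and e: "e = 1 \<or> e = -1"
  shows "2 * (\<Sum>s\<in>{s \<in> {0..<int p ^ n}. int p dvd s}. class_ind p r e s)
    = (int p - 1) * int p ^ (n - r - 1)"
proof -
  have p0: "p > 0" using p prime_gt_0_nat by blast
  have "(\<Sum>s\<in>{s \<in> {0..<int p ^ n}. int p dvd s}. class_ind p r e s)
      = (\<Sum>u\<in>{0..<int p ^ (n - r)}. (if Legendre u (int p) = e then 1 else 0))"
    using sum_class_ind_mult[OF p0 r, of e "\<lambda>_. 1"] by simp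
  also have "\<dots> = int (p ^ (n - r - 1)) * (\<Sum>u\<in>{0..<int p}. (if Legendre u (int p) = e then 1 else 0))"
    unfolding power_split_p[OF r(2)] by (rule sum_periodic_int[where 'a = int, unfolded of_int_of_nat_eq])
      (simp add: Legendre_cong)
  finally have "2 * (\<Sum>s\<in>{s \<in> {0..<int p ^ n}. int p dvd s}. class_ind p r e s)
      = int (p ^ (n - r - 1)) * (\<Sum>u\<in>{0..<int p}. 2 * (if Legendre u (int p) = e then 1 else 0))"
    by (simp add: mult.left_commute flip: sum_distrib_left)
  also have "(\<Sum>u\<in>{0..<int p}. 2 * (if Legendre u (int p) = e then 1 else 0 :: int)) = int p - 1"
    unfolding Legendre_ind_sign[OF e] sum.distrib sum_Legendre_sq[OF p(1)]
    by (simp add: sum_Legendre[OF p c] flip: sum_distrib_left)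
  finally show ?thesis by (simp add: mult.commute)
qed

text \<open>If p divides v, then chi(v - u) = chi(-1) chi(u), and only the sum of chi(u)^2 survives.
  Otherwise the linear terms sum to 0, the mixed term is a Jacobi sum, and the constant p is
  corrected at u = 0 and u = v, where one of the squares chi^2 is 0 instead of 1.\<close>

lemma sum_Legendre_ind_conv:
  fixes p :: nat
  assumes p: "Factorial_Ring.prime p" "odd p" and c: "Legendre c p = -1"
    and e: "e = 1 \<or> e = -1" and e': "e' = 1 \<or> e' = -1"
  shows "4 * (\<Sum>u\<in>{0..<int p}. (if Legendre u p = e then if Legendre (v - u) p = e' then 1 else 0 else 0 :: int))
    = (if int p dvd v then (int p - 1) * (1 + e * e' * Legendre (-1) p)
       else int p - 2 - (e + e') * Legendre v p - e * e' * Legendre (-1) p)"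
proof -
  have p0: "int p > 0" using p prime_gt_0_nat by simp
  have split: "4 * (if Legendre u p = e then if Legendre (v - u) p = e' then 1 else 0 else 0 :: int)
      = ((Legendre u p)\<^sup>2 + e * Legendre u p) * ((Legendre (v - u) p)\<^sup>2 + e' * Legendre (v - u) p)" for u
    unfolding Legendre_ind_sign[OF e, symmetric] Legendre_ind_sign[OF e', symmetric] by simp
  have S: "4 * (\<Sum>u\<in>{0..<int p}. (if Legendre u p = e then if Legendre (v - u) p = e' then 1 else 0 else 0 :: int))
    = (\<Sum>u\<in>{0..<int p}. ((Legendre u p)\<^sup>2 + e * Legendre u p) * ((Legendre (v - u) p)\<^sup>2 + e' * Legendre (v - u) p))"
    unfolding sum_distrib_left split ..
  show ?thesis
  proof (cases "int p dvd v")
    case True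
    have L: "Legendre (v - u) p = Legendre (-1) p * Legendre u p" for u
    proof -
      have "Legendre (v - u) p = Legendre (-1 * u) p"
        by (rule Legendre_cong) (use True in \<open>simp add: cong_iff_dvd_diff\<close>)
      then show ?thesis by (simp only: Legendre_mult[OF p])
    qed
    have i2: "(Legendre (-1) p)\<^sup>2 = 1"
      using Legendre_sq[of "-1" p] prime_gt_1_nat[OF p(1)] by (simp add: zdvd1_eq)
    have e2: "e * e = 1" "e' * e' = 1" using e e' by auto
    have "((Legendre u p)\<^sup>2 + e * Legendre u p) * ((Legendre (v - u) p)\<^sup>2 + e' * Legendre (v - u) p)
        = (1 + e * e' * Legendre (-1) p) * (Legendre u p)\<^sup>2 + (e + e' * Legendre (-1) p) * Legendre u p" for u
      unfolding L power_mult_distrib i2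
      using Legendre_values[of u p] by (auto simp: algebra_simps power2_eq_square)
    then show ?thesis
      using True unfolding S
      by (simp add: sum.distrib sum_Legendre_sq[OF p(1)] sum_Legendre[OF p c] flip: sum_distrib_left)
  next
    case False
    define w where "w = v mod int p"
    have w: "w \<in> {0..<int p}" "w \<noteq> 0" using False p0 by (auto simp: w_def dvd_eq_mod_eq_0 simp del: mod_eq_0_iff_dvd)
    have Lw: "Legendre w p = Legendre v p" by (simp add: w_def)
    have sq: "(Legendre u p)\<^sup>2 = 1 - (if u = 0 then 1 else 0)" if "u \<in> {0..<int p}" for u
      using that zdvd_not_zless[of u "int p"] by (auto simp: Legendre_sq)
    have sqv: "(Legendre (v - u) p)\<^sup>2 = 1 - (if u = w then 1 else 0)" if u: "u \<in> {0..<int p}" for u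
    proof -
      have "int p dvd v - u \<longleftrightarrow> v mod int p = u mod int p" by (simp add: mod_eq_dvd_iff)
      also have "u mod int p = u" using u by simp
      finally show ?thesis by (auto simp: Legendre_sq w_def)
    qed
    \<comment> \<open>Replacing each square by 1 overcounts at u = 0 and at u = w; these two points
      are distinct because p does not divide v.\<close>
    have "((Legendre u p)\<^sup>2 + e * Legendre u p) * ((Legendre (v - u) p)\<^sup>2 + e' * Legendre (v - u) p)
        = 1 + e' * Legendre (v - u) p + e * Legendre u p + e * e' * (Legendre u p * Legendre (v - u) p)
          - (if u = 0 then 1 + e' * Legendre v p else 0) - (if u = w then 1 + e * Legendre v p else 0)"
      if u: "u \<in> {0..<int p}" for u
    proof -
      have "Legendre (v - u) p = 0" if "u = w" using sqv[OF u] that by simp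
      moreover have "Legendre u p = 0" if "u = 0" using sq[OF u] that by simp
      ultimately show ?thesis unfolding sq[OF u] sqv[OF u] using w(2) Lw
        by (auto simp: algebra_simps)
    qed
    then have "(\<Sum>u\<in>{0..<int p}. ((Legendre u p)\<^sup>2 + e * Legendre u p) * ((Legendre (v - u) p)\<^sup>2 + e' * Legendre (v - u) p))
        = (\<Sum>u\<in>{0..<int p}. 1 + e' * Legendre (v - u) p + e * Legendre u p + e * e' * (Legendre u p * Legendre (v - u) p)
          - (if u = 0 then 1 + e' * Legendre v p else 0) - (if u = w then 1 + e * Legendre v p else 0))"
      by (rule sum.cong[OF refl])
    also have "\<dots> = int p + e * e' * (- Legendre (-1) p) - (1 + e' * Legendre v p) - (1 + e * Legendre v p)"
      using p0 w(1)
      by (simp add: sum.distrib sum_subtractf sum_Legendre[OF p c] sum_Legendre_shift[OF p c]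
          Jacobi_sum_Legendre[OF p c False] flip: sum_distrib_left)
    finally show ?thesis using False unfolding S by (simp add: algebra_simps)
  qed
qed

text \<open>With s = p^r u and t = p^r v the count mod p is repeated p^(n - r - 1) times; if p^r
  does not divide t, each summand is 0.\<close>

lemma sum_class_ind_conv:
  fixes p :: nat
  assumes p: "Factorial_Ring.prime p" "odd p" and c: "Legendre c p = -1"
    and r: "1 \<le> r" "r < n" and e: "e = 1 \<or> e = -1" and e': "e' = 1 \<or> e' = -1"
  shows "4 * (\<Sum>s\<in>{s \<in> {0..<int p ^ n}. int p dvd s}. class_ind p r e s * class_ind p r e' (t - s))
    = (if int p ^ r dvd t then int p ^ (n - r - 1) *
        (if int p dvd t div int p ^ r then (int p - 1) * (1 + e * e' * Legendre (-1) p)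
         else int p - 2 - (e + e') * Legendre (t div int p ^ r) p - e * e' * Legendre (-1) p) else 0)"
proof -
  have p0: "p > 0" using p prime_gt_0_nat by blast
  note red = sum_class_ind_mult[OF p0 r, of e "\<lambda>s. class_ind p r e' (t - s)"]
  show ?thesis
  proof (cases "int p ^ r dvd t")
    case False
    then have "class_ind p r e' (t - int p ^ r * u) = 0" for u
      by (simp add: class_ind_def dvd_diff_left_iff)
    then show ?thesis using False unfolding red by (simp cong: if_cong)
  next
    case True
    then obtain v where v: "t = int p ^ r * v" by (elim dvdE)
    have q: "int p ^ r > 0" using p0 by simp
    have "class_ind p r e' (t - int p ^ r * u) = (if Legendre (v - u) p = e' then 1 else 0)" for u
      using q unfolding v right_diff_distrib[symmetric] by (simp add: class_ind_def)
    then have "(\<Sum>s\<in>{s \<in> {0..<int p ^ n}. int p dvd s}. class_ind p r e s * class_ind p r e' (t - s))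
        = (\<Sum>u\<in>{0..<int p * int (p ^ (n - r - 1))}.
            (if Legendre u p = e then if Legendre (v - u) p = e' then 1 else 0 else 0))"
      unfolding red power_split_p[OF r(2)] by (simp only:)
    also have "\<dots> = int (p ^ (n - r - 1)) * (\<Sum>u\<in>{0..<int p}.
            (if Legendre u p = e then if Legendre (v - u) p = e' then 1 else 0 else 0))"
    proof -
      have "(if Legendre x p = e then if Legendre (v - x) p = e' then 1 else 0 else 0 :: int)
          = (if Legendre y p = e then if Legendre (v - y) p = e' then 1 else 0 else 0)" if "[x = y] (mod int p)" for x y
        using Legendre_cong[OF that] Legendre_cong[OF cong_diff[OF cong_refl that], of v] by simp
      then show ?thesis
        using sum_periodic_int[where p = p and m = "p ^ (n - r - 1)" and
            k = "\<lambda>u. if Legendre u p = e then if Legendre (v - u) p = e' then 1 else 0 else 0 :: int"]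
        by simp
    qed
    finally show ?thesis
      using sum_Legendre_ind_conv[OF p c e e', of v] True q by (simp add: v)
  qed
qed

text \<open>Subtracting a multiple of p^j with j > r does not affect membership of t in a class of
  order r. So V_j acts on V_r through its total mass.\<close>

lemma sum_class_ind_mixed:
  fixes p :: nat
  assumes p: "Factorial_Ring.prime p" and r: "r < j"
  shows "(\<Sum>s\<in>S. class_ind p j e s * class_ind p r e' (t - s)) = class_ind p r e' t * (\<Sum>s\<in>S. class_ind p j e s)"
proof -
  have p0: "int p > 0" using p prime_gt_0_nat by simp
  have q: "int p ^ r \<noteq> 0" using p0 by simp
  have "class_ind p j e s * class_ind p r e' (t - s) = class_ind p r e' t * class_ind p j e s" for s
  proof (cases "int p ^ j dvd s")
    case True
    obtain i where i: "j = r + Suc i" using r less_imp_Suc_add by auto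
    obtain u where "s = int p ^ j * u" using True by (elim dvdE)
    then have s: "s = int p ^ r * (int p * (int p ^ i * u))" by (simp add: i power_add ac_simps)
    have "class_ind p r e' (t - s) = class_ind p r e' t"
    proof (cases "int p ^ r dvd t")
      case True
      then obtain v where v: "t = int p ^ r * v" by (elim dvdE)
      have "Legendre (v - int p * (int p ^ i * u)) p = Legendre v p"
        by (rule Legendre_cong) (simp add: cong_iff_dvd_diff)
      moreover have "t - s = int p ^ r * (v - int p * (int p ^ i * u))" by (simp add: v s right_diff_distrib)
      ultimately show ?thesis using q by (simp add: class_ind_def v)
    next
      case False
      then show ?thesis by (simp add: class_ind_def s dvd_diff_left_iff)
    qed
    then show ?thesis by simp
  qed (simp add: class_ind_def)
  then show ?thesis by (simp only: sum_distrib_left)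
qed

text \<open>For t divisible by p^r the symbol of t / p^r is 0 exactly when p^(r + 1) divides t. The
  difference form makes the sum in Y_r telescope.\<close>

lemma class_ind_signs:
  fixes p :: nat
  assumes p: "Factorial_Ring.prime p"
  shows "class_ind p r 1 t + class_ind p r (-1) t
    = (if int p ^ r dvd t then 1 else 0) - (if int p ^ Suc r dvd t then 1 else 0)"
proof (cases "int p ^ r dvd t")
  case True
  have q: "int p ^ r \<noteq> 0" using p prime_gt_0_nat by simp
  obtain v where v: "t = int p ^ r * v" using True by (elim dvdE)
  have "int p ^ Suc r dvd t \<longleftrightarrow> int p dvd v"
    unfolding v power_Suc2 using q by (simp only: dvd_mult_cancel_left) simp
  then show ?thesis
    using q Legendre_values[of v p] Legendre_eq_0_iff[of v p] by (auto simp: class_ind_def v)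
next
  case False
  then have "\<not> int p ^ Suc r dvd t" by (metis dvd_mult_right power_Suc)
  then show ?thesis using False by (simp add: class_ind_def)
qed

section \<open>Bases dual to evaluation points\<close>

lemma sum_fun_eval: "(\<Sum>y\<in>P. g y) x = (\<Sum>y\<in>P. g y x)" for g :: "'b \<Rightarrow> 'a \<Rightarrow> complex"
  by (induction P rule: infinite_finite_induct) auto

text \<open>Evaluation at x in P reads off the coefficient of \<open>b x\<close>, which gives
  independence; f minus the combination with coefficients f y vanishes on P and hence is 0, which
  gives spanning.\<close>

lemma dual_basis_functions:
  fixes b :: "'a \<Rightarrow> 'a \<Rightarrow> complex"
  assumes P: "finite P" and S: "cfun.subspace S" and b: "\<And>y. y \<in> P \<Longrightarrow> b y \<in> S"
    and dual: "\<And>x y. x \<in> P \<Longrightarrow> y \<in> P \<Longrightarrow> b y x = (if x = y then 1 else 0)"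
    and vanish: "\<And>f. f \<in> S \<Longrightarrow> (\<And>x. x \<in> P \<Longrightarrow> f x = 0) \<Longrightarrow> f = 0"
  shows "inj_on b P" "cfun.independent (b ` P)" "cfun.span (b ` P) = S"
proof -
  show inj: "inj_on b P"
  proof
    fix x y assume "x \<in> P" "y \<in> P" "b x = b y"
    then show "x = y" using dual[of x x] dual[of x y] by (simp split: if_splits)
  qed
  have eval: "(\<Sum>y\<in>P. u y *\<^sub>C b y) x = u x" if "x \<in> P" for u x
  proof -
    have "(\<Sum>y\<in>P. u y *\<^sub>C b y) x = (\<Sum>y\<in>P. if x = y then u y else 0)"
      unfolding sum_fun_eval by (rule sum.cong[OF refl]) (simp add: cscale_def dual that)
    then show ?thesis using P that by simp
  qed
  show "cfun.independent (b ` P)"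
  proof (rule notI)
    assume "cfun.dependent (b ` P)"
    then obtain u where u: "\<exists>v\<in>b ` P. u v \<noteq> 0" "(\<Sum>v\<in>b ` P. u v *\<^sub>C v) = 0"
      using cfun.dependent_finite[of "b ` P"] P by auto
    then obtain x where x: "x \<in> P" "u (b x) \<noteq> 0" by auto
    have "(\<Sum>y\<in>P. u (b y) *\<^sub>C b y) = 0" using u(2) inj by (simp add: sum.reindex)
    then show False using eval[OF x(1), of "\<lambda>y. u (b y)"] x(2) by simp
  qed
  show "cfun.span (b ` P) = S"
  proof
    show "cfun.span (b ` P) \<subseteq> S" using b S by (intro cfun.span_minimal) auto
    show "S \<subseteq> cfun.span (b ` P)"
    proof
      fix f assume f: "f \<in> S"
      define g where "g = (\<Sum>y\<in>P. f y *\<^sub>C b y)"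
      have g: "g \<in> cfun.span (b ` P)"
        unfolding g_def by (intro cfun.span_sum cfun.span_scale cfun.span_base) auto
      have "g \<in> S" unfolding g_def by (intro cfun.subspace_sum[OF S] cfun.subspace_scale[OF S] b)
      then have "f - g \<in> S" using f cfun.subspace_diff[OF S] by blast
      then have "f - g = 0" by (rule vanish) (simp add: g_def eval)
      then show "f \<in> cfun.span (b ` P)" using g by simp
    qed
  qed
qed

section \<open>The basis of double cosets\<close>

definition coset_reps :: "nat \<Rightarrow> 'p::prime_card padic_int \<Rightarrow> 'p mp2 set" where
  "coset_reps n lam = {rep_I, rep_U} \<union> (\<Union>i\<in>{1..<n}. {rep_V i 1, rep_V i lam})"

lemma finite_coset_reps: "finite (coset_reps n lam)"
  by (simp add: coset_reps_def)

lemma coset_reps_cases: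
  assumes "x \<in> coset_reps n lam"
  obtains "x = rep_I" | "x = rep_U" | r \<delta> where "x = rep_V r \<delta>" "r \<in> {1..<n}" "\<delta> \<in> {1, lam}"
  using assms unfolding coset_reps_def by blast

lemma rep_V_eq_iff:
  fixes \<delta> \<epsilon> :: "'p::prime_card padic_int"
  assumes "\<delta> dvd 1" "\<epsilon> dvd 1"
  shows "rep_V r \<delta> = rep_V j \<epsilon> \<longleftrightarrow> r = j \<and> \<delta> = \<epsilon>"
proof
  assume "rep_V r \<delta> = rep_V j \<epsilon>"
  then have "of_nat CARD('p) ^ r * \<delta> = of_nat CARD('p) ^ j * \<epsilon>"
    by (simp add: rep_V_eq mult.commute)
  then show "r = j \<and> \<delta> = \<epsilon>" using p_power_mult_unit_inj[OF _ assms] by blast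
qed simp

lemma rep_distinct:
  fixes \<delta> :: "'p::prime_card padic_int"
  shows "(rep_I :: 'p mp2) \<noteq> rep_U" "rep_U \<noteq> rep_V r \<delta>" "\<delta> dvd 1 \<Longrightarrow> rep_I \<noteq> rep_V r \<delta>"
  using p_nonzero[where 'p = 'p] by (auto simp: rep_I_def rep_U_eq rep_V_eq upw_def mat_1_zmat)

lemma card_coset_reps:
  fixes lam :: "'p::prime_card padic_int"
  assumes lam: "lam dvd 1" "lam \<noteq> 1" and n: "n > 0"
  shows "card (coset_reps n lam) = 2 * n"
proof -
  define W where "W = (\<lambda>(r, \<delta>). rep_V r \<delta>) ` ({1..<n} \<times> {1, lam})"
  have "inj_on (\<lambda>(r, \<delta>). rep_V r \<delta>) ({1..<n} \<times> {1, lam})"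
    using lam by (auto simp: inj_on_def rep_V_eq_iff)
  then have cW: "card W = (n - 1) * 2"
    unfolding W_def using lam by (simp add: card_image card_cartesian_product)
  have "coset_reps n lam = insert rep_I (insert rep_U W)"
    unfolding coset_reps_def W_def Sigma_def image_UN by auto
  moreover have "finite W" by (simp add: W_def)
  moreover have "rep_I \<notin> W" "rep_U \<notin> W" using rep_distinct lam by (auto simp: W_def)
  ultimately have "card (coset_reps n lam) = Suc (Suc (card W))"
    using rep_distinct(1)[where 'p = 'p] by simp
  then show ?thesis using cW n by simp
qed

lemma unit_class_ind_p_power:
  fixes \<epsilon> :: "'p::prime_card padic_int"
  assumes "\<epsilon> dvd 1" "e = 1 \<or> e = -1"
  shows "unit_class_ind r e (\<epsilon> * of_nat CARD('p) ^ j) = (if r = j \<and> leg \<epsilon> = e then 1 else 0)"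
proof -
  have "(\<exists>v. \<epsilon> * of_nat CARD('p) ^ j = of_nat CARD('p) ^ r * v \<and> leg v = e) \<longleftrightarrow> r = j \<and> leg \<epsilon> = e"
  proof
    assume "\<exists>v. \<epsilon> * of_nat CARD('p) ^ j = of_nat CARD('p) ^ r * v \<and> leg v = e"
    then obtain v where v: "of_nat CARD('p) ^ j * \<epsilon> = of_nat CARD('p) ^ r * v" "leg v = e"
      by (auto simp: mult.commute)
    then have "\<not> of_nat CARD('p) dvd v" using assms(2) leg_eq_0_iff[of v] by auto
    then have "v dvd 1" by (simp add: padic_unit_iff)
    then show "r = j \<and> leg \<epsilon> = e" using p_power_mult_unit_inj[OF v(1) assms(1)] v(2) by auto
  qed (auto intro!: exI[of _ \<epsilon>] simp: mult.commute)
  then show ?thesis by (simp add: unit_class_ind_def)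
qed

text \<open>Order and square class separate the representatives, which can therefore serve as the
  evaluation points of \<open>dual_basis_functions\<close>.\<close>

lemma coset_element_dual:
  fixes \<eta> :: "'p::prime_card padic_int \<Rightarrow> complex"
  assumes odd: "odd CARD('p)" and \<eta>: "quadratic_char \<eta>" and n: "n > 0"
    and lam: "lam dvd 1" "leg lam = -1"
    and x: "x \<in> coset_reps n lam" and y: "y \<in> coset_reps n lam"
  shows "coset_element n \<eta> y x = (if x = y then 1 else 0)"
proof -
  note [simp] = rep_distinct rep_distinct[symmetric]
  have pd: "of_nat CARD('p) dvd \<epsilon> * (of_nat CARD('p) :: 'p padic_int) ^ j" if "j \<in> {1..<n}" for j \<epsilon>
    using that by (intro dvd_mult dvd_power) auto
  have I: "(rep_I :: 'p mp2) = (low 0, 1)" by (simp add: rep_I_def low_0)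
  have unit: "\<delta> dvd 1" if "\<delta> \<in> {1, lam}" for \<delta> using that lam by auto
  have sgn: "leg \<delta> = 1 \<or> leg \<delta> = -1" if "\<delta> \<in> {1, lam}" for \<delta> using that lam by auto
  have leg_inj: "leg \<delta> = leg \<epsilon> \<longleftrightarrow> \<delta> = \<epsilon>" if "\<delta> \<in> {1, lam}" "\<epsilon> \<in> {1, lam}" for \<delta> \<epsilon>
    using that lam by auto
  note V = genuine_cell_fun_lower[OF odd \<eta> n pd]
  note elem = coset_element_I(2)[OF odd \<eta> n] coset_element_U(2)[OF odd \<eta> n]
  have zero: "\<not> of_nat CARD('p) ^ n dvd \<epsilon> * (of_nat CARD('p) :: 'p padic_int) ^ j"
    if j: "j \<in> {1..<n}" and \<epsilon>: "\<epsilon> dvd 1" for j \<epsilon>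
  proof
    assume "of_nat CARD('p) ^ n dvd \<epsilon> * (of_nat CARD('p) :: 'p padic_int) ^ j"
    then have "(of_nat CARD('p) :: 'p padic_int) ^ n dvd of_nat CARD('p) ^ j"
      using dvd_mult_unit_iff'[OF \<epsilon>] by blast
    then have "int CARD('p) ^ n dvd int CARD('p) ^ j"
      using p_power_dvd_of_int[where 'p = 'p and k = n and m = "int CARD('p) ^ j"] by simp
    then have "int CARD('p) ^ n \<le> int CARD('p) ^ j" by (intro zdvd_imp_le) simp_all
    then show False using j prime_gt_1_nat[OF prime_p[where 'p = 'p]] by simp
  qed
  show ?thesis
    using y
  proof (cases rule: coset_reps_cases)
    case y: 1
    show ?thesis using x
    proof (cases rule: coset_reps_cases)
      case 1
      then show ?thesis using y coset_element_I(1)[OF odd \<eta> n] by (simp add: is_coset_element_def)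
    next
      case 2
      then show ?thesis using y by (simp add: rep_U_eq[symmetric]) (simp add: rep_U_eq coset_element_upw[OF odd \<eta> n])
    next
      case (3 r \<delta>)
      then show ?thesis using y unit[OF 3(3)] zero[OF 3(2) unit[OF 3(3)]]
        by (simp add: elem V rep_V_eq[of r \<delta>] zero_class_ind_def) (simp add: rep_V_eq[symmetric])
    qed
  next
    case y: 2
    show ?thesis using x
    proof (cases rule: coset_reps_cases)
      case 1
      then show ?thesis using y coset_element_U_low[OF odd \<eta> n, of 0] I by simp
    next
      case 2
      then show ?thesis using y coset_element_U(1)[OF odd \<eta> n] by (simp add: is_coset_element_def)
    next
      case (3 r \<delta>)
      then show ?thesis using y by (simp add: elem V rep_V_eq[of r \<delta>]) (simp add: rep_V_eq[symmetric])
    qed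
  next
    case y: (3 r \<delta>)
    note Vel = coset_element_V[OF odd \<eta> n y(2) unit[OF y(3)]]
    show ?thesis using x
    proof (cases rule: coset_reps_cases)
      case 1
      have "coset_element n \<eta> (rep_V r \<delta>) (low 0, 1) = 0"
        using coset_element_V_low[OF odd \<eta> n y(2) unit[OF y(3)], of 0] sgn[OF y(3)]
          Legendre_eq_0_iff[of 0 "int CARD('p)"] by auto
      then show ?thesis using 1 y unit[OF y(3)] I by simp
    next
      case 2
      have "coset_element n \<eta> (rep_V r \<delta>) rep_U = 0"
        using coset_element_upw(3)[OF odd \<eta> n y(2) unit[OF y(3)]] by (simp add: rep_U_eq)
      then show ?thesis using 2 y by simp
    next
      case (3 j \<epsilon>)
      have "coset_element n \<eta> (rep_V r \<delta>) (rep_V j \<epsilon>) = unit_class_ind r (leg \<delta>) (\<epsilon> * of_nat CARD('p) ^ j)"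
        unfolding Vel(2) rep_V_eq[of j \<epsilon>] by (rule V[OF 3(2)])
      then show ?thesis
        using 3 y unit_class_ind_p_power[OF unit[OF 3(3)] sgn[OF y(3)], of r j] leg_inj[OF 3(3) y(3)]
          rep_V_eq_iff[OF unit[OF 3(3)] unit[OF y(3)], of j r] by auto
    qed
  qed
qed

section \<open>The Weyl coefficient for the two characters\<close>

lemma unit_sum_trivial:
  assumes odd: "odd CARD('p::prime_card)" and n: "n > 0"
  shows "unit_sum (\<lambda>_ :: 'p padic_int. 1) n = of_nat CARD('p) ^ (n - 1) * (of_nat CARD('p) - 1)"
proof -
  have qc: "quadratic_char (\<lambda>_ :: 'p padic_int. 1)" by (simp add: quadratic_char_def)
  have "of_nat CARD('p) ^ n = (\<Sum>s\<in>{0..<int CARD('p) ^ n}. 1 :: complex)"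
    by (simp add: nat_power_eq)
  also have "\<dots> = of_nat (card (p_residues_below TYPE('p) n)) + unit_sum (\<lambda>_ :: 'p padic_int. 1) n"
    unfolding sum_residues_split[OF odd qc n] unit_sum_def[OF odd qc n] by simp
  also have "of_nat (card (p_residues_below TYPE('p) n)) = (of_nat CARD('p) ^ (n - 1) :: complex)"
    using card_p_residues_below[OF odd qc n] by (metis of_int_of_nat_eq of_int_power)
  finally have "unit_sum (\<lambda>_ :: 'p padic_int. 1) n = of_nat CARD('p) ^ n - of_nat CARD('p) ^ (n - 1)"
    by (simp add: algebra_simps)
  also have "(of_nat CARD('p) ^ n :: complex) = of_nat CARD('p) * of_nat CARD('p) ^ (n - 1)"
    using n by (cases n) auto
  finally show ?thesis by (simp add: algebra_simps)
qed

text \<open>The symbol vanishes on multiples of p, so the sum over units extends to p^(n - 1)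
  complete periods, each of sum 0.\<close>

lemma unit_sum_legendre:
  assumes odd: "odd CARD('p::prime_card)" and n: "n > 0" and c: "Legendre c (int CARD('p)) = -1"
  shows "unit_sum (legendre_char :: 'p padic_int \<Rightarrow> complex) n = 0"
proof -
  have qc: "quadratic_char (legendre_char :: 'p padic_int \<Rightarrow> complex)" by (simp add: quadratic_char_def)
  have l: "legendre_char (- of_int s :: 'p padic_int) = of_int (Legendre (0 - s) (int CARD('p)))" for s
    using leg_of_int[of "- s", where 'p = 'p] by (simp add: legendre_char_leg)
  have "unit_sum (legendre_char :: 'p padic_int \<Rightarrow> complex) n
      = of_int (\<Sum>s\<in>{s \<in> {0..<int CARD('p) ^ n}. \<not> int CARD('p) dvd s}. Legendre (0 - s) (int CARD('p)))"
    unfolding unit_sum_def[OF odd qc n] l by simp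
  also have "(\<Sum>s\<in>{s \<in> {0..<int CARD('p) ^ n}. \<not> int CARD('p) dvd s}. Legendre (0 - s) (int CARD('p)))
      = (\<Sum>s\<in>{0..<int CARD('p) * int (CARD('p) ^ (n - 1))}. Legendre (0 - s) (int CARD('p)))"
  proof (rule sum.mono_neutral_left)
    have "int CARD('p) ^ n = int CARD('p) * int (CARD('p) ^ (n - 1))" using n by (cases n) auto
    then show "{s \<in> {0..<int CARD('p) ^ n}. \<not> int CARD('p) dvd s} \<subseteq> {0..<int CARD('p) * int (CARD('p) ^ (n - 1))}"
      "\<forall>i\<in>{0..<int CARD('p) * int (CARD('p) ^ (n - 1))} - {s \<in> {0..<int CARD('p) ^ n}. \<not> int CARD('p) dvd s}.
         Legendre (0 - i) (int CARD('p)) = 0"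
      by (auto simp: Legendre_eq_0_iff)
  qed simp
  also have "\<dots> = of_nat (CARD('p) ^ (n - 1)) * (\<Sum>s\<in>{0..<int CARD('p)}. Legendre (0 - s) (int CARD('p)))"
  proof (rule sum_periodic_int)
    fix u v assume "[u = v] (mod int CARD('p))"
    then show "Legendre (0 - u) (int CARD('p)) = Legendre (0 - v) (int CARD('p))"
      by (intro Legendre_cong cong_diff cong_refl)
  qed
  also have "(\<Sum>s\<in>{0..<int CARD('p)}. Legendre (0 - s) (int CARD('p))) = 0"
    by (rule sum_Legendre_shift[OF prime_p odd c])
  finally show ?thesis by simp
qed

section \<open>Basis and multiplication table\<close>

theorem theorem1:
  fixes p n :: nat
    and \<eta> :: "'p::prime_card padic_int \<Rightarrow> complex"
    and lam :: "'p padic_int"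
    and \<mu> :: "'p mp2 measure"
    and conv :: "('p mp2 \<Rightarrow> complex) \<Rightarrow> ('p mp2 \<Rightarrow> complex) \<Rightarrow> 'p mp2 \<Rightarrow> complex"  (infixl "\<star>" 76)
    and I U0 :: "'p mp2 \<Rightarrow> complex"
    and V :: "nat \<Rightarrow> 'p padic_int \<Rightarrow> 'p mp2 \<Rightarrow> complex"
    and VV Y :: "nat \<Rightarrow> 'p mp2 \<Rightarrow> complex"
    and B :: "('p mp2 \<Rightarrow> complex) set"
  assumes p: "p = CARD('p)" "odd p"
    and n: "n \<ge> 2"
    and \<eta>: "\<eta> = (\<lambda>_. 1) \<or> \<eta> = legendre_char"
    and lam: "lam dvd 1" "legendre_char lam = -1"
    and \<mu>: "left_haar_measure Mp2 Mp2_topology \<mu>" "emeasure \<mu> (cover_preimage (K0 n)) = 1"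
  defines "conv \<equiv> hecke_conv \<mu>"
    and "I \<equiv> coset_element n \<eta> rep_I"
    and "U0 \<equiv> coset_element n \<eta> rep_U"
    and "V \<equiv> \<lambda>r a. coset_element n \<eta> (rep_V r a)"
    and "VV \<equiv> \<lambda>j. V j 1 + V j lam"
    and "Y \<equiv> \<lambda>r. I + (\<Sum>j\<in>{r..<n}. VV j)"
    and "B \<equiv> {I, U0} \<union> (\<Union>i\<in>{1..<n}. {V i 1, V i lam})"
  shows
    "(is_coset_element n \<eta> rep_I I \<and> is_coset_element n \<eta> rep_U U0 \<and>
      (\<forall>r\<in>{1..<n}. \<forall>\<delta>\<in>{1, lam}. is_coset_element n \<eta> (rep_V r \<delta>) (V r \<delta>))) \<and>
     Module.algebra (ring_of_type_algebra :: complex ring) (hecke_algebra \<mu> n \<eta>) \<and>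
     cfun.subspace (hecke_space n \<eta>) \<and> cfun.dim (hecke_space n \<eta>) = 2 * n \<and>
     card B = 2 * n \<and> cfun.independent B \<and> cfun.span B = hecke_space n \<eta> \<and>
     (\<forall>r\<in>{1..<n}. p mod 4 = 1 \<longrightarrow>
       V r 1 \<star> V r 1 = ((of_nat p - 1) / 2 * of_nat p ^ (n - r - 1)) *\<^sub>C Y (r + 1)
         + ((of_nat p - 5) / 4 * of_nat p ^ (n - r - 1)) *\<^sub>C V r 1
         + ((of_nat p - 1) / 4 * of_nat p ^ (n - r - 1)) *\<^sub>C V r lam \<and>
       V r lam \<star> V r lam = ((of_nat p - 1) / 2 * of_nat p ^ (n - r - 1)) *\<^sub>C Y (r + 1)
         + ((of_nat p - 1) / 4 * of_nat p ^ (n - r - 1)) *\<^sub>C V r 1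
         + ((of_nat p - 5) / 4 * of_nat p ^ (n - r - 1)) *\<^sub>C V r lam \<and>
       V r 1 \<star> V r lam = V r lam \<star> V r 1 \<and>
       V r lam \<star> V r 1 = ((of_nat p - 1) / 4 * of_nat p ^ (n - r - 1)) *\<^sub>C (V r 1 + V r lam)) \<and>
     (\<forall>r\<in>{1..<n}. p mod 4 = 3 \<longrightarrow>
       V r 1 \<star> V r 1 = ((of_nat p - 3) / 4 * of_nat p ^ (n - r - 1)) *\<^sub>C V r 1
         + ((of_nat p + 1) / 4 * of_nat p ^ (n - r - 1)) *\<^sub>C V r lam \<and>
       V r lam \<star> V r lam = ((of_nat p + 1) / 4 * of_nat p ^ (n - r - 1)) *\<^sub>C V r 1
         + ((of_nat p - 3) / 4 * of_nat p ^ (n - r - 1)) *\<^sub>C V r lam \<and>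
       V r 1 \<star> V r lam = V r lam \<star> V r 1 \<and>
       V r lam \<star> V r 1 = ((of_nat p - 1) / 2 * of_nat p ^ (n - r - 1)) *\<^sub>C Y (r + 1)
         + ((of_nat p - 3) / 4 * of_nat p ^ (n - r - 1)) *\<^sub>C (V r 1 + V r lam)) \<and>
     (\<forall>r j. 1 \<le> r \<and> r < j \<and> j \<le> n - 1 \<longrightarrow> (\<forall>\<nu>\<in>{1, lam}. \<forall>\<delta>\<in>{1, lam}.
       V r \<nu> \<star> V j \<delta> = V j \<delta> \<star> V r \<nu> \<and>
       V j \<delta> \<star> V r \<nu> = ((of_nat p - 1) / 2 * of_nat p ^ (n - j - 1)) *\<^sub>C V r \<nu>)) \<and>
     (\<eta> = (\<lambda>_. 1) \<longrightarrow>
       U0 \<star> U0 = (of_nat p ^ n) *\<^sub>C Y 1 + (of_nat p ^ (n - 1) * (of_nat p - 1)) *\<^sub>C U0) \<and>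
     (\<eta> \<noteq> (\<lambda>_. 1) \<longrightarrow> U0 \<star> U0 = (\<eta> (-1) * of_nat p ^ n) *\<^sub>C Y 1) \<and>
     (\<forall>r\<in>{1..<n}. \<forall>\<delta>\<in>{1, lam}.
       U0 \<star> V r \<delta> = V r \<delta> \<star> U0 \<and>
       V r \<delta> \<star> U0 = ((of_nat p - 1) / 2 * of_nat p ^ (n - r - 1)) *\<^sub>C U0)"
proof -
  have odd: "odd CARD('p)" using p by simp
  have qc: "quadratic_char \<eta>" using \<eta> by (simp add: quadratic_char_def)
  have n0: "n > 0" using n by simp
  have pr: "Factorial_Ring.prime p" using p prime_p[where 'p = 'p] by simp
  have ll: "leg lam = -1" using lam(2) by (simp add: legendre_char_leg) (metis of_int_eq_iff of_int_1 of_int_minus)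
  \<comment> \<open>The residue of \<open>lam\<close> supplies the integer nonresidue on which the
    Legendre sums rely.\<close>
  define c where "c = padic_coord lam 1"
  have c: "Legendre c (int p) = -1" using ll by (simp add: c_def leg_def p)
  have unit: "\<delta> dvd 1" and sgn: "leg \<delta> = 1 \<or> leg \<delta> = -1" if "\<delta> \<in> {1, lam}" for \<delta>
    using that lam ll by auto
  let ?H = "hecke_space n \<eta>"
  define S where "S = {s \<in> {0..<int p ^ n}. int p dvd s}"
  have S: "p_residues_below TYPE('p) n = S" by (simp add: S_def p_residues_below_def p)
  have Sp: "int p dvd t" if "t \<in> S" for t using that by (simp add: S_def)
  have sub: "cfun.subspace ?H" by (rule subspace_hecke_space[OF odd qc n0])
  note add = hecke_space_add[OF odd qc n0] and scale = hecke_space_scale[OF odd qc n0]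
  have ce: "is_coset_element n \<eta> rep_I I" "is_coset_element n \<eta> rep_U U0"
    "\<And>r \<delta>. r \<in> {1..<n} \<Longrightarrow> \<delta> \<in> {1, lam} \<Longrightarrow> is_coset_element n \<eta> (rep_V r \<delta>) (V r \<delta>)"
    unfolding I_def U0_def V_def
    by (rule coset_element_I(1)[OF odd qc n0] coset_element_U(1)[OF odd qc n0]
        coset_element_V(1)[OF odd qc n0 _ unit]; assumption)+
  then have IH: "I \<in> ?H" and UH: "U0 \<in> ?H" and VH: "\<And>r \<delta>. r \<in> {1..<n} \<Longrightarrow> \<delta> \<in> {1, lam} \<Longrightarrow> V r \<delta> \<in> ?H"
    by (simp_all add: is_coset_element_def)
  have YH: "Y r \<in> ?H" if "1 \<le> r" for r
    unfolding Y_def VV_def using that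
    by (intro add IH cfun.subspace_sum[OF sub] VH) auto
  have Iw: "I (upw 0, 1) = 0" and Uw: "U0 (upw 0, 1) = 1"
    and Vw: "\<And>r \<delta>. r \<in> {1..<n} \<Longrightarrow> \<delta> \<in> {1, lam} \<Longrightarrow> V r \<delta> (upw 0, 1) = 0"
    unfolding I_def U0_def V_def using coset_element_upw[OF odd qc n0] unit by auto
  have Il: "I (low t, 1) = (if int p ^ n dvd t then 1 else 0)" if "int p dvd t" for t
    unfolding I_def using coset_element_I_low[OF odd qc n0] that by (simp add: p)
  have Ul: "U0 (low t, 1) = 0" if "int p dvd t" for t
    unfolding U0_def using coset_element_U_low[OF odd qc n0] that by (simp add: p)
  have Vl: "V r \<delta> (low t, 1) = of_int (class_ind p r (leg \<delta>) t)"
    if "r \<in> {1..<n}" "\<delta> \<in> {1, lam}" "int p dvd t" for r \<delta> t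
    unfolding V_def using coset_element_V_low[OF odd qc n0 that(1) unit[OF that(2)]] that(3)
    by (simp add: class_ind_def p)
  have Yw: "Y r (upw 0, 1) = 0" if "1 \<le> r" for r
    unfolding Y_def VV_def using that by (simp add: sum_fun_eval Iw Vw)
  \<comment> \<open>The two classes of order j add up to the difference of the indicators of p^j and
    p^(j + 1), so the sum telescopes and \<open>I\<close> cancels its last term. The case r = n, an
    empty sum, is needed for \<open>Y (r + 1)\<close> at r = n - 1.\<close>
  have Yl: "Y r (low t, 1) = (if int p ^ r dvd t then 1 else 0)" if r: "1 \<le> r" "r \<le> n" and t: "int p dvd t" for r t
  proof -
    define g where "g j = (if int p ^ j dvd t then 1 else 0 :: complex)" for j
    have "VV j (low t, 1) = - (g (Suc j) - g j)" if j: "j \<in> {r..<n}" for j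
    proof -
      have jn: "j \<in> {1..<n}" using j r by auto
      have "VV j (low t, 1) = of_int (class_ind p j 1 t + class_ind p j (-1) t)"
        using Vl[OF jn _ t, of 1] Vl[OF jn _ t, of lam] ll by (simp add: VV_def)
      then show ?thesis unfolding class_ind_signs[OF pr] by (simp add: g_def)
    qed
    then have "(\<Sum>j\<in>{r..<n}. VV j (low t, 1)) = - (\<Sum>j\<in>{r..<n}. g (Suc j) - g j)"
      by (simp add: sum_negf[symmetric])
    also have "\<dots> = g r - g n" using sum_Suc_diff'[OF r(2), of g] by simp
    finally have "Y r (low t, 1) = g r"
      unfolding Y_def using Il[OF t] by (simp add: sum_fun_eval g_def)
    then show ?thesis by (simp add: g_def)
  qed
  have eqI: "f = g" if "f \<in> ?H" "g \<in> ?H" "f (upw 0, 1) = g (upw 0, 1)"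
    "\<And>t. t \<in> S \<Longrightarrow> f (low t, 1) = g (low t, 1)" for f g
    by (rule hecke_space_eqI_low[OF odd qc n0 that(1,2,3)]) (simp add: S that(4))
  have convH: "f \<star> g \<in> ?H" if "f \<in> ?H" "g \<in> ?H" for f g
    unfolding conv_def by (rule hecke_conv_in_hecke_space[OF odd qc n0 \<mu> that])
  have comm: "f \<star> g = g \<star> f" if "f \<in> ?H" "g \<in> ?H" for f g
    unfolding conv_def by (rule hecke_conv_commute[OF odd qc n0 \<mu> that])
  have convl: "(f \<star> g) (low t, 1) = (\<Sum>s\<in>S. f (low s, 1) * g (low (t - s), 1))
      + \<eta> (-1) * of_nat p ^ n * f (upw 0, 1) * g (upw 0, 1)" if "f \<in> ?H" "g \<in> ?H" "t \<in> S" for f g t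
    unfolding conv_def using hecke_conv_low[OF odd qc n0 \<mu> that(1,2), of t] Sp[OF that(3)]
    by (simp only: S p)
  have convw: "(f \<star> g) (upw 0, 1) = f (upw 0, 1) * (\<Sum>s\<in>S. g (low s, 1)) + g (upw 0, 1) * (\<Sum>s\<in>S. f (low s, 1))
      + unit_sum \<eta> n * f (upw 0, 1) * g (upw 0, 1)" if "f \<in> ?H" "g \<in> ?H" for f g
    unfolding conv_def using hecke_conv_upw[OF odd qc n0 \<mu> that] by (simp only: S)
  have sumV: "(\<Sum>s\<in>S. V r \<delta> (low s, 1)) = (of_nat p - 1) / 2 * of_nat p ^ (n - r - 1)"
    if r: "r \<in> {1..<n}" and \<delta>: "\<delta> \<in> {1, lam}" for r \<delta>
  proof -
    have "2 * (\<Sum>s\<in>S. V r \<delta> (low s, 1)) = of_int (2 * (\<Sum>s\<in>S. class_ind p r (leg \<delta>) s))"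
      by (simp add: Vl[OF r \<delta>] Sp)
    also have "\<dots> = of_int ((int p - 1) * int p ^ (n - r - 1))"
      unfolding S_def using sum_class_ind[OF pr p(2) c _ _ sgn[OF \<delta>], of r n] r by simp
    finally show ?thesis by (simp add: field_simps)
  qed
  have convVV: "(V j \<delta> \<star> V r \<nu>) (low t, 1) = of_int (\<Sum>s\<in>S. class_ind p j (leg \<delta>) s * class_ind p r (leg \<nu>) (t - s))"
    if r: "r \<in> {1..<n}" and j: "j \<in> {1..<n}" and \<delta>: "\<delta> \<in> {1, lam}" and \<nu>: "\<nu> \<in> {1, lam}" and t: "t \<in> S"
    for r j \<delta> \<nu> t
  proof -
    have "(V j \<delta> \<star> V r \<nu>) (low t, 1) = (\<Sum>s\<in>S. V j \<delta> (low s, 1) * V r \<nu> (low (t - s), 1))"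
      by (simp add: convl[OF VH[OF j \<delta>] VH[OF r \<nu>] t] Vw[OF j \<delta>])
    also have "\<dots> = (\<Sum>s\<in>S. of_int (class_ind p j (leg \<delta>) s * class_ind p r (leg \<nu>) (t - s)))"
      by (rule sum.cong[OF refl]) (simp add: Vl[OF j \<delta>] Vl[OF r \<nu>] Sp t)
    finally show ?thesis by simp
  qed
  have convVVw: "(V j \<delta> \<star> V r \<nu>) (upw 0, 1) = 0"
    if r: "r \<in> {1..<n}" and j: "j \<in> {1..<n}" and \<delta>: "\<delta> \<in> {1, lam}" and \<nu>: "\<nu> \<in> {1, lam}" for r j \<delta> \<nu>
    by (simp add: convw[OF VH[OF j \<delta>] VH[OF r \<nu>]] Vw[OF j \<delta>] Vw[OF r \<nu>])
  let ?\<iota> = "Legendre (-1) (int p)"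
  \<comment> \<open>One formula for all products of equal order: with t = p^r v, the coefficients
    a1, a2, a3 are the counts for v of symbol 0, 1 and -1. They are given multiplied by 4, as in
    \<open>sum_class_ind_conv\<close>.\<close>
  have same: "V r \<delta> \<star> V r \<nu> = a1 *\<^sub>C Y (r + 1) + a2 *\<^sub>C V r 1 + a3 *\<^sub>C V r lam"
    if r: "r \<in> {1..<n}" and \<delta>: "\<delta> \<in> {1, lam}" and \<nu>: "\<nu> \<in> {1, lam}"
      and a: "4 * a1 = of_nat p ^ (n - r - 1) * of_int ((int p - 1) * (1 + leg \<delta> * leg \<nu> * ?\<iota>))"
        "4 * a2 = of_nat p ^ (n - r - 1) * of_int (int p - 2 - (leg \<delta> + leg \<nu>) - leg \<delta> * leg \<nu> * ?\<iota>)"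
        "4 * a3 = of_nat p ^ (n - r - 1) * of_int (int p - 2 + (leg \<delta> + leg \<nu>) - leg \<delta> * leg \<nu> * ?\<iota>)"
    for r \<delta> \<nu> a1 a2 a3
  proof (rule eqI)
    have one: "1 \<in> {1, lam}" "lam \<in> {1, lam}" by auto
    show "V r \<delta> \<star> V r \<nu> \<in> ?H" by (intro convH VH r \<delta> \<nu>)
    show "a1 *\<^sub>C Y (r + 1) + a2 *\<^sub>C V r 1 + a3 *\<^sub>C V r lam \<in> ?H"
      by (intro add scale YH VH r one) simp
    show "(V r \<delta> \<star> V r \<nu>) (upw 0, 1) = (a1 *\<^sub>C Y (r + 1) + a2 *\<^sub>C V r 1 + a3 *\<^sub>C V r lam) (upw 0, 1)"
      by (simp add: convVVw[OF r r \<delta> \<nu>] cscale_def Yw Vw[OF r])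
    fix t assume t: "t \<in> S"
    have rr: "1 \<le> r" "r < n" using r by auto
    have Y': "Y (Suc r) (low t, 1) = (if int p ^ Suc r dvd t then 1 else 0)"
      using Yl[of "Suc r" t] rr Sp[OF t] by simp
    have "4 * (V r \<delta> \<star> V r \<nu>) (low t, 1) = of_int (4 * (\<Sum>s\<in>S. class_ind p r (leg \<delta>) s * class_ind p r (leg \<nu>) (t - s)))"
      by (simp only: convVV[OF r r \<delta> \<nu> t] of_int_mult) simp
    also have "\<dots> = 4 * (a1 *\<^sub>C Y (r + 1) + a2 *\<^sub>C V r 1 + a3 *\<^sub>C V r lam) (low t, 1)"
    proof (cases "int p ^ r dvd t")
      case False
      then have "\<not> int p ^ Suc r dvd t" by (metis dvd_mult_right power_Suc)
      then show ?thesis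
        unfolding S_def sum_class_ind_conv[OF pr p(2) c rr sgn[OF \<delta>] sgn[OF \<nu>]]
        using False by (simp add: cscale_def Y' Vl[OF r _ Sp[OF t]] class_ind_def)
    next
      case True
      then obtain v where v: "t = int p ^ r * v" by (elim dvdE)
      have q: "int p ^ r \<noteq> 0" using pr prime_gt_0_nat[of p] by simp
      have Sv: "int p ^ Suc r dvd t \<longleftrightarrow> int p dvd v"
        unfolding v power_Suc2 using q by (simp only: dvd_mult_cancel_left) simp
      have Yv: "Y (Suc r) (low t, 1) = (if int p dvd v then 1 else 0)" by (simp only: Y' Sv)
      have tv: "t div int p ^ r = v" using q by (simp add: v)
      have ci: "class_ind p r e t = (if Legendre v (int p) = e then 1 else 0)" for e
        using True by (simp add: class_ind_def tv)
      have rhs: "4 * (a1 *\<^sub>C Y (r + 1) + a2 *\<^sub>C V r 1 + a3 *\<^sub>C V r lam) (low t, 1)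
        = 4 * a1 * (if int p dvd v then 1 else 0) + 4 * a2 * (if Legendre v (int p) = 1 then 1 else 0)
          + 4 * a3 * (if Legendre v (int p) = -1 then 1 else 0)"
        using ll by (simp add: cscale_def Yv Vl[OF r _ Sp[OF t]] ci algebra_simps)
      consider "Legendre v (int p) = 0" "int p dvd v" | "Legendre v (int p) = 1" "\<not> int p dvd v"
        | "Legendre v (int p) = -1" "\<not> int p dvd v"
        using Legendre_values[of v "int p"] Legendre_eq_0_iff[of v "int p"] by auto
      then show ?thesis
        unfolding rhs S_def sum_class_ind_conv[OF pr p(2) c rr sgn[OF \<delta>] sgn[OF \<nu>]] tv a
        using True by cases (simp_all add: algebra_simps)
    qed
    finally show "(V r \<delta> \<star> V r \<nu>) (low t, 1) = (a1 *\<^sub>C Y (r + 1) + a2 *\<^sub>C V r 1 + a3 *\<^sub>C V r lam) (low t, 1)"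
      by (metis mult_left_cancel zero_neq_numeral)
  qed
  \<comment> \<open>The product is computed with V_j first, so that the summation variable has order
    j and \<open>sum_class_ind_mixed\<close> pulls out the other factor; commutativity gives the
    reverse order.\<close>
  have part_b: "V r \<nu> \<star> V j \<delta> = V j \<delta> \<star> V r \<nu> \<and>
       V j \<delta> \<star> V r \<nu> = ((of_nat p - 1) / 2 * of_nat p ^ (n - j - 1)) *\<^sub>C V r \<nu>"
    if rj: "1 \<le> r" "r < j" "j \<le> n - 1" and \<nu>: "\<nu> \<in> {1, lam}" and \<delta>: "\<delta> \<in> {1, lam}" for r j \<nu> \<delta>
  proof
    have r: "r \<in> {1..<n}" and j: "j \<in> {1..<n}" using rj by auto
    show "V r \<nu> \<star> V j \<delta> = V j \<delta> \<star> V r \<nu>" by (intro comm VH r j \<nu> \<delta>)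
    show "V j \<delta> \<star> V r \<nu> = ((of_nat p - 1) / 2 * of_nat p ^ (n - j - 1)) *\<^sub>C V r \<nu>"
    proof (rule eqI)
      show "V j \<delta> \<star> V r \<nu> \<in> ?H" "((of_nat p - 1) / 2 * of_nat p ^ (n - j - 1)) *\<^sub>C V r \<nu> \<in> ?H"
        by (intro convH scale VH r j \<nu> \<delta>)+
      show "(V j \<delta> \<star> V r \<nu>) (upw 0, 1) = (((of_nat p - 1) / 2 * of_nat p ^ (n - j - 1)) *\<^sub>C V r \<nu>) (upw 0, 1)"
        by (simp add: convVVw[OF r j \<delta> \<nu>] cscale_def Vw[OF r \<nu>])
      fix t assume t: "t \<in> S"
      have "(V j \<delta> \<star> V r \<nu>) (low t, 1) = of_int (class_ind p r (leg \<nu>) t) * of_int (\<Sum>s\<in>S. class_ind p j (leg \<delta>) s)"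
        by (simp only: convVV[OF r j \<delta> \<nu> t] sum_class_ind_mixed[OF pr rj(2)] of_int_mult)
      also have "of_int (\<Sum>s\<in>S. class_ind p j (leg \<delta>) s) = (\<Sum>s\<in>S. V j \<delta> (low s, 1))"
        by (simp add: Vl[OF j \<delta>] Sp)
      finally show "(V j \<delta> \<star> V r \<nu>) (low t, 1) = (((of_nat p - 1) / 2 * of_nat p ^ (n - j - 1)) *\<^sub>C V r \<nu>) (low t, 1)"
        by (simp add: sumV[OF j \<delta>] cscale_def Vl[OF r \<nu> Sp[OF t]])
    qed
  qed
  have part_d: "U0 \<star> V r \<delta> = V r \<delta> \<star> U0 \<and> V r \<delta> \<star> U0 = ((of_nat p - 1) / 2 * of_nat p ^ (n - r - 1)) *\<^sub>C U0"
    if r: "r \<in> {1..<n}" and \<delta>: "\<delta> \<in> {1, lam}" for r \<delta>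
  proof
    show "U0 \<star> V r \<delta> = V r \<delta> \<star> U0" by (intro comm UH VH r \<delta>)
    show "V r \<delta> \<star> U0 = ((of_nat p - 1) / 2 * of_nat p ^ (n - r - 1)) *\<^sub>C U0"
    proof (rule eqI)
      show "V r \<delta> \<star> U0 \<in> ?H" "((of_nat p - 1) / 2 * of_nat p ^ (n - r - 1)) *\<^sub>C U0 \<in> ?H"
        by (intro convH scale UH VH r \<delta>)+
      show "(V r \<delta> \<star> U0) (upw 0, 1) = (((of_nat p - 1) / 2 * of_nat p ^ (n - r - 1)) *\<^sub>C U0) (upw 0, 1)"
        by (simp add: convw[OF VH[OF r \<delta>] UH] Vw[OF r \<delta>] Uw sumV[OF r \<delta>] cscale_def)
      fix t assume t: "t \<in> S"
      show "(V r \<delta> \<star> U0) (low t, 1) = (((of_nat p - 1) / 2 * of_nat p ^ (n - r - 1)) *\<^sub>C U0) (low t, 1)"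
        by (simp add: convl[OF VH[OF r \<delta>] UH t] Vw[OF r \<delta>] Ul Sp t cscale_def)
    qed
  qed
  \<comment> \<open>At y(t) the additive part is 0 and the constant Weyl term \<eta>(-1) p^n
    remains, a multiple of Y_1; at w(1) only \<open>unit_sum\<close> remains.\<close>
  have UU: "U0 \<star> U0 = (\<eta> (-1) * of_nat p ^ n) *\<^sub>C Y 1 + unit_sum \<eta> n *\<^sub>C U0"
  proof (rule eqI)
    show "U0 \<star> U0 \<in> ?H" "(\<eta> (-1) * of_nat p ^ n) *\<^sub>C Y 1 + unit_sum \<eta> n *\<^sub>C U0 \<in> ?H"
      by (intro convH add scale UH YH; simp)+
    show "(U0 \<star> U0) (upw 0, 1) = ((\<eta> (-1) * of_nat p ^ n) *\<^sub>C Y 1 + unit_sum \<eta> n *\<^sub>C U0) (upw 0, 1)"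
      by (simp add: convw[OF UH UH] Uw Ul Sp Yw cscale_def)
    fix t assume t: "t \<in> S"
    show "(U0 \<star> U0) (low t, 1) = ((\<eta> (-1) * of_nat p ^ n) *\<^sub>C Y 1 + unit_sum \<eta> n *\<^sub>C U0) (low t, 1)"
      using Yl[of 1 t] n Sp[OF t] by (simp add: convl[OF UH UH t] Uw Ul Sp t cscale_def)
  qed
  have part_c1: "\<eta> = (\<lambda>_. 1) \<longrightarrow> U0 \<star> U0 = (of_nat p ^ n) *\<^sub>C Y 1 + (of_nat p ^ (n - 1) * (of_nat p - 1)) *\<^sub>C U0"
  proof
    assume "\<eta> = (\<lambda>_. 1)"
    then show "U0 \<star> U0 = (of_nat p ^ n) *\<^sub>C Y 1 + (of_nat p ^ (n - 1) * (of_nat p - 1)) *\<^sub>C U0"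
      using UU unit_sum_trivial[OF odd n0] by (simp add: p)
  qed
  have part_c2: "\<eta> \<noteq> (\<lambda>_. 1) \<longrightarrow> U0 \<star> U0 = (\<eta> (-1) * of_nat p ^ n) *\<^sub>C Y 1"
  proof
    assume "\<eta> \<noteq> (\<lambda>_. 1)"
    then have "unit_sum \<eta> n = 0" using \<eta> unit_sum_legendre[OF odd n0, of c] c by (simp add: p)
    then show "U0 \<star> U0 = (\<eta> (-1) * of_nat p ^ n) *\<^sub>C Y 1"
      using UU by simp
  qed
  have one: "1 \<in> {1, lam}" "lam \<in> {1, lam}" by auto
  have part_a1: "V r 1 \<star> V r 1 = ((of_nat p - 1) / 2 * of_nat p ^ (n - r - 1)) *\<^sub>C Y (r + 1)
         + ((of_nat p - 5) / 4 * of_nat p ^ (n - r - 1)) *\<^sub>C V r 1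
         + ((of_nat p - 1) / 4 * of_nat p ^ (n - r - 1)) *\<^sub>C V r lam \<and>
       V r lam \<star> V r lam = ((of_nat p - 1) / 2 * of_nat p ^ (n - r - 1)) *\<^sub>C Y (r + 1)
         + ((of_nat p - 1) / 4 * of_nat p ^ (n - r - 1)) *\<^sub>C V r 1
         + ((of_nat p - 5) / 4 * of_nat p ^ (n - r - 1)) *\<^sub>C V r lam \<and>
       V r 1 \<star> V r lam = V r lam \<star> V r 1 \<and>
       V r lam \<star> V r 1 = ((of_nat p - 1) / 4 * of_nat p ^ (n - r - 1)) *\<^sub>C (V r 1 + V r lam)"
    if r: "r \<in> {1..<n}" and p4: "p mod 4 = 1" for r
  proof (intro conjI)
    have \<iota>: "?\<iota> = 1" by (rule Legendre_minus_1(1)[OF pr p4])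
    show "V r 1 \<star> V r 1 = ((of_nat p - 1) / 2 * of_nat p ^ (n - r - 1)) *\<^sub>C Y (r + 1)
         + ((of_nat p - 5) / 4 * of_nat p ^ (n - r - 1)) *\<^sub>C V r 1
         + ((of_nat p - 1) / 4 * of_nat p ^ (n - r - 1)) *\<^sub>C V r lam"
      by (rule same[OF r one(1) one(1)]) (simp_all add: \<iota> ll field_simps)
    show "V r lam \<star> V r lam = ((of_nat p - 1) / 2 * of_nat p ^ (n - r - 1)) *\<^sub>C Y (r + 1)
         + ((of_nat p - 1) / 4 * of_nat p ^ (n - r - 1)) *\<^sub>C V r 1
         + ((of_nat p - 5) / 4 * of_nat p ^ (n - r - 1)) *\<^sub>C V r lam"
      by (rule same[OF r one(2) one(2)]) (simp_all add: \<iota> ll field_simps)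
    show "V r 1 \<star> V r lam = V r lam \<star> V r 1" by (intro comm VH r one)
    \<comment> \<open>The two symbols have product -1 and chi(-1) = 1, so the coefficient of Y_(r+1)
      is 0; it is written out to match \<open>same\<close>.\<close>
    have "V r lam \<star> V r 1 = 0 *\<^sub>C Y (r + 1) + ((of_nat p - 1) / 4 * of_nat p ^ (n - r - 1)) *\<^sub>C V r 1
         + ((of_nat p - 1) / 4 * of_nat p ^ (n - r - 1)) *\<^sub>C V r lam"
      by (rule same[OF r one(2) one(1)]) (simp_all add: \<iota> ll field_simps)
    then show "V r lam \<star> V r 1 = ((of_nat p - 1) / 4 * of_nat p ^ (n - r - 1)) *\<^sub>C (V r 1 + V r lam)"
      by (simp add: cfun.scale_right_distrib)
  qed
  have part_a3: "V r 1 \<star> V r 1 = ((of_nat p - 3) / 4 * of_nat p ^ (n - r - 1)) *\<^sub>C V r 1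
         + ((of_nat p + 1) / 4 * of_nat p ^ (n - r - 1)) *\<^sub>C V r lam \<and>
       V r lam \<star> V r lam = ((of_nat p + 1) / 4 * of_nat p ^ (n - r - 1)) *\<^sub>C V r 1
         + ((of_nat p - 3) / 4 * of_nat p ^ (n - r - 1)) *\<^sub>C V r lam \<and>
       V r 1 \<star> V r lam = V r lam \<star> V r 1 \<and>
       V r lam \<star> V r 1 = ((of_nat p - 1) / 2 * of_nat p ^ (n - r - 1)) *\<^sub>C Y (r + 1)
         + ((of_nat p - 3) / 4 * of_nat p ^ (n - r - 1)) *\<^sub>C (V r 1 + V r lam)"
    if r: "r \<in> {1..<n}" and p4: "p mod 4 = 3" for r
  proof (intro conjI)
    have \<iota>: "?\<iota> = -1" by (rule Legendre_minus_1(2)[OF pr p4])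
    \<comment> \<open>Now chi(-1) = -1, so it is the products of equal symbols that lose the Y_(r+1)
      term.\<close>
    have "V r 1 \<star> V r 1 = 0 *\<^sub>C Y (r + 1) + ((of_nat p - 3) / 4 * of_nat p ^ (n - r - 1)) *\<^sub>C V r 1
         + ((of_nat p + 1) / 4 * of_nat p ^ (n - r - 1)) *\<^sub>C V r lam"
      by (rule same[OF r one(1) one(1)]) (simp_all add: \<iota> ll field_simps)
    then show "V r 1 \<star> V r 1 = ((of_nat p - 3) / 4 * of_nat p ^ (n - r - 1)) *\<^sub>C V r 1
         + ((of_nat p + 1) / 4 * of_nat p ^ (n - r - 1)) *\<^sub>C V r lam" by simp
    have "V r lam \<star> V r lam = 0 *\<^sub>C Y (r + 1) + ((of_nat p + 1) / 4 * of_nat p ^ (n - r - 1)) *\<^sub>C V r 1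
         + ((of_nat p - 3) / 4 * of_nat p ^ (n - r - 1)) *\<^sub>C V r lam"
      by (rule same[OF r one(2) one(2)]) (simp_all add: \<iota> ll field_simps)
    then show "V r lam \<star> V r lam = ((of_nat p + 1) / 4 * of_nat p ^ (n - r - 1)) *\<^sub>C V r 1
         + ((of_nat p - 3) / 4 * of_nat p ^ (n - r - 1)) *\<^sub>C V r lam" by simp
    show "V r 1 \<star> V r lam = V r lam \<star> V r 1" by (intro comm VH r one)
    have "V r lam \<star> V r 1 = ((of_nat p - 1) / 2 * of_nat p ^ (n - r - 1)) *\<^sub>C Y (r + 1)
         + ((of_nat p - 3) / 4 * of_nat p ^ (n - r - 1)) *\<^sub>C V r 1
         + ((of_nat p - 3) / 4 * of_nat p ^ (n - r - 1)) *\<^sub>C V r lam"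
      by (rule same[OF r one(2) one(1)]) (simp_all add: \<iota> ll field_simps)
    then show "V r lam \<star> V r 1 = ((of_nat p - 1) / 2 * of_nat p ^ (n - r - 1)) *\<^sub>C Y (r + 1)
         + ((of_nat p - 3) / 4 * of_nat p ^ (n - r - 1)) *\<^sub>C (V r 1 + V r lam)"
      by (simp add: cfun.scale_right_distrib add.assoc)
  qed
  have B: "B = coset_element n \<eta> ` coset_reps n lam"
    unfolding B_def I_def U0_def V_def coset_reps_def by auto
  have mem: "coset_element n \<eta> y \<in> ?H" if "y \<in> coset_reps n lam" for y
    using that
  proof (cases rule: coset_reps_cases)
    case 1
    then show ?thesis using IH by (simp add: I_def)
  next
    case 2
    then show ?thesis using UH by (simp add: U0_def)
  next
    case (3 r \<delta>)
    then show ?thesis using VH by (simp add: V_def)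
  qed
  have van: "f = 0" if f: "f \<in> ?H" and z: "\<And>x. x \<in> coset_reps n lam \<Longrightarrow> f x = 0" for f
    by (rule hecke_space_vanishing[OF odd qc n0 f lam(1) ll]; rule z) (auto simp: coset_reps_def)
  note dual = coset_element_dual[OF odd qc n0 lam(1) ll]
  have inj: "inj_on (coset_element n \<eta>) (coset_reps n lam)"
    and ind: "cfun.independent B" and span: "cfun.span B = ?H"
    unfolding B by (rule dual_basis_functions[OF finite_coset_reps sub]; fact mem dual van)+
  have lam1: "lam \<noteq> 1" using ll by auto
  have "card B = card (coset_reps n lam)" unfolding B by (rule card_image[OF inj])
  then have cardB: "card B = 2 * n" by (simp only: card_coset_reps[OF lam(1) lam1 n0])
  have sp: "cfun.span B = cfun.span ?H" unfolding span by (rule cfun.span_eq_iff[THEN iffD2, OF sub, symmetric])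
  have dim: "cfun.dim ?H = 2 * n" by (simp only: cfun.dim_eq_card[OF sp ind] cardB)
  have alg: "Module.algebra (ring_of_type_algebra :: complex ring) (hecke_algebra \<mu> n \<eta>)"
    by (rule algebra_hecke_algebra[OF odd qc n0 \<mu>])
  show ?thesis
    by (intro conjI ce(1,2) alg sub dim cardB ind span part_c1 part_c2)
      ((intro ballI allI impI, (elim conjE)?,
        (rule ce(3) part_a1 part_a3 part_b part_d; assumption))+)
qed

end
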